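(* Let $T$ be a sublinear operator on $\mathbb{R}^d$, i.e. there is $K\ge1$ with $|T(f+g)|\le K\{|T(f)|+|T(g)|\}$. Let $0<p_0<p<p_1<\infty$ and let $\omega$ be an $A_{p/p_0}$ weight. Suppose that (1) $T$ is bounded on $L^{p_0}(\mathbb{R}^d)$ with $\|T\|_{L^{p_0}\to L^{p_0}}\le C_0$; (2) for every ball $B\subset\mathbb{R}^d$ and every $g\in L^\infty_c(\mathbb{R}^d)$ with $\mathrm{supp}(g)\subset\mathbb{R}^d\setminus4B$, $$\Big(\fint_B|T(g)|^{p_1}\omega\Big)^{1/p_1}\le N\Big\{\Big(\fint_{3B}|T(g)|^{p_0}\Big)^{1/p_0}+\sup_{B'\supset B}\Big(\fint_{B'}|g|^{p_0}\Big)^{1/p_0}\Big\}\Big(\fint_B\omega\Big)^{1/p_1},$$ the supremum being over balls $B'$ containing $B$. Then for every $f\in L^\infty_c(\mathbb{R}^d)$, $$\int_{\mathbb{R}^d}|T(f)|^p\omega\,dx\le C\int_{\mathbb{R}^d}|f|^p\omega\,dx,$$ where $C$ depends only on $d,K,p_0,p_1,p,C_0,N$ and the $A_{p/p_0}$ constant of $\omega$.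
   Context: $L^\infty_c(\mathbb{R}^d)$ is the space of bounded measurable functions with compact support. For $1<q<\infty$, $\omega\ge0$ in $L^1_{loc}$ is an $A_q$ weight if $\fint_B\omega\,(\fint_B\omega^{-1/(q-1)})^{q-1}\le C_\omega$ for all balls $B$ (smallest such $C_\omega$ is the $A_q$ constant). For $B=B(x,r)$, $tB=B(x,tr)$; $\fint$ denotes Lebesgue average. *)

theory Defs
  imports "HOL-Analysis.Analysis"
begin

text \<open>Real power of an extended nonnegative real, with \<open>\<infinity> ^ r = \<infinity>\<close> (used for r > 0).\<close>
definition epow :: "ennreal \<Rightarrow> real \<Rightarrow> ennreal" where
  "epow x r = (if x = \<infinity> then \<infinity> else ennreal (enn2real x powr r))"

definition avg :: "'a::euclidean_space set \<Rightarrow> ('a \<Rightarrow> ennreal) \<Rightarrow> ennreal" where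
  "avg B h = (\<integral>\<^sup>+x\<in>B. h x \<partial>lebesgue) / emeasure lebesgue B"

definition is_ball :: "'a::euclidean_space set \<Rightarrow> bool" where
  "is_ball B \<longleftrightarrow> (\<exists>x r. 0 < r \<and> B = ball x r)"

definition Linf_c :: "('a::euclidean_space \<Rightarrow> real) \<Rightarrow> bool" where
  "Linf_c f \<longleftrightarrow> f \<in> borel_measurable lebesgue \<and>
     (\<exists>M. AE x in lebesgue. \<bar>f x\<bar> \<le> M) \<and>
     (\<exists>S. compact S \<and> (AE x in lebesgue. x \<notin> S \<longrightarrow> f x = 0))"

definition Lp :: "real \<Rightarrow> ('a::euclidean_space \<Rightarrow> real) \<Rightarrow> bool" where
  "Lp p f \<longleftrightarrow> f \<in> borel_measurable lebesgue \<and>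
     (\<integral>\<^sup>+x. ennreal (\<bar>f x\<bar> powr p) \<partial>lebesgue) < \<infinity>"

definition Lp_norm :: "real \<Rightarrow> ('a::euclidean_space \<Rightarrow> real) \<Rightarrow> ennreal" where
  "Lp_norm p f = epow (\<integral>\<^sup>+x. ennreal (\<bar>f x\<bar> powr p) \<partial>lebesgue) (1 / p)"

text \<open>A_q weight with A_q constant at most Cw (1 < q < \<infinity>).  The integrand
  \<open>\<omega>^{-1/(q-1)}\<close> is taken as \<open>\<infinity>\<close> where \<open>\<omega> = 0\<close>.\<close>
definition Aq_weight :: "real \<Rightarrow> real \<Rightarrow> ('a::euclidean_space \<Rightarrow> real) \<Rightarrow> bool" where
  "Aq_weight q Cw \<omega> \<longleftrightarrow>
     (\<forall>x. 0 \<le> \<omega> x) \<and> \<omega> \<in> borel_measurable lebesgue \<and>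
     (\<forall>S. compact S \<longrightarrow> (\<integral>\<^sup>+x\<in>S. ennreal (\<omega> x) \<partial>lebesgue) < \<infinity>) \<and>
     (\<forall>B. is_ball B \<longrightarrow>
        avg B (\<lambda>x. ennreal (\<omega> x)) *
        epow (avg B (\<lambda>x. if \<omega> x = 0 then \<infinity> else ennreal (\<omega> x powr (-1 / (q - 1))))) (q - 1)
        \<le> ennreal Cw)"

end

theory Submission
  imports Defs
begin

text \<open>
  Put \<open>F = |T f|\<^bsup>p\<^sub>0\<^esup>\<close>, \<open>\<phi> = |f|\<^bsup>p\<^sub>0\<^esup>\<close>, \<open>q = p/p\<^sub>0\<close> and let \<open>M\<close> be the uncentred maximal operator over balls.
  On a Whitney ball \<open>B\<close> of \<open>{M F > \<lambda>}\<close> split \<open>f\<close> into its parts inside and outside \<open>4B\<close>. The inner part is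
  controlled by the unweighted bound of \<open>T\<close> and the \<open>A\<^sub>\<infinity>\<close> property of the weight, the outer one by
  hypothesis (2) with exponent \<open>p\<^sub>1 > p\<close>; this yields a good-\<open>\<lambda>\<close> inequality comparing the
  weighted sizes of \<open>{M F > \<alpha>\<lambda>}\<close>, \<open>{M F > \<lambda>}\<close> and \<open>{M \<phi> > \<gamma>\<lambda>}\<close>. To have finite quantities to absorb, it is
  localised to a ball \<open>B\<^sub>0 \<supseteq> supp f\<close> and levels \<open>\<lambda> \<ge> \<lambda>\<^sub>0 \<approx> \<parallel>F\<parallel>\<^sub>1 / |B\<^sub>0|\<close>; the low levels are dominated using
  the \<open>A\<^sub>q\<close> condition on \<open>B\<^sub>0\<close> itself. Muckenhoupt's theorem for \<open>M \<phi>\<close> is obtained by Lerner's argument,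
  which needs no reverse Hoelder inequality.
\<close>

section \<open>Powers and masses\<close>

text \<open>Nothing says beforehand that the weighted norm of \<open>T f\<close> is finite, so the
  good-lambda inequality cannot just be integrated and solved. What is integrated over
  \<open>B0\<close> is the minimum of \<open>M F1\<close> and a height \<open>L\<close>, where
  \<open>F1\<close> is \<open>F\<close> cut off to the four-fold dilation of \<open>B0\<close>. That
  integral is at most \<open>L^q w(B0)\<close>, so absorption is legitimate, and the resulting
  constant depends neither on \<open>L\<close> nor on the radius of \<open>B0\<close>. The outer
  part carries a factor of order \<open>alpha^(-q1)\<close> against the \<open>alpha^q\<close> lost
  by rescaling the level; this is where p < p1 is used. The inner part is small in Lebesgue measure
  only. Its smallness is transferred to the weight by an iteration: a small open set is enlarged
  again and again inside a comparable ball, and each enlargement multiplies the weight by a fixed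
  factor greater than 1. The final constant has to be chosen before \<open>T\<close> and the weight,
  so the intermediate constants are explicit functions of the exponents, the weight constant and the
  dimension.\<close>

lemma epow_ennreal [simp]: "0 \<le> x \<Longrightarrow> epow (ennreal x) r = ennreal (x powr r)"
  by (simp add: epow_def)

lemma epow_top [simp]: "epow top r = top"
  by (simp add: epow_def)

lemma epow_0 [simp]: "epow 0 r = 0"
  by (simp add: epow_def)

lemma epow_1 [simp]: "epow x 1 = x"
  by (cases x) auto

lemma one_epow [simp]: "epow 1 r = 1"
  using epow_ennreal[of 1 r] by simp

lemma epow_eq_top_iff [simp]: "epow x r = top \<longleftrightarrow> x = top"
  by (cases x) auto

lemma epow_less_top_iff [simp]: "epow x r < top \<longleftrightarrow> x < top"
  by (cases x) auto

lemma epow_eq_0_iff [simp]: "epow x r = 0 \<longleftrightarrow> x = 0"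
  by (cases x) auto

lemma epow_mono: "0 \<le> r \<Longrightarrow> x \<le> y \<Longrightarrow> epow x r \<le> epow y r"
  by (cases x; cases y) (auto simp: powr_mono2 top_unique)

lemma epow_mult: "epow (x * y) r = epow x r * epow y r"
proof (cases "x = 0 \<or> y = 0 \<or> x = top \<or> y = top")
  case True
  then show ?thesis by (auto simp: ennreal_mult_eq_top_iff ennreal_mult_top ennreal_top_mult)
next
  case False
  then obtain a b where "x = ennreal a" "y = ennreal b" "0 \<le> a" "0 \<le> b"
    by (metis ennreal_cases)
  then show ?thesis
    by (simp add: ennreal_mult[symmetric] powr_mult)
qed

lemma epow_epow: "epow (epow x r) s = epow x (r * s)"
  by (cases x) (auto simp: powr_powr)

lemma epow_add: "0 \<le> x \<Longrightarrow> epow x (r + s) = epow x r * epow x s"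
  by (cases x) (auto simp: powr_add ennreal_mult)

lemma epow_le_iff: "0 < r \<Longrightarrow> epow x r \<le> y \<longleftrightarrow> x \<le> epow y (1/r)"
proof
  assume r: "0 < r" and "epow x r \<le> y"
  then have "epow (epow x r) (1/r) \<le> epow y (1/r)" by (intro epow_mono) auto
  then show "x \<le> epow y (1/r)" using r by (simp add: epow_epow)
next
  assume r: "0 < r" and "x \<le> epow y (1/r)"
  then have "epow x r \<le> epow (epow y (1/r)) r" by (intro epow_mono) auto
  then show "epow x r \<le> y" using r by (simp add: epow_epow)
qed

lemma measurable_epow [measurable]:
  assumes [measurable]: "f \<in> borel_measurable M"
  shows "(\<lambda>x. epow (f x) r) \<in> borel_measurable M"
  unfolding epow_def by measurable

section \<open>Set integrals as measures, Vitali coverings, layer-cake formula\<close>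

lemma sigma_finite_lebesgue: "sigma_finite_measure (lebesgue :: 'a::euclidean_space measure)"
proof
  show "\<exists>A::'a set set. countable A \<and> A \<subseteq> sets lebesgue \<and> \<Union> A = space lebesgue \<and>
     (\<forall>a\<in>A. emeasure lebesgue a \<noteq> \<infinity>)"
  proof (intro exI[of _ "range (\<lambda>n::nat. ball 0 (real n))"] conjI)
    show "\<Union> (range (\<lambda>n::nat. ball (0::'a) (real n))) = space lebesgue"
      by (auto intro: reals_Archimedean2)
    show "\<forall>a\<in>range (\<lambda>n::nat. ball (0::'a) (real n)). emeasure lebesgue a \<noteq> \<infinity>"
      using emeasure_lborel_ball_finite by (auto simp: less_top)
  qed auto
qed

text \<open>For measurable \<open>u\<close> this is the measure with density \<open>u\<close>. Since
  \<open>u = 1\<close> gives Lebesgue measure, one covering lemma and one maximal operator serve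
  both Lebesgue measure and the weights.\<close>

definition mass :: "('a::euclidean_space \<Rightarrow> ennreal) \<Rightarrow> 'a set \<Rightarrow> ennreal" where
  "mass u A = (\<integral>\<^sup>+x\<in>A. u x \<partial>lebesgue)"

lemma mass_eq_emeasure_density:
  "u \<in> borel_measurable lebesgue \<Longrightarrow> A \<in> sets lebesgue \<Longrightarrow>
    mass u A = emeasure (density lebesgue u) A"
  by (simp add: mass_def emeasure_density)

lemma mass_1: "A \<in> sets lebesgue \<Longrightarrow> mass (\<lambda>_. 1) A = emeasure lebesgue A"
  by (simp add: mass_def)

lemma mass_mono: "A \<subseteq> B \<Longrightarrow> mass u A \<le> mass u B"
  unfolding mass_def by (intro nn_integral_mono mult_left_mono) (auto split: split_indicator)

lemma mass_mono_fun: "(\<And>x. x \<in> A \<Longrightarrow> u x \<le> v x) \<Longrightarrow> mass u A \<le> mass v A"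
  unfolding mass_def by (intro nn_integral_mono) (auto split: split_indicator)

lemma mass_mono_fun_AE: "AE x in lebesgue. x \<in> A \<longrightarrow> u x \<le> v x \<Longrightarrow> mass u A \<le> mass v A"
  unfolding mass_def by (intro nn_integral_mono_AE) (auto split: split_indicator)

lemma mass_add:
  "u \<in> borel_measurable lebesgue \<Longrightarrow> v \<in> borel_measurable lebesgue \<Longrightarrow> A \<in> sets lebesgue \<Longrightarrow>
   mass (\<lambda>x. u x + v x) A = mass u A + mass v A"
  unfolding mass_def by (simp add: distrib_right nn_integral_add)

lemma mass_cmult:
  "u \<in> borel_measurable lebesgue \<Longrightarrow> A \<in> sets lebesgue \<Longrightarrow>
   mass (\<lambda>x. c * u x) A = c * mass u A"
  unfolding mass_def by (simp add: mult.assoc nn_integral_cmult)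

lemma mass_Un_le:
  "u \<in> borel_measurable lebesgue \<Longrightarrow> A \<in> sets lebesgue \<Longrightarrow> B \<in> sets lebesgue \<Longrightarrow>
   mass u (A \<union> B) \<le> mass u A + mass u B"
  by (simp add: mass_eq_emeasure_density emeasure_subadditive)

lemma mass_Un_disjoint:
  "u \<in> borel_measurable lebesgue \<Longrightarrow> A \<in> sets lebesgue \<Longrightarrow> B \<in> sets lebesgue \<Longrightarrow> A \<inter> B = {} \<Longrightarrow>
   mass u (A \<union> B) = mass u A + mass u B"
  by (simp add: mass_eq_emeasure_density plus_emeasure)

lemma mass_empty [simp]: "mass u {} = 0"
  by (simp add: mass_def)

text \<open>The form in which every Vitali selection is used: the \<open>A i\<close> may overlap and
  need only subadditivity, while disjointness of the \<open>B i\<close> lets the right-hand sides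
  add up.\<close>

lemma mass_UN_le_disjoint:
  fixes A B :: "'i \<Rightarrow> 'a::euclidean_space set"
  assumes [measurable]: "u \<in> borel_measurable lebesgue" "v \<in> borel_measurable lebesgue"
    and C: "countable C"
    and A: "\<And>i. i \<in> C \<Longrightarrow> A i \<in> sets lebesgue" and B: "\<And>i. i \<in> C \<Longrightarrow> B i \<in> sets lebesgue"
    and disj: "pairwise (\<lambda>i j. disjnt (B i) (B j)) C"
    and le: "\<And>i. i \<in> C \<Longrightarrow> mass u (A i) \<le> mass v (B i)"
  shows "mass u (\<Union>i\<in>C. A i) \<le> mass v (\<Union>i\<in>C. B i)"
proof -
  \<comment> \<open>Indices outside the range of \<open>to_nat_on C\<close> receive the empty set,
    so finite and infinite \<open>C\<close> are treated alike.\<close>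
  define e where "e = (\<lambda>(X :: _ \<Rightarrow> 'a set) n. if n \<in> to_nat_on C ` C then X (from_nat_into C n) else {})"
  have e_Un: "(\<Union>n. e X n) = (\<Union>i\<in>C. X i)" for X
  proof (intro equalityI subsetI)
    fix x assume "x \<in> (\<Union>n. e X n)"
    then obtain n where "x \<in> e X n" by blast
    then obtain i where "i \<in> C" "x \<in> X (from_nat_into C (to_nat_on C i))"
      unfolding e_def by (metis empty_iff imageE)
    then show "x \<in> (\<Union>i\<in>C. X i)" using C by (metis UN_I from_nat_into_to_nat_on)
  next
    fix x assume "x \<in> (\<Union>i\<in>C. X i)"
    then obtain i where "i \<in> C" "x \<in> X i" by blast
    then have "x \<in> e X (to_nat_on C i)" using C by (simp add: e_def)
    then show "x \<in> (\<Union>n. e X n)" by blast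
  qed
  have e_sets: "range (e X) \<subseteq> sets lebesgue" if "\<And>i. i \<in> C \<Longrightarrow> X i \<in> sets lebesgue" for X
  proof
    fix A assume "A \<in> range (e X)"
    then obtain n where "A = e X n" by blast
    then show "A \<in> sets lebesgue" using that C by (cases "n \<in> to_nat_on C ` C") (fastforce simp: e_def)+
  qed
  have "disjoint_family (e B)"
  proof (unfold disjoint_family_on_def, intro ballI impI)
    fix m n :: nat assume "m \<noteq> n"
    show "e B m \<inter> e B n = {}"
    proof (cases "m \<in> to_nat_on C ` C \<and> n \<in> to_nat_on C ` C")
      case True
      then obtain i j where ij: "i \<in> C" "j \<in> C" "m = to_nat_on C i" "n = to_nat_on C j" by auto
      with \<open>m \<noteq> n\<close> have "i \<noteq> j" by auto
      with ij disj have "B i \<inter> B j = {}" by (auto simp: pairwise_def disjnt_def)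
      then show ?thesis using ij C by (simp add: e_def)
    qed (auto simp: e_def)
  qed
  then have "(\<Sum>n. mass v (e B n)) = mass v (\<Union>i\<in>C. B i)"
    using suminf_emeasure[of "e B" "density lebesgue v"] e_sets[of B, OF B] sets.countable_UN[of "e B" UNIV lebesgue]
    by (simp add: mass_eq_emeasure_density e_Un[of B, symmetric] image_subset_iff)
  moreover have "mass u (\<Union>i\<in>C. A i) \<le> (\<Sum>n. mass u (e A n))"
    using emeasure_subadditive_countably[of "e A" "density lebesgue u"] e_sets[of A, OF A] sets.countable_UN[of "e A" UNIV lebesgue]
    by (simp add: mass_eq_emeasure_density e_Un[of A, symmetric] image_subset_iff)
  moreover have "mass u (e A n) \<le> mass v (e B n)" for n
  proof (cases "n \<in> to_nat_on C ` C")
    case True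
    then obtain i where "i \<in> C" "n = to_nat_on C i" by blast
    then show ?thesis using le C by (simp add: e_def)
  qed (simp add: e_def)
  then have "(\<Sum>n. mass u (e A n)) \<le> (\<Sum>n. mass v (e B n))"
    by (intro suminf_le) auto
  ultimately show ?thesis by simp
qed

lemma mass_incseq_le:
  assumes [measurable]: "u \<in> borel_measurable lebesgue"
    and S: "\<And>n::nat. S n \<in> sets lebesgue" "incseq S" and le: "\<And>n. mass u (S n) \<le> m"
  shows "mass u (\<Union>n. S n) \<le> m"
proof -
  have "mass u (\<Union>n. S n) = emeasure (density lebesgue u) (\<Union>n. S n)"
    using S by (intro mass_eq_emeasure_density) auto
  also have "\<dots> = (SUP n. emeasure (density lebesgue u) (S n))"
    using S by (subst SUP_emeasure_incseq) auto
  also have "\<dots> \<le> m"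
    using S le by (auto intro!: SUP_least simp: mass_eq_emeasure_density)
  finally show ?thesis .
qed

text \<open>Vitali's lemma selects disjoint balls whose five-fold dilations cover the union; the
  \<open>u\<close>-mass of the dilations is paid for by the \<open>v\<close>-mass of the disjoint
  balls themselves.\<close>

lemma mass_UN_balls_le:
  assumes [measurable]: "u \<in> borel_measurable lebesgue" "v \<in> borel_measurable lebesgue"
    and K: "\<And>x r. (x, r) \<in> K \<Longrightarrow> 0 < r \<and> mass u (ball x (5 * r)) \<le> mass v (ball x r)"
  shows "mass u (\<Union>(x, r)\<in>K. ball x r) \<le> mass v (\<Union>(x, r)\<in>K. ball x r)"
proof -
  \<comment> \<open>Vitali's lemma asks for bounded radii; the general case is an increasing
    limit.\<close>
  define S where "S n = (\<Union>(x, r)\<in>{(x, r) \<in> K. r \<le> real n}. ball x r)" for n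
  have "mass u (\<Union>n. S n) \<le> mass v (\<Union>(x, r)\<in>K. ball x r)"
  proof (rule mass_incseq_le)
    show "S n \<in> sets lebesgue" for n
      by (auto simp: S_def split_beta intro!: open_UN lmeasurable_open borel_open sets_completionI_sets)
    show "incseq S" by (force simp: S_def incseq_def)
    fix n
    have K': "0 < snd i" if "i \<in> K" for i
      using K[of "fst i" "snd i"] that by simp
    obtain C where C: "countable C" "C \<subseteq> {(x, r) \<in> K. r \<le> real n}"
       "pairwise (\<lambda>i j. disjnt (ball (fst i) (snd i)) (ball (fst j) (snd j))) C"
       "S n \<subseteq> (\<Union>i\<in>C. ball (fst i) (5 * snd i))"
      by (rule Vitali_covering_lemma_balls
          [where S = "S n" and K = "{(x, r) \<in> K. r \<le> real n}" and a = fst and r = snd and B = "real n"])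
         (use K' in \<open>simp_all add: S_def split_beta\<close>)
    have "mass u (S n) \<le> mass u (\<Union>i\<in>C. ball (fst i) (5 * snd i))"
      using C by (intro mass_mono)
    also have "\<dots> \<le> mass v (\<Union>i\<in>C. ball (fst i) (snd i))"
      using C K by (intro mass_UN_le_disjoint) auto
    also have "\<dots> \<le> mass v (\<Union>(x, r)\<in>K. ball x r)"
      using C by (intro mass_mono) auto
    finally show "mass u (S n) \<le> mass v (\<Union>(x, r)\<in>K. ball x r)" .
  qed simp
  moreover have "(\<Union>n. S n) = (\<Union>(x, r)\<in>K. ball x r)"
    by (auto simp: S_def) (metis real_arch_simple split_conv)
  ultimately show ?thesis by simp
qed

text \<open>The power \<open>t^s\<close> is the integral of its derivative. Infinite
  \<open>y\<close> is included because maximal functions may take the value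
  \<open>\<infinity>\<close>.\<close>

lemma nn_integral_powr_Ioo:
  assumes "0 < s"
  shows "(\<integral>\<^sup>+t. ennreal (s * t powr (s - 1)) * indicator {t. 0 < t \<and> ennreal t < y} t \<partial>lborel) = epow y s"
proof -
  let ?h = "\<lambda>t. ennreal (s * t powr (s - 1))"
  have fin: "(\<integral>\<^sup>+t. ?h t * indicator {0..a} t \<partial>lborel) = ennreal (a powr s)" if "0 \<le> a" for a
  proof -
    have "((\<lambda>t. s * t powr (s - 1)) has_integral (s * (a powr s / s))) {0..a}"
      using has_integral_mult_right[OF has_integral_powr_from_0[of "s - 1" a], of s] that assms by simp
    then have "(\<integral>\<^sup>+t. indicator {0..a} t * ennreal (s * t powr (s - 1)) \<partial>lborel) = ennreal (s * (a powr s / s))"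
      using nn_integral_has_integral_lebesgue[of "{0..a}" "\<lambda>t. s * t powr (s - 1)"] assms
      by (simp add: ennreal_mult' ennreal_indicator)
    then show ?thesis using assms by (simp add: mult.commute)
  qed
  show ?thesis
  proof (cases y)
    case (real a)
    have a: "0 \<le> a" "y = ennreal a" using real by auto
    have "(\<integral>\<^sup>+t. ?h t * indicator {t. 0 < t \<and> ennreal t < y} t \<partial>lborel)
        = (\<integral>\<^sup>+t. ?h t * indicator {0..a} t \<partial>lborel)"
    proof (rule nn_integral_cong_AE)
      have "AE t in lborel. t \<noteq> a" by (rule AE_lborel_singleton)
      then show "AE t in lborel. ?h t * indicator {t. 0 < t \<and> ennreal t < y} t = ?h t * indicator {0..a} t"
        by (rule eventually_mono) (use a in \<open>auto simp: indicator_def ennreal_less_iff\<close>)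
    qed
    then show ?thesis using fin real by simp
  next
    case top
    have "ennreal (real n powr s) \<le> (\<integral>\<^sup>+t. ?h t * indicator {t. 0 < t \<and> ennreal t < y} t \<partial>lborel)" for n
      unfolding fin[of "real n", OF of_nat_0_le_iff, symmetric]
      using top by (intro nn_integral_mono) (auto split: split_indicator)
    moreover have "(SUP n. ennreal (real n powr s)) = top"
    proof (rule ennreal_SUP_eq_top)
      fix m :: nat
      obtain n :: nat where "real m powr (1/s) \<le> real n" using real_arch_simple by blast
      then have "(real m powr (1/s)) powr s \<le> real n powr s" using assms by (intro powr_mono2) auto
      then have "real m \<le> real n powr s" using assms by (simp add: powr_powr)
      then show "\<exists>n\<in>UNIV. of_nat m \<le> ennreal (real n powr s)"
        by (auto intro!: exI[of _ n] simp: ennreal_of_nat_eq_real_of_nat)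
    qed
    ultimately have "top \<le> (\<integral>\<^sup>+t. ?h t * indicator {t. 0 < t \<and> ennreal t < y} t \<partial>lborel)"
      by (metis (no_types, lifting) SUP_least)
    then show ?thesis using top by (simp add: top_unique)
  qed
qed

lemma measurable_mass_superlevel:
  assumes [measurable]: "X \<in> borel_measurable lebesgue" "v \<in> borel_measurable lebesgue"
  shows "(\<lambda>t. mass v {x. ennreal t < X x}) \<in> borel_measurable lborel"
proof -
  interpret L: sigma_finite_measure "lebesgue :: 'a measure" by (rule sigma_finite_lebesgue)
  have "indicator {x. ennreal t < X x} x = indicator {p. ennreal (fst p) < X (snd p)} (t, x)" for x t
    by (auto split: split_indicator)
  then show ?thesis
    unfolding mass_def by (intro L.borel_measurable_nn_integral) (simp add: split_beta)
qed

text \<open>Fubini on the region below the graph of \<open>X\<close>, with respect to the measure of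
  density \<open>v\<close>.\<close>

lemma layer_cake:
  assumes [measurable]: "X \<in> borel_measurable lebesgue" "v \<in> borel_measurable lebesgue" and "0 < s"
  shows "(\<integral>\<^sup>+x. epow (X x) s * v x \<partial>lebesgue) =
    (\<integral>\<^sup>+t. ennreal (s * t powr (s - 1)) * indicator {0<..} t * mass v {x. ennreal t < X x} \<partial>lborel)"
proof -
  interpret L: sigma_finite_measure "lebesgue :: 'a measure" by (rule sigma_finite_lebesgue)
  interpret pair_sigma_finite "lebesgue :: 'a measure" "lborel :: real measure" ..
  let ?f = "\<lambda>x t. ennreal (s * t powr (s - 1)) * indicator {0<..} t * (v x * indicator {x. ennreal t < X x} x)"
  have ind: "indicator {x. ennreal t < X x} x = indicator {p. ennreal (snd p) < X (fst p)} (x, t)" for x t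
    by (auto split: split_indicator)
  have "(\<integral>\<^sup>+t. ennreal (s * t powr (s - 1)) * indicator {0<..} t * mass v {x. ennreal t < X x} \<partial>lborel)
      = (\<integral>\<^sup>+t. (\<integral>\<^sup>+x. ?f x t \<partial>lebesgue) \<partial>lborel)"
    unfolding mass_def by (subst nn_integral_cmult) auto
  also have "\<dots> = (\<integral>\<^sup>+x. (\<integral>\<^sup>+t. ?f x t \<partial>lborel) \<partial>lebesgue)"
    by (rule Fubini') (simp add: ind split_beta)
  also have "\<dots> = (\<integral>\<^sup>+x. epow (X x) s * v x \<partial>lebesgue)"
  proof (rule nn_integral_cong)
    fix x
    have "(\<integral>\<^sup>+t. ?f x t \<partial>lborel) = (\<integral>\<^sup>+t. v x * (ennreal (s * t powr (s - 1)) * indicator {t. 0 < t \<and> ennreal t < X x} t) \<partial>lborel)"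
      by (intro nn_integral_cong) (auto split: split_indicator simp: mult_ac)
    also have "\<dots> = v x * epow (X x) s"
      by (subst nn_integral_cmult) (auto simp: nn_integral_powr_Ioo assms)
    finally show "(\<integral>\<^sup>+t. ?f x t \<partial>lborel) = epow (X x) s * v x" by (simp add: mult.commute)
  qed
  finally show ?thesis ..
qed

section \<open>Maximal functions of doubling densities\<close>

declare emeasure_completion [simp del]

lemma emeasure_lebesgue_ball:
  fixes x :: "'a::euclidean_space"
  assumes "0 \<le> r"
  shows "emeasure lebesgue (ball x r) = ennreal (measure lebesgue (ball (0::'a) 1) * r ^ DIM('a))"
proof -
  have "emeasure lebesgue (ball x r) = ennreal (measure lebesgue (ball x r))"
    using emeasure_lborel_ball_finite[of x r]
    by (subst emeasure_eq_ennreal_measure) (auto simp: emeasure_completion)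
  then show ?thesis using content_ball_conv_unit_ball[OF assms, of x] by (simp add: mult.commute)
qed

lemma emeasure_lebesgue_ball_scale:
  fixes x y :: "'a::euclidean_space"
  assumes "0 \<le> r" "0 \<le> c"
  shows "emeasure lebesgue (ball x (c * r)) = ennreal (c ^ DIM('a)) * emeasure lebesgue (ball y r)"
  using assms by (simp add: emeasure_lebesgue_ball ennreal_mult[symmetric] power_mult_distrib mult_ac)

lemma emeasure_lebesgue_ball_pos: "0 < r \<Longrightarrow> 0 < emeasure lebesgue (ball x r)"
  by (simp add: emeasure_lebesgue_ball content_ball_gt_0_iff)

lemma emeasure_lebesgue_ball_finite: "emeasure lebesgue (ball x r) < top"
  using emeasure_lborel_ball_finite[of x r] by (simp add: emeasure_completion)

lemma ennreal_divide_le_iff: "0 < m \<Longrightarrow> m < top \<Longrightarrow> a / m \<le> t \<longleftrightarrow> a \<le> t * (m::ennreal)"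
proof (cases "a = top \<or> t = top")
  case True
  assume m: "0 < m" "m < top"
  from True show ?thesis
  proof
    assume "a = top"
    with m show ?thesis by (auto simp: ennreal_top_divide top_unique ennreal_mult_eq_top_iff)
  qed (use m in \<open>auto simp: ennreal_top_mult\<close>)
next
  case False
  assume m: "0 < m" "m < top"
  with False obtain a' m' t' where "a = ennreal a'" "m = ennreal m'" "t = ennreal t'" "0 \<le> a'" "0 < m'" "0 \<le> t'"
    by (metis ennreal_cases ennreal_0 less_irrefl order_le_less)
  then show ?thesis by (simp add: divide_ennreal ennreal_mult[symmetric] pos_divide_le_eq)
qed

lemma less_ennreal_divide_iff: "0 < m \<Longrightarrow> m < top \<Longrightarrow> t < a / m \<longleftrightarrow> t * m < (a::ennreal)"
  using ennreal_divide_le_iff[of m a t] by (simp add: not_le[symmetric])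

text \<open>The factor 5 is the dilation in Vitali's lemma. Positive finite mass of balls lets
  inequalities between quotients in \<open>ennreal\<close> be cleared of denominators.\<close>

definition doubling :: "real \<Rightarrow> ('a::euclidean_space \<Rightarrow> ennreal) \<Rightarrow> bool" where
  "doubling D u \<longleftrightarrow> 0 \<le> D \<and> u \<in> borel_measurable lebesgue \<and>
     (\<forall>x r. 0 < r \<longrightarrow> 0 < mass u (ball x r) \<and> mass u (ball x r) < top \<and>
        mass u (ball x (5 * r)) \<le> ennreal D * mass u (ball x r))"

lemma doubling_1: "doubling (5 ^ DIM('a)) (\<lambda>_ :: 'a::euclidean_space. 1)"
  unfolding doubling_def
proof (intro conjI allI impI)
  fix x :: 'a and r :: real
  assume "0 < r"
  then show "mass (\<lambda>_. 1) (ball x (5 * r)) \<le> ennreal (5 ^ DIM('a)) * mass (\<lambda>_. 1) (ball x r)"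
    using emeasure_lebesgue_ball_scale[of r 5 x x] by (simp add: mass_1)
qed (auto simp: mass_1 emeasure_lebesgue_ball_finite emeasure_lebesgue_ball_pos)

text \<open>The uncentred maximal function of the measure with density \<open>g\<close> relative to
  the measure with density \<open>u\<close>. The maximal function of a function \<open>h\<close>
  with respect to \<open>u\<close> is thus \<open>maxf u (\<lambda>x. h x * u x)\<close>, and
  \<open>u = 1\<close> gives the Hardy-Littlewood operator. Membership of \<open>x\<close> in the
  ball already forces \<open>r\<close> to be positive.\<close>

definition maxf :: "('a::euclidean_space \<Rightarrow> ennreal) \<Rightarrow> ('a \<Rightarrow> ennreal) \<Rightarrow> 'a \<Rightarrow> ennreal" where
  "maxf u g x = (SUP (y, r) \<in> {(y, r). x \<in> ball y r}. mass g (ball y r) / mass u (ball y r))"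

lemma maxf_upper: "x \<in> ball y r \<Longrightarrow> mass g (ball y r) / mass u (ball y r) \<le> maxf u g x"
  unfolding maxf_def by (rule SUP_upper2[of "(y, r)"]) auto

lemma maxf_least:
  "(\<And>y r. x \<in> ball y r \<Longrightarrow> mass g (ball y r) / mass u (ball y r) \<le> t) \<Longrightarrow> maxf u g x \<le> t"
  unfolding maxf_def by (rule SUP_least) auto

lemma less_maxf_iff:
  "t < maxf u g x \<longleftrightarrow> (\<exists>y r. x \<in> ball y r \<and> t < mass g (ball y r) / mass u (ball y r))"
  unfolding maxf_def less_SUP_iff by auto

text \<open>A ball that witnesses membership of one of its points does so for all of them. Hence
  superlevel sets are open and of the form that Vitali's lemma covers.\<close>

lemma maxf_superlevel:
  "{x. t < maxf u g x} = (\<Union>(y, r)\<in>{(y, r). 0 < r \<and> t < mass g (ball y r) / mass u (ball y r)}. ball y r)"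
proof -
  have "0 < r" if "x \<in> ball y r" for x y :: 'a and r
    using that by (metis ball_eq_empty empty_iff not_le)
  then show ?thesis by (fastforce simp: less_maxf_iff simp del: mem_ball)
qed

lemma open_maxf_superlevel: "open {x. t < maxf u g x}"
  unfolding maxf_superlevel by (intro open_UN) auto

lemma measurable_ball_lebesgue [measurable]: "ball x r \<in> sets lebesgue"
  by simp

lemma measurable_open_lebesgue: "open S \<Longrightarrow> S \<in> sets lebesgue"
  by (simp add: borel_open)

lemma measurable_maxf [measurable]: "maxf u g \<in> borel_measurable lebesgue"
proof (rule borel_measurableI_greater)
  show "{x \<in> space lebesgue. t < maxf u g x} \<in> sets lebesgue" for t
    using open_maxf_superlevel[of t u g] by (simp add: measurable_open_lebesgue)
qed

section \<open>Weak and strong type bounds\<close>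

lemma doublingD:
  assumes "doubling D u"
  shows "0 \<le> D" "u \<in> borel_measurable lebesgue"
    "0 < r \<Longrightarrow> 0 < mass u (ball x r)" "mass u (ball x r) < top"
    "mass u (ball x (5 * r)) \<le> ennreal D * mass u (ball x r)"
proof -
  show "0 \<le> D" "u \<in> borel_measurable lebesgue" "0 < r \<Longrightarrow> 0 < mass u (ball x r)"
    using assms by (auto simp: doubling_def)
  show "mass u (ball x r) < top" "mass u (ball x (5 * r)) \<le> ennreal D * mass u (ball x r)"
  proof -
    have "mass u (ball x r) < top \<and> mass u (ball x (5 * r)) \<le> ennreal D * mass u (ball x r)"
    proof (cases "0 < r")
      case True
      then show ?thesis using assms unfolding doubling_def by blast
    next
      case False
      then have "ball x r = {}" "ball x (5 * r) = {}"
        by (intro ball_empty; simp)+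
      then show ?thesis by (simp del: ball_eq_empty)
    qed
    then show "mass u (ball x r) < top" "mass u (ball x (5 * r)) \<le> ennreal D * mass u (ball x r)"
      by auto
  qed
qed

text \<open>Each ball in the superlevel set satisfies \<open>t u(B) < g(B)\<close>, and doubling
  pays for the Vitali dilation.\<close>

lemma maxf_weak_type:
  assumes u: "doubling D u" and [measurable]: "g \<in> borel_measurable lebesgue" and t: "0 < t"
  shows "mass u {x. ennreal t < maxf u g x} \<le> ennreal (D / t) * mass g UNIV"
proof -
  note [measurable] = doublingD(2)[OF u]
  have "mass u {x. ennreal t < maxf u g x} \<le> mass (\<lambda>x. ennreal (D / t) * g x)
      (\<Union>(y, r)\<in>{(y, r). 0 < r \<and> ennreal t < mass g (ball y r) / mass u (ball y r)}. ball y r)"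
    unfolding maxf_superlevel
  proof (rule mass_UN_balls_le)
    fix x r assume "(x, r) \<in> {(y, r). 0 < r \<and> ennreal t < mass g (ball y r) / mass u (ball y r)}"
    then have r: "0 < r" and *: "ennreal t * mass u (ball x r) \<le> mass g (ball x r)"
      using less_ennreal_divide_iff[OF doublingD(3)[OF u] doublingD(4)[OF u]] by auto
    have "mass u (ball x (5 * r)) \<le> ennreal D * mass u (ball x r)" by (rule doublingD(5)[OF u])
    also have "\<dots> = ennreal (D / t) * (ennreal t * mass u (ball x r))"
      using t doublingD(1)[OF u] by (simp add: mult.assoc[symmetric] ennreal_mult[symmetric])
    also have "\<dots> \<le> ennreal (D / t) * mass g (ball x r)" by (intro mult_left_mono *) auto
    also have "\<dots> = mass (\<lambda>x. ennreal (D / t) * g x) (ball x r)" by (subst mass_cmult) auto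
    finally show "0 < r \<and> mass u (ball x (5 * r)) \<le> mass (\<lambda>x. ennreal (D / t) * g x) (ball x r)"
      using r by simp
  qed measurable
  also have "\<dots> \<le> mass (\<lambda>x. ennreal (D / t) * g x) UNIV" by (rule mass_mono) simp
  also have "\<dots> = ennreal (D / t) * mass g UNIV" by (subst mass_cmult) auto
  finally show ?thesis .
qed

text \<open>The part of \<open>h\<close> that is at most \<open>t\<close> has
  \<open>u\<close>-averages at most \<open>t\<close>, hence accounts for only half of the level
  \<open>2 t\<close>; the rest must exceed \<open>t\<close> by itself.\<close>

lemma less_maxf_truncate:
  assumes u: "doubling D u" and [measurable]: "h \<in> borel_measurable lebesgue"
    and t: "0 \<le> t" and less: "ennreal (t + t) < maxf u (\<lambda>x. h x * u x) x"
  shows "ennreal t < maxf u (\<lambda>x. h x * u x * indicator {x. ennreal t < h x} x) x"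
proof -
  note [measurable] = doublingD(2)[OF u]
  let ?g = "\<lambda>x. h x * u x * indicator {x. ennreal t < h x} x"
  from less obtain y r where yr: "x \<in> ball y r"
    and gt: "ennreal (t + t) < mass (\<lambda>x. h x * u x) (ball y r) / mass u (ball y r)"
    unfolding less_maxf_iff by blast
  have r: "0 < r" using yr by (metis ball_eq_empty empty_iff not_le)
  note m = doublingD(3)[OF u r, of y] doublingD(4)[OF u, of y r]
  have "ennreal (t + t) * mass u (ball y r) < mass (\<lambda>x. h x * u x) (ball y r)"
    using gt less_ennreal_divide_iff[OF m] by simp
  also have "\<dots> \<le> mass (\<lambda>x. ?g x + ennreal t * u x) (ball y r)"
  proof (rule mass_mono_fun)
    fix x
    show "h x * u x \<le> ?g x + ennreal t * u x"
      by (cases "ennreal t < h x") (auto simp: not_less intro: mult_right_mono)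
  qed
  also have "\<dots> = mass ?g (ball y r) + ennreal t * mass u (ball y r)"
    by (subst mass_add, measurable) (subst mass_cmult, auto)
  finally have "ennreal t * mass u (ball y r) + ennreal t * mass u (ball y r) < mass ?g (ball y r) + ennreal t * mass u (ball y r)"
    using t by (simp only: ennreal_plus distrib_right)
  then have "ennreal t * mass u (ball y r) < mass ?g (ball y r)"
    by (meson add_right_mono not_le)
  then show ?thesis
    unfolding less_maxf_iff using less_ennreal_divide_iff[OF m] yr by blast
qed

text \<open>Marcinkiewicz interpolation between weak type (1,1) and the trivial L-infinity bound: at
  each level the weak type bound is applied only to the part of \<open>h\<close> above half that
  level.\<close>

theorem maxf_strong_type:
  assumes u: "doubling D u" and [measurable]: "h \<in> borel_measurable lebesgue" and s: "1 < s"
  shows "(\<integral>\<^sup>+x. epow (maxf u (\<lambda>x. h x * u x) x) s * u x \<partial>lebesgue)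
    \<le> ennreal (2 * D * s / (s - 1) * 2 powr (s - 1)) * (\<integral>\<^sup>+x. epow (h x) s * u x \<partial>lebesgue)"
proof -
  note [measurable] = doublingD(2)[OF u]
  have D: "0 \<le> D" by (rule doublingD(1)[OF u])
  let ?hu = "\<lambda>x. h x * u x"
  have level: "mass u {x. ennreal t < maxf u ?hu x} \<le>
      ennreal (2 * D / t) * mass ?hu {x. ennreal t < 2 * h x}" if t: "0 < t" for t
  proof -
    let ?g = "\<lambda>x. h x * u x * indicator {x. ennreal (t/2) < h x} x"
    have "mass u {x. ennreal t < maxf u ?hu x} \<le> mass u {x. ennreal (t/2) < maxf u ?g x}"
      using less_maxf_truncate[OF u, of h "t/2"] t by (intro mass_mono) auto
    also have "\<dots> \<le> ennreal (D / (t/2)) * mass ?g UNIV"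
      using t by (intro maxf_weak_type[OF u]) auto
    also have "mass ?g UNIV = mass ?hu {x. ennreal t < 2 * h x}"
    proof -
      have "ennreal (t/2) < h x \<longleftrightarrow> ennreal t < 2 * h x" for x
      proof (cases "h x")
        case (real a)
        have "2 * ennreal a = ennreal (2 * a)" using real by (simp add: ennreal_mult)
        then show ?thesis using real t by (simp add: ennreal_less_iff mult.commute)
      qed (simp add: ennreal_mult_top)
      then show ?thesis by (simp add: mass_def)
    qed
    finally show ?thesis by (simp add: mult.commute)
  qed
  have "(\<integral>\<^sup>+x. epow (maxf u ?hu x) s * u x \<partial>lebesgue) =
      (\<integral>\<^sup>+t. ennreal (s * t powr (s - 1)) * indicator {0<..} t * mass u {x. ennreal t < maxf u ?hu x} \<partial>lborel)"
    using s by (intro layer_cake) auto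
  also have "\<dots> \<le> (\<integral>\<^sup>+t. ennreal (2 * D * s / (s - 1)) *
      (ennreal ((s - 1) * t powr (s - 1 - 1)) * indicator {0<..} t * mass ?hu {x. ennreal t < 2 * h x}) \<partial>lborel)"
  proof (rule nn_integral_mono)
    fix t :: real
    show "ennreal (s * t powr (s - 1)) * indicator {0<..} t * mass u {x. ennreal t < maxf u ?hu x}
      \<le> ennreal (2 * D * s / (s - 1)) *
      (ennreal ((s - 1) * t powr (s - 1 - 1)) * indicator {0<..} t * mass ?hu {x. ennreal t < 2 * h x})"
    proof (cases "0 < t")
      case True
      have "s * t powr (s - 1) * (2 * D / t) = 2 * D * s / (s - 1) * ((s - 1) * t powr (s - 1 - 1))"
        using True s powr_diff[of t "s - 1" 1] by simp
      then have "ennreal (s * t powr (s - 1)) * ennreal (2 * D / t) =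
          ennreal (2 * D * s / (s - 1)) * ennreal ((s - 1) * t powr (s - 1 - 1))"
        using True s D by (simp add: ennreal_mult[symmetric])
      then show ?thesis
        using mult_left_mono[OF level[OF True], of "ennreal (s * t powr (s - 1))"] True
        by (simp add: mult.assoc[symmetric])
    qed simp
  qed
  \<comment> \<open>The layer-cake formula read backwards, for the function \<open>2 h\<close>, the
    density \<open>h u\<close> and the exponent \<open>s - 1\<close>; the factor \<open>h\<close> in
    the density restores the exponent \<open>s\<close>.\<close>
  also have "\<dots> = ennreal (2 * D * s / (s - 1)) * (\<integral>\<^sup>+x. epow (2 * h x) (s - 1) * ?hu x \<partial>lebesgue)"
  proof -
    have "(\<lambda>t. ennreal ((s - 1) * t powr (s - 1 - 1)) * indicator {0<..} t * mass ?hu {x. ennreal t < 2 * h x})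
      \<in> borel_measurable lborel"
      by (intro borel_measurable_times_ennreal measurable_mass_superlevel) auto
    then show ?thesis using s by (subst layer_cake) (auto simp: nn_integral_cmult)
  qed
  also have "\<dots> = ennreal (2 * D * s / (s - 1)) * (\<integral>\<^sup>+x. ennreal (2 powr (s - 1)) * (epow (h x) s * u x) \<partial>lebesgue)"
  proof -
    have "epow (2 * h x) (s - 1) * ?hu x = ennreal (2 powr (s - 1)) * (epow (h x) s * u x)" for x
      using epow_add[of "h x" "s - 1" 1] epow_ennreal[of 2 "s - 1"]
      by (simp add: epow_mult mult_ac)
    then show ?thesis by simp
  qed
  also have "\<dots> = ennreal (2 * D * s / (s - 1) * 2 powr (s - 1)) * (\<integral>\<^sup>+x. epow (h x) s * u x \<partial>lebesgue)"
    using s D by (subst nn_integral_cmult, measurable)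
      (subst mult.assoc[symmetric], subst ennreal_mult[symmetric], auto)
  finally show ?thesis .
qed

section \<open>Muckenhoupt weights\<close>

text \<open>The convex function \<open>x^q\<close> lies above its tangent at \<open>t\<close>; here
  this comes from Young's inequality with exponents \<open>q\<close> and
  \<open>q / (q - 1)\<close>.\<close>

lemma young_powr:
  fixes x t q :: real
  assumes "1 < q" "0 \<le> x" "0 < t"
  shows "q * t powr (q - 1) * x \<le> x powr q + (q - 1) * t powr q"
proof (cases "x = 0")
  case True
  then show ?thesis using assms by simp
next
  case False
  with assms have x: "0 < x" by simp
  have "(x powr q) powr (1 / q) * (t powr q) powr ((q - 1) / q) \<le> (1 / q) * x powr q + ((q - 1) / q) * t powr q"
    using assms x by (intro Youngs_inequality_0) (auto simp: field_simps)
  then have "x * t powr (q - 1) \<le> (1 / q) * x powr q + ((q - 1) / q) * t powr q"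
    using assms x by (simp add: powr_powr)
  then have "q * (x * t powr (q - 1)) \<le> q * ((1 / q) * x powr q + ((q - 1) / q) * t powr q)"
    using assms by (intro mult_left_mono) auto
  then show ?thesis using assms by (simp add: distrib_left mult_ac)
qed

lemma mass_pos:
  assumes [measurable]: "u \<in> borel_measurable lebesgue" and "\<And>x. 0 < u x" "0 < r"
  shows "0 < mass u (ball x r)"
proof -
  have "mass u (ball x r) \<noteq> 0"
  proof
    assume "mass u (ball x r) = 0"
    then have "AE y in lebesgue. u y * indicator (ball x r) y = 0"
      unfolding mass_def by (subst (asm) nn_integral_0_iff_AE) auto
    then have "AE y in lebesgue. y \<notin> ball x r"
      by (rule eventually_mono) (use assms(2) in \<open>auto simp: indicator_def less_le split: if_splits\<close>)
    then have "emeasure lebesgue (ball x r) = 0"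
      by (subst (asm) AE_iff_measurable[OF _ refl]) (auto simp: ball_def)
    then show False using emeasure_lebesgue_ball_pos[OF \<open>0 < r\<close>, of x] by simp
  qed
  then show ?thesis by (simp add: zero_less_iff_neq_zero)
qed

text \<open>This is \<open>c (|5B| / |B|)^q\<close>, which arises by comparing a ball with its
  five-fold dilation.\<close>

definition doubling_const :: "real \<Rightarrow> real \<Rightarrow> nat \<Rightarrow> real" where
  "doubling_const q c d = c * (5 ^ d) powr q"

text \<open>Three factors: \<open>c^(q')\<close> from the pointwise estimate, the strong type
  constant of the weight at exponent \<open>q'\<close>, and that of the dual weight at exponent
  \<open>q\<close>. The dual weight has constant \<open>c^(1/(q-1))\<close>.\<close>

definition maximal_const :: "real \<Rightarrow> real \<Rightarrow> nat \<Rightarrow> real" where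
  "maximal_const q c d = (let q' = q / (q - 1) in
     c powr q' * (2 * doubling_const q c d * q' / (q' - 1) * 2 powr (q' - 1)) *
     (2 * doubling_const q' (c powr (1 / (q - 1))) d * q / (q - 1) * 2 powr (q - 1)))"

text \<open>The weight is assumed to be positive everywhere; this costs nothing since a weight satisfying the
  \<open>A\<^sub>q\<close> condition is either positive or zero almost everywhere.\<close>

locale muckenhoupt =
  fixes q c :: real and w :: "'a::euclidean_space \<Rightarrow> real"
  assumes q: "1 < q" and c: "0 < c"
    and measurable_w [measurable]: "w \<in> borel_measurable lebesgue"
    and w_pos: "0 < w x"
    and mass_w_finite: "mass (\<lambda>x. ennreal (w x)) (ball x r) < top"
    and mass_dual_finite: "mass (\<lambda>x. ennreal (w x powr (-1 / (q - 1)))) (ball x r) < top"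
    and Aq: "0 < r \<Longrightarrow> mass (\<lambda>x. ennreal (w x)) (ball x r) *
          epow (mass (\<lambda>x. ennreal (w x powr (-1 / (q - 1)))) (ball x r)) (q - 1)
        \<le> ennreal c * epow (emeasure lebesgue (ball x r)) q"
begin

abbreviation W :: "'a \<Rightarrow> ennreal" where "W x \<equiv> ennreal (w x)"
abbreviation S :: "'a \<Rightarrow> ennreal" where "S x \<equiv> ennreal (w x powr (-1 / (q - 1)))"

lemma q_div: "(1 - q) / (q - 1) = -1"
  using q by (simp add: field_simps)

lemma mass_W_pos: "0 < r \<Longrightarrow> 0 < mass W (ball x r)"
  by (rule mass_pos) (auto simp: w_pos)

lemma mass_S_pos: "0 < r \<Longrightarrow> 0 < mass S (ball x r)"
  by (rule mass_pos) (auto simp: w_pos less_imp_neq[OF w_pos, symmetric])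

text \<open>Hoelder's inequality for the product of \<open>g w^(1/q)\<close> and
  \<open>w^(-1/q)\<close>. It is obtained by integrating a pointwise Young inequality with a
  parameter \<open>t\<close> and choosing \<open>t\<close> at the end; infinite values of
  \<open>g\<close> are covered.\<close>

lemma mass_powr_le_dual:
  assumes [measurable]: "g \<in> borel_measurable lebesgue" and r: "0 < r"
  shows "epow (mass g (ball x r)) q \<le>
    mass (\<lambda>y. epow (g y) q * W y) (ball x r) * epow (mass S (ball x r)) (q - 1)"
proof -
  let ?B = "ball x r"
  obtain s where s: "mass S ?B = ennreal s" "0 < s"
    using mass_S_pos[OF r, of x] mass_dual_finite[of x r] by (cases "mass S ?B") auto
  define X where "X = mass (\<lambda>y. epow (g y) q * W y) ?B"
  have *: "ennreal (q * t powr (q - 1)) * mass g ?B \<le> X + ennreal ((q - 1) * t powr q * s)" if t: "0 < t" for t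
  proof -
    have "ennreal (q * t powr (q - 1)) * mass g ?B = mass (\<lambda>y. ennreal (q * t powr (q - 1)) * g y) ?B"
      by (subst mass_cmult) auto
    also have "\<dots> \<le> mass (\<lambda>y. epow (g y) q * W y + ennreal ((q - 1) * t powr q) * S y) ?B"
    proof (rule mass_mono_fun)
      fix y
      show "ennreal (q * t powr (q - 1)) * g y \<le> epow (g y) q * W y + ennreal ((q - 1) * t powr q) * S y"
      proof (cases "g y")
        case (real a)
        define v where "v = w y powr (-1 / (q - 1))"
        have v: "0 < v" using w_pos[of y] by (simp add: v_def)
        have wv: "w y = v powr (1 - q)" using w_pos[of y] q by (simp add: v_def powr_powr q_div)
        \<comment> \<open>Young's inequality is used for \<open>a / v\<close> and then multiplied by
          \<open>v\<close>; since \<open>v^(1-q) = w\<close>, exactly the densities \<open>W\<close>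
          and \<open>S\<close> appear.\<close>
        have "q * t powr (q - 1) * (a / v) \<le> (a / v) powr q + (q - 1) * t powr q"
          using young_powr[of q "a / v" t] q real v t by simp
        then have "q * t powr (q - 1) * (a / v) * v \<le> ((a / v) powr q + (q - 1) * t powr q) * v"
          using v by (intro mult_right_mono) auto
        also have "\<dots> = a powr q * w y + (q - 1) * t powr q * v"
          using v real by (simp add: wv distrib_right powr_divide powr_diff)
        finally have "q * t powr (q - 1) * a \<le> a powr q * w y + (q - 1) * t powr q * v"
          using v by simp
        then have "ennreal (q * t powr (q - 1) * a) \<le> ennreal (a powr q * w y + (q - 1) * t powr q * v)"
          by (rule ennreal_leI)
        then show ?thesis
          using real q v w_pos[of y] by (simp add: ennreal_mult[symmetric] v_def less_imp_le)
      next
        case top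
        then show ?thesis using w_pos[of y] by (simp add: ennreal_top_mult)
      qed
    qed
    also have "\<dots> = X + ennreal ((q - 1) * t powr q) * mass S ?B"
      unfolding X_def by (subst mass_add, measurable) (subst mass_cmult, auto)
    also have "\<dots> = X + ennreal ((q - 1) * t powr q * s)"
      using s q by (simp add: ennreal_mult)
    finally show ?thesis .
  qed
  have "epow (mass g ?B) q \<le> X * ennreal (s powr (q - 1))"
  proof (cases X)
    case (real a)
    have "mass g ?B \<noteq> top"
      using *[of 1] q real by (auto simp: ennreal_mult_top top_unique)
    then obtain b where b: "mass g ?B = ennreal b" "0 \<le> b" by (cases "mass g ?B") auto
    show ?thesis
    proof (cases "b = 0")
      case False
      then have "0 < b" using b by simp
      \<comment> \<open>The optimal parameter, the ratio of the masses of \<open>g\<close> and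
        \<open>S\<close>.\<close>
      define t where "t = b / s"
      have t: "0 < t" "b = t * s" using \<open>0 < b\<close> s by (auto simp: t_def)
      have "ennreal (q * t powr (q - 1) * b) \<le> ennreal (a + (q - 1) * t powr q * s)"
        using *[OF t(1)] real b q s by (simp add: ennreal_mult[symmetric])
      then have "q * t powr (q - 1) * b \<le> a + (q - 1) * t powr q * s"
        using real q s by (subst (asm) ennreal_le_iff) auto
      moreover have "t powr (q - 1) * b = t powr q * s"
        using t by (simp add: powr_diff)
      ultimately have "t powr q * s \<le> a" by (simp add: mult.assoc left_diff_distrib)
      then have "(t powr q * s) * s powr (q - 1) \<le> a * s powr (q - 1)" by (intro mult_right_mono) auto
      moreover have "(t powr q * s) * s powr (q - 1) = b powr q"
        using t s by (simp add: powr_diff powr_mult)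
      ultimately show ?thesis using real b by (simp add: ennreal_mult[symmetric] ennreal_leI)
    qed (use b in simp)
  qed (use s in \<open>simp add: ennreal_top_mult\<close>)
  then show ?thesis using s by (simp add: X_def)
qed

text \<open>Hoelder followed by the \<open>A_q\<close> condition. In other words, averaging over a
  ball is bounded on \<open>L^q(w)\<close> uniformly in the ball.\<close>

lemma mass_powr_le:
  assumes [measurable]: "g \<in> borel_measurable lebesgue" and r: "0 < r"
  shows "epow (mass g (ball x r)) q * mass W (ball x r) \<le>
    ennreal c * epow (emeasure lebesgue (ball x r)) q * mass (\<lambda>y. epow (g y) q * W y) (ball x r)"
proof -
  let ?B = "ball x r" and ?X = "mass (\<lambda>y. epow (g y) q * W y) (ball x r)"
  have "epow (mass g ?B) q * mass W ?B \<le> (?X * epow (mass S ?B) (q - 1)) * mass W ?B"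
    by (intro mult_right_mono mass_powr_le_dual) (use r in auto)
  also have "\<dots> = ?X * (mass W ?B * epow (mass S ?B) (q - 1))" by (simp add: mult_ac)
  also have "\<dots> \<le> ?X * (ennreal c * epow (emeasure lebesgue ?B) q)"
    by (intro mult_left_mono Aq r) auto
  finally show ?thesis by (simp add: mult_ac)
qed

text \<open>The averaging bound tested on an indicator: a subset that is not small in volume is not
  small in weight.\<close>

lemma emeasure_powr_le:
  assumes [measurable]: "A \<in> sets lebesgue" and A: "A \<subseteq> ball x r" and r: "0 < r"
  shows "epow (emeasure lebesgue A) q * mass W (ball x r) \<le>
    ennreal c * epow (emeasure lebesgue (ball x r)) q * mass W A"
proof -
  have "mass (indicator A) (ball x r) = emeasure lebesgue A"
    unfolding mass_def using A by (simp add: nn_integral_indicator[symmetric] indicator_inter_arith[symmetric] Int_absorb2 del: nn_integral_indicator)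
  moreover have "mass (\<lambda>y. epow (indicator A y) q * W y) (ball x r) = mass W A"
    unfolding mass_def using A by (intro nn_integral_cong) (auto split: split_indicator)
  ultimately show ?thesis
    using mass_powr_le[of "indicator A", OF _ r, of x] by simp
qed

definition D :: real where "D = doubling_const q c DIM('a)"

lemma D_pos: "0 < D"
  using c by (simp add: D_def doubling_const_def)

lemma doubling_W: "doubling D W"
  unfolding doubling_def
proof (intro conjI allI impI)
  fix x :: 'a and r :: real
  assume r: "0 < r"
  show "0 < mass W (ball x r)" "mass W (ball x r) < top"
    using r by (auto simp: mass_W_pos mass_w_finite)
  obtain n where n: "emeasure lebesgue (ball x r) = ennreal n" "0 < n"
    using emeasure_lebesgue_ball_pos[OF r, of x] emeasure_lebesgue_ball_finite[of x r]
    by (cases "emeasure lebesgue (ball x r)") auto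
  have "ennreal (n powr q) * mass W (ball x (5 * r)) \<le>
      ennreal c * epow (emeasure lebesgue (ball x (5 * r))) q * mass W (ball x r)"
    using emeasure_powr_le[of "ball x r" x "5 * r"] r n by (auto simp: subset_ball)
  also have "epow (emeasure lebesgue (ball x (5 * r))) q = ennreal ((5 ^ DIM('a)) powr q * n powr q)"
    using r n by (subst emeasure_lebesgue_ball_scale[of r 5 x x]) (auto simp: ennreal_mult[symmetric] powr_mult)
  finally have "ennreal (n powr q) * mass W (ball x (5 * r)) \<le> ennreal (n powr q) * (ennreal D * mass W (ball x r))"
    using c by (simp add: D_def doubling_const_def ennreal_mult mult_ac)
  then show "mass W (ball x (5 * r)) \<le> ennreal D * mass W (ball x r)"
    using n by (subst (asm) ennreal_mult_le_mult_iff) auto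
qed (use D_pos in auto)

text \<open>The defining inequality raised to the power \<open>1 / (q - 1)\<close> is the same
  condition with \<open>W\<close> and \<open>S\<close> exchanged, because
  \<open>q / (q - 1) - 1 = 1 / (q - 1)\<close>.\<close>

lemma dual: "muckenhoupt (q / (q - 1)) (c powr (1 / (q - 1))) (\<lambda>x. w x powr (-1 / (q - 1)))"
proof
  have *: "-1 / (q / (q - 1) - 1) = - (q - 1)" using q by (simp add: field_simps)
  have **: "(w x powr (-1 / (q - 1))) powr (-1 / (q / (q - 1) - 1)) = w x" for x
    unfolding * using w_pos[of x] q by (simp add: powr_powr q_div)
  have q': "q / (q - 1) - 1 = 1 / (q - 1)" using q by (simp add: field_simps)
  show "1 < q / (q - 1)" "0 < c powr (1 / (q - 1))" using q c by auto
  show "0 < w x powr (-1 / (q - 1))" for x using w_pos[of x] by simp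
  show "mass S (ball x r) < top" for x r by (rule mass_dual_finite)
  show "mass (\<lambda>x. ennreal ((w x powr (-1 / (q - 1))) powr (-1 / (q / (q - 1) - 1)))) (ball x r) < top" for x r
    unfolding ** by (rule mass_w_finite)
  show "mass S (ball x r) * epow (mass (\<lambda>x. ennreal ((w x powr (-1 / (q - 1))) powr (-1 / (q / (q - 1) - 1)))) (ball x r)) (q / (q - 1) - 1)
       \<le> ennreal (c powr (1 / (q - 1))) * epow (emeasure lebesgue (ball x r)) (q / (q - 1))"
    if "0 < r" for x r
    using epow_mono[OF _ Aq[OF that, of x], of "1 / (q - 1)"] q c
    unfolding ** unfolding q' by (simp add: epow_mult epow_epow mult.commute)
qed measurable

text \<open>The pointwise estimate behind Lerner's proof of Muckenhoupt's theorem: it trades \<open>maxf (\<lambda>_. 1)\<close> for maximal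
  functions that are bounded merely because \<open>W\<close> and \<open>S\<close> are doubling.\<close>

lemma maxf_powr_le:
  assumes [measurable]: "f \<in> borel_measurable lebesgue"
  shows "epow (maxf (\<lambda>_. 1) f x) (q - 1) \<le> ennreal c * maxf W (\<lambda>y. epow (maxf S f y) (q - 1)) x"
proof -
  let ?R = "ennreal c * maxf W (\<lambda>y. epow (maxf S f y) (q - 1)) x"
  have "maxf (\<lambda>_. 1) f x \<le> epow ?R (1 / (q - 1))"
  proof (rule maxf_least)
    fix y r assume x: "x \<in> ball y r"
    then have r: "0 < r" by (metis ball_eq_empty empty_iff not_le)
    let ?B = "ball y r"
    obtain n where n: "emeasure lebesgue ?B = ennreal n" "0 < n"
      using emeasure_lebesgue_ball_pos[OF r, of y] emeasure_lebesgue_ball_finite[of y r]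
      by (cases "emeasure lebesgue ?B") auto
    obtain a where a: "mass W ?B = ennreal a" "0 < a"
      using mass_W_pos[OF r, of y] mass_w_finite[of y r] by (cases "mass W ?B") auto
    obtain s where s: "mass S ?B = ennreal s" "0 < s"
      using mass_S_pos[OF r, of y] mass_dual_finite[of y r] by (cases "mass S ?B") auto
    have "ennreal (a * s powr (q - 1)) \<le> ennreal (c * n powr q)"
      using Aq[OF r, of y] n a s c by (simp add: ennreal_mult)
    then have *: "a * s powr (q - 1) \<le> c * n powr q" using c by (subst (asm) ennreal_le_iff) auto
    \<comment> \<open>The \<open>A_q\<close> condition solved for the average of the dual weight;
      the factor \<open>n / a\<close> later turns a Lebesgue average into a
      \<open>W\<close>-average.\<close>
    have sn: "(s / n) powr (q - 1) \<le> c * (n / a)"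
      using * a s n by (simp add: powr_divide powr_diff field_simps)
    define t where "t = mass f ?B / mass S ?B"
    have "mass f ?B = t * ennreal s"
      unfolding t_def using s ennreal_divide_times[of "mass f ?B" "ennreal s" "ennreal s"] by simp
    then have ft: "mass f ?B / mass (\<lambda>_. 1) ?B = t * ennreal (s / n)"
      using n s by (simp add: mass_1 divide_ennreal[symmetric] ennreal_times_divide)
    \<comment> \<open>The number \<open>t\<close> is below \<open>maxf S f\<close> at every point of
      the ball, so the constant \<open>t^(q-1)\<close> may be replaced by a function before
      averaging.\<close>
    have "epow t (q - 1) * ennreal n = mass (\<lambda>_. epow t (q - 1)) ?B"
      using n by (simp add: mass_def nn_integral_cmult)
    also have "\<dots> \<le> mass (\<lambda>y. epow (maxf S f y) (q - 1)) ?B"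
      unfolding t_def using q by (intro mass_mono_fun epow_mono maxf_upper) auto
    finally have "epow t (q - 1) * ennreal n / mass W ?B \<le> mass (\<lambda>y. epow (maxf S f y) (q - 1)) ?B / mass W ?B"
      by (rule divide_right_mono_ennreal)
    also have "\<dots> \<le> maxf W (\<lambda>y. epow (maxf S f y) (q - 1)) x" by (rule maxf_upper[OF x])
    finally have M: "epow t (q - 1) * ennreal (n / a) \<le> maxf W (\<lambda>y. epow (maxf S f y) (q - 1)) x"
      using a n by (simp add: divide_ennreal[symmetric] ennreal_times_divide)
    have "epow (mass f ?B / mass (\<lambda>_. 1) ?B) (q - 1) = epow t (q - 1) * ennreal ((s / n) powr (q - 1))"
      unfolding ft using s n by (simp add: epow_mult)
    also have "\<dots> \<le> epow t (q - 1) * ennreal (c * (n / a))" by (intro mult_left_mono ennreal_leI sn) simp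
    also have "\<dots> = ennreal c * (epow t (q - 1) * ennreal (n / a))"
      using c n a by (subst ennreal_mult) (auto simp: mult_ac)
    also have "\<dots> \<le> ?R" by (intro mult_left_mono M) simp
    finally show "mass f ?B / mass (\<lambda>_. 1) ?B \<le> epow ?R (1 / (q - 1))"
      using q by (subst (asm) epow_le_iff) auto
  qed
  then show ?thesis using q by (subst epow_le_iff) auto
qed

definition CM :: real where "CM = maximal_const q c DIM('a)"

text \<open>The pointwise estimate is raised to the power \<open>q / (q - 1)\<close>; then the
  strong type bound is applied for \<open>W\<close> at that exponent and for \<open>S\<close> at the
  exponent \<open>q\<close>.\<close>

theorem maxf_bounded:
  assumes [measurable]: "f \<in> borel_measurable lebesgue"
  shows "(\<integral>\<^sup>+x. epow (maxf (\<lambda>_. 1) f x) q * W x \<partial>lebesgue) \<le>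
    ennreal CM * (\<integral>\<^sup>+x. epow (f x) q * W x \<partial>lebesgue)"
proof -
  interpret dual: muckenhoupt "q / (q - 1)" "c powr (1 / (q - 1))" "\<lambda>x. w x powr (-1 / (q - 1))"
    by (rule dual)
  let ?q' = "q / (q - 1)"
  have q': "1 < ?q'" "(q - 1) * ?q' = q" using q by auto
  define C1 where "C1 = 2 * D * ?q' / (?q' - 1) * 2 powr (?q' - 1)"
  define C2 where "C2 = 2 * dual.D * q / (q - 1) * 2 powr (q - 1)"
  have C12: "0 \<le> C1" "0 \<le> C2" using q q' D_pos dual.D_pos by (auto simp: C1_def C2_def)
  \<comment> \<open>Dividing by the densities puts both maximal functions into the form that
    \<open>maxf_strong_type\<close> expects.\<close>
  define h where "h y = epow (maxf S f y) (q - 1) * ennreal (1 / w y)" for y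
  define k where "k y = f y * ennreal (1 / w y powr (-1 / (q - 1)))" for y
  have [measurable]: "h \<in> borel_measurable lebesgue" "k \<in> borel_measurable lebesgue"
    unfolding h_def k_def by measurable
  have hW: "h y * W y = epow (maxf S f y) (q - 1)" for y
    using w_pos[of y] by (simp add: h_def mult.assoc ennreal_mult[symmetric])
  have kS: "k y * S y = f y" for y
    using w_pos[of y] by (simp add: k_def mult.assoc ennreal_mult[symmetric])
  \<comment> \<open>The exponents fit: \<open>1 - q' = -1 / (q - 1)\<close>, so the integral left by
    the first strong type bound is the one that the second bound estimates.\<close>
  have eq1: "epow (h y) ?q' * W y = epow (maxf S f y) q * S y" for y
  proof -
    have "(1 / w y) powr ?q' * w y = w y powr (-1 / (q - 1))"
    proof -
      have "(1 / w y) powr ?q' * w y = w y powr (1 - ?q')"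
        using w_pos[of y] by (simp add: powr_divide powr_diff)
      also have "1 - ?q' = -1 / (q - 1)" using q by (simp add: field_simps)
      finally show ?thesis .
    qed
    then show ?thesis
      using w_pos[of y] q' by (simp add: h_def epow_mult epow_epow mult.assoc ennreal_mult[symmetric])
  qed
  have eq2: "epow (k y) q * S y = epow (f y) q * W y" for y
  proof -
    define v where "v = w y powr (-1 / (q - 1))"
    have v: "0 < v" using w_pos[of y] by (simp add: v_def)
    have wv: "w y = v powr (1 - q)" using w_pos[of y] q by (simp add: v_def powr_powr q_div)
    have "(1 / v) powr q * v = w y" using v by (simp add: wv powr_divide powr_diff)
    moreover have "k y = f y * ennreal (1 / v)" "S y = ennreal v" by (simp_all add: k_def v_def)
    ultimately show ?thesis
      using v by (simp add: epow_mult mult.assoc ennreal_mult[symmetric])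
  qed
  have "(\<integral>\<^sup>+x. epow (maxf (\<lambda>_. 1) f x) q * W x \<partial>lebesgue) \<le>
      (\<integral>\<^sup>+x. ennreal (c powr ?q') * (epow (maxf W (\<lambda>y. h y * W y) x) ?q' * W x) \<partial>lebesgue)"
  proof (rule nn_integral_mono)
    fix x
    have "epow (epow (maxf (\<lambda>_. 1) f x) (q - 1)) ?q' \<le>
        epow (ennreal c * maxf W (\<lambda>y. epow (maxf S f y) (q - 1)) x) ?q'"
      using q' by (intro epow_mono maxf_powr_le) auto
    then have "epow (maxf (\<lambda>_. 1) f x) q \<le> ennreal (c powr ?q') * epow (maxf W (\<lambda>y. h y * W y) x) ?q'"
      using q' c by (simp add: epow_epow epow_mult hW)
    then show "epow (maxf (\<lambda>_. 1) f x) q * W x \<le>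
        ennreal (c powr ?q') * (epow (maxf W (\<lambda>y. h y * W y) x) ?q' * W x)"
      by (simp add: mult.assoc[symmetric] mult_right_mono)
  qed
  also have "\<dots> = ennreal (c powr ?q') * (\<integral>\<^sup>+x. epow (maxf W (\<lambda>y. h y * W y) x) ?q' * W x \<partial>lebesgue)"
    by (rule nn_integral_cmult) measurable
  also have "\<dots> \<le> ennreal (c powr ?q') * (ennreal C1 * (\<integral>\<^sup>+x. epow (h x) ?q' * W x \<partial>lebesgue))"
    unfolding C1_def by (intro mult_left_mono maxf_strong_type doubling_W q') auto
  also have "(\<integral>\<^sup>+x. epow (h x) ?q' * W x \<partial>lebesgue) = (\<integral>\<^sup>+x. epow (maxf S (\<lambda>y. k y * S y) x) q * S x \<partial>lebesgue)"
    by (simp only: eq1 kS)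
  also have "\<dots> \<le> ennreal C2 * (\<integral>\<^sup>+x. epow (k x) q * S x \<partial>lebesgue)"
    unfolding C2_def by (intro maxf_strong_type dual.doubling_W q) auto
  also have "(\<integral>\<^sup>+x. epow (k x) q * S x \<partial>lebesgue) = (\<integral>\<^sup>+x. epow (f x) q * W x \<partial>lebesgue)"
    by (simp only: eq2)
  finally have "(\<integral>\<^sup>+x. epow (maxf (\<lambda>_. 1) f x) q * W x \<partial>lebesgue) \<le>
     ennreal (c powr ?q') * (ennreal C1 * (ennreal C2 * (\<integral>\<^sup>+x. epow (f x) q * W x \<partial>lebesgue)))"
    by (simp add: mult_left_mono)
  also have "\<dots> = ennreal CM * (\<integral>\<^sup>+x. epow (f x) q * W x \<partial>lebesgue)"
  proof -
    have "CM = c powr ?q' * C1 * C2"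
      by (simp only: CM_def D_def dual.D_def maximal_const_def C1_def C2_def Let_def)
    then show ?thesis using C12 by (simp only: ennreal_mult mult_nonneg_nonneg powr_ge_zero mult.assoc)
  qed
  finally show ?thesis .
qed

end

section \<open>Lebesgue points and the A-infinity property\<close>

text \<open>The half of Lebesgue's differentiation theorem that is required. For fixed
  \<open>t\<close> let \<open>A\<close> be the set where \<open>maxf F \<le> t < F\<close>. Vitali's
  theorem covers \<open>A\<close> up to a null set by disjoint balls centred in \<open>A\<close>,
  inside an open set barely larger than \<open>A\<close>. On each of them \<open>F\<close> has mass
  at most \<open>t\<close> times the volume, so \<open>F\<close> has mass at most
  \<open>t |A|\<close> on \<open>A\<close>, and \<open>A\<close> is null.\<close>

theorem AE_le_maxf:
  fixes F :: "'a::euclidean_space \<Rightarrow> ennreal"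
  assumes [measurable]: "F \<in> borel_measurable lebesgue" and fin: "mass F UNIV < top"
  shows "AE x in lebesgue. F x \<le> maxf (\<lambda>_. 1) F x"
proof -
  have null: "AE x in lebesgue. \<not> (maxf (\<lambda>_. 1) F x \<le> ennreal t \<and> ennreal t < F x)" if t: "0 < t" for t
  proof -
    define A where "A = {x. maxf (\<lambda>_. 1) F x \<le> ennreal t \<and> ennreal t < F x}"
    have [measurable]: "A \<in> sets lebesgue"
    proof -
      have "{x \<in> space lebesgue. maxf (\<lambda>_. 1) F x \<le> ennreal t \<and> ennreal t < F x} \<in> sets lebesgue"
        by measurable
      then show ?thesis by (simp add: A_def)
    qed
    have "mass (\<lambda>_. ennreal t) A \<le> mass F A"
      by (rule mass_mono_fun) (auto simp: A_def)
    also have "\<dots> \<le> mass F UNIV" by (rule mass_mono) simp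
    finally have "mass (\<lambda>_. ennreal t) A < top" using fin by simp
    then have tA: "ennreal t * emeasure lebesgue A < top"
      by (simp add: mass_def nn_integral_cmult)
    have le: "mass F A \<le> ennreal t * emeasure lebesgue A + ennreal (t * e)" if e: "0 < e" for e
    proof -
      obtain U where U: "open U" "A \<subseteq> U" "U - A \<in> lmeasurable" "emeasure lebesgue (U - A) < ennreal e"
        using sets_lebesgue_outer_open[OF \<open>A \<in> sets lebesgue\<close> e] by blast
      have [measurable]: "U \<in> sets lebesgue" using U by auto
      define K where "K = {(x, r). x \<in> A \<and> 0 < r \<and> ball x r \<subseteq> U}"
      obtain C where C: "countable C" "C \<subseteq> K"
          "pairwise (\<lambda>i j. disjnt (ball (fst i) (snd i)) (ball (fst j) (snd j))) C"
          "negligible (A - (\<Union>i\<in>C. ball (fst i) (snd i)))"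
      proof (rule Vitali_covering_theorem_balls[where S = A and K = K and a = fst and r = snd])
        fix x :: 'a and d :: real assume "x \<in> A" "0 < d"
        then obtain r where r: "0 < r" "ball x r \<subseteq> U" using U open_contains_ball by blast
        have "ball x (min r (d/2)) \<subseteq> U" using r by (meson min.cobounded1 order_trans subset_ball)
        then show "\<exists>i. i \<in> K \<and> x \<in> ball (fst i) (snd i) \<and> snd i < d"
          using \<open>x \<in> A\<close> \<open>0 < d\<close> r by (intro exI[of _ "(x, min r (d/2))"]) (auto simp: K_def)
      qed blast
      let ?U = "\<Union>i\<in>C. ball (fst i) (snd i)"
      have [measurable]: "?U \<in> sets lebesgue"
        by (rule measurable_open_lebesgue) (intro open_UN; simp)
      have "AE x in lebesgue. x \<notin> A - ?U"
        by (intro AE_not_in) (use C(4) in \<open>simp add: negligible_iff_null_sets\<close>)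
      then have "mass F A \<le> mass F ?U"
        unfolding mass_def by (intro nn_integral_mono_AE) (auto split: split_indicator elim: eventually_mono)
      also have "\<dots> \<le> mass (\<lambda>_. ennreal t) ?U"
      proof (rule mass_UN_le_disjoint)
        fix i assume "i \<in> C"
        with C have i: "fst i \<in> A" "0 < snd i" by (auto simp: K_def)
        have "mass F (ball (fst i) (snd i)) / mass (\<lambda>_. 1) (ball (fst i) (snd i)) \<le> maxf (\<lambda>_. 1) F (fst i)"
          using i by (intro maxf_upper) simp
        also have "\<dots> \<le> ennreal t" using i by (simp add: A_def)
        finally have "mass F (ball (fst i) (snd i)) \<le> ennreal t * mass (\<lambda>_. 1) (ball (fst i) (snd i))"
          using i doubling_1 by (subst (asm) ennreal_divide_le_iff) (auto intro: doublingD)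
        then show "mass F (ball (fst i) (snd i)) \<le> mass (\<lambda>_. ennreal t) (ball (fst i) (snd i))"
          by (simp add: mass_def nn_integral_cmult)
      qed (use C in auto)
      also have "\<dots> = ennreal t * emeasure lebesgue ?U"
        by (simp add: mass_def nn_integral_cmult)
      also have "\<dots> \<le> ennreal t * (emeasure lebesgue A + ennreal e)"
      proof (intro mult_left_mono)
        have "emeasure lebesgue ?U \<le> emeasure lebesgue (A \<union> (U - A))"
        proof (intro emeasure_mono)
          have "ball (fst i) (snd i) \<subseteq> U" if "i \<in> C" for i
          proof -
            have "i \<in> K" using that C(2) by blast
            then show ?thesis unfolding K_def by (simp add: split_beta)
          qed
          then show "?U \<subseteq> A \<union> (U - A)" by blast
        qed auto
        also have "\<dots> \<le> emeasure lebesgue A + emeasure lebesgue (U - A)"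
          by (intro emeasure_subadditive) auto
        also have "\<dots> \<le> emeasure lebesgue A + ennreal e"
          using U by (intro add_left_mono) auto
        finally show "emeasure lebesgue ?U \<le> emeasure lebesgue A + ennreal e" .
      qed simp
      finally show ?thesis using t e by (simp add: distrib_left ennreal_mult)
    qed
    have "mass F A \<le> ennreal t * emeasure lebesgue A"
    proof (rule ennreal_le_epsilon)
      fix e :: real assume "0 < e"
      then show "mass F A \<le> ennreal t * emeasure lebesgue A + ennreal e"
        using le[of "e / t"] t by simp
    qed
    moreover have "mass F A = ennreal t * emeasure lebesgue A + mass (\<lambda>x. F x - ennreal t) A"
    proof -
      have "mass F A = mass (\<lambda>x. ennreal t + (F x - ennreal t)) A"
        unfolding mass_def
        by (intro nn_integral_cong) (auto simp: A_def less_imp_le add_diff_inverse_ennreal split: split_indicator)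
      also have "\<dots> = mass (\<lambda>_. ennreal t) A + mass (\<lambda>x. F x - ennreal t) A"
        by (rule mass_add) measurable
      finally show ?thesis by (simp add: mass_def nn_integral_cmult)
    qed
    \<comment> \<open>Cancelling relies on \<open>t |A|\<close> being finite. The excess
      \<open>F - t\<close>, positive on \<open>A\<close>, then has zero integral there.\<close>
    ultimately have "mass (\<lambda>x. F x - ennreal t) A = 0"
      using tA by (cases "mass (\<lambda>x. F x - ennreal t) A"; cases "ennreal t * emeasure lebesgue A")
        (auto simp: ennreal_plus[symmetric] top_unique simp del: ennreal_plus)
    then have "AE x in lebesgue. (F x - ennreal t) * indicator A x = 0"
      unfolding mass_def by (subst (asm) nn_integral_0_iff_AE) auto
    then show ?thesis
      by (rule eventually_mono) (auto simp: A_def indicator_def diff_eq_0_iff_ennreal split: if_splits)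
  qed
  have "AE x in lebesgue. \<forall>r::rat. 0 < real_of_rat r \<longrightarrow>
      \<not> (maxf (\<lambda>_. 1) F x \<le> ennreal (real_of_rat r) \<and> ennreal (real_of_rat r) < F x)"
    unfolding AE_all_countable using null by auto
  then show ?thesis
  proof (rule eventually_mono)
    fix x
    assume *: "\<forall>r::rat. 0 < real_of_rat r \<longrightarrow>
      \<not> (maxf (\<lambda>_. 1) F x \<le> ennreal (real_of_rat r) \<and> ennreal (real_of_rat r) < F x)"
    show "F x \<le> maxf (\<lambda>_. 1) F x"
    proof (rule ccontr)
      assume "\<not> F x \<le> maxf (\<lambda>_. 1) F x"
      then obtain r :: rat where r: "maxf (\<lambda>_. 1) F x < ennreal (real_of_rat r)" "ennreal (real_of_rat r) < F x"
        using ennreal_rat_dense[of "maxf (\<lambda>_. 1) F x" "F x"] by (auto simp: not_le)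
      then have "0 < ennreal (real_of_rat r)" using le_less_trans zero_le by blast
      then show False using * r by (auto simp: less_imp_le)
    qed
  qed
qed

text \<open>The number \<open>a\<close> is the radius of a ball with at least the volume of
  \<open>E\<close>. Starting from a ball inside \<open>E\<close>, the radius is doubled until
  \<open>E\<close> fills at most half; the radius just before that gives the lower bound on the
  proportion.\<close>

lemma exists_half_density_ball:
  fixes E :: "'a::euclidean_space set"
  assumes "open E" "x \<in> E" and a: "0 < a"
    and E: "emeasure lebesgue E \<le> ennreal (measure lebesgue (ball (0::'a) 1) * a ^ DIM('a))"
  shows "\<exists>r. 0 < r \<and> 2 * emeasure lebesgue (E \<inter> ball x r) \<le> emeasure lebesgue (ball x r) \<and>
    emeasure lebesgue (ball x r) \<le> ennreal (2 * 2 ^ DIM('a)) * emeasure lebesgue (E \<inter> ball x r)"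
proof -
  let ?V = "measure lebesgue (ball (0::'a) 1)"
  have [measurable]: "E \<in> sets lebesgue" using assms by auto
  obtain d where d: "0 < d" "ball x d \<subseteq> E" using assms open_contains_ball by blast
  define P where "P k \<longleftrightarrow> 2 * emeasure lebesgue (E \<inter> ball x (2 ^ k * d)) \<le> emeasure lebesgue (ball x (2 ^ k * d))" for k :: nat
  have "\<exists>k. P k"
  proof -
    \<comment> \<open>Beyond radius \<open>2 a\<close> the ball has at least \<open>2^d\<close>
      times the allowed volume of \<open>E\<close>, so the doubling stops.\<close>
    obtain k :: nat where k: "2 * a / d < 2 ^ k" using real_arch_pow[of 2 "2 * a / d"] by auto
    have "2 * emeasure lebesgue (E \<inter> ball x (2 ^ k * d)) \<le> ennreal 2 * ennreal (?V * a ^ DIM('a))"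
      using E by (intro mult_mono order.trans[OF emeasure_mono E]) auto
    also have "\<dots> = ennreal (?V * (2 * a ^ DIM('a)))"
      using a by (subst ennreal_mult[symmetric]) (auto simp: mult_ac)
    also have "\<dots> \<le> ennreal (?V * (2 ^ k * d) ^ DIM('a))"
    proof (intro ennreal_leI mult_left_mono)
      have "2 * a ^ DIM('a) \<le> 2 ^ DIM('a) * a ^ DIM('a)"
        using a power_increasing[of 1 "DIM('a)" "2::real"] by (intro mult_right_mono) (auto simp: Suc_leI)
      also have "\<dots> = (2 * a) ^ DIM('a)" by (simp add: power_mult_distrib)
      also have "\<dots> \<le> (2 ^ k * d) ^ DIM('a)"
        using k a d by (intro power_mono) (auto simp: field_simps)
      finally show "2 * a ^ DIM('a) \<le> (2 ^ k * d) ^ DIM('a)" .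
    qed simp
    also have "\<dots> = emeasure lebesgue (ball x (2 ^ k * d))"
      using d by (simp add: emeasure_lebesgue_ball)
    finally show ?thesis unfolding P_def by blast
  qed
  define k where "k = (LEAST k. P k)"
  have Pk: "P k" unfolding k_def using \<open>\<exists>k. P k\<close> by (rule LeastI_ex)
  \<comment> \<open>The initial ball lies in \<open>E\<close>, so the stopping index has a
    predecessor.\<close>
  have "\<not> P 0"
  proof
    assume "P 0"
    then have "2 * emeasure lebesgue (ball x d) \<le> emeasure lebesgue (ball x d)"
      using d by (simp add: P_def Int_absorb1)
    then show False
      using emeasure_lebesgue_ball_pos[OF d(1), of x] emeasure_lebesgue_ball_finite[of x d]
      by (cases "emeasure lebesgue (ball x d)") (auto simp: ennreal_mult[symmetric] simp flip: ennreal_numeral)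
  qed
  with Pk obtain j where j: "k = Suc j" by (cases k) auto
  then have "\<not> P j" using not_less_Least[of j P] by (simp add: k_def)
  have "emeasure lebesgue (ball x (2 ^ k * d)) = ennreal (2 ^ DIM('a)) * emeasure lebesgue (ball x (2 ^ j * d))"
    using emeasure_lebesgue_ball_scale[of "2 ^ j * d" 2 x x] d j by (simp add: mult.assoc)
  also have "\<dots> \<le> ennreal (2 ^ DIM('a)) * (2 * emeasure lebesgue (E \<inter> ball x (2 ^ j * d)))"
    using \<open>\<not> P j\<close> by (intro mult_left_mono) (auto simp: P_def)
  also have "\<dots> \<le> ennreal (2 ^ DIM('a)) * (2 * emeasure lebesgue (E \<inter> ball x (2 ^ k * d)))"
    using j d by (intro mult_left_mono emeasure_mono Int_mono subset_ball) auto
  also have "\<dots> = ennreal (2 * 2 ^ DIM('a)) * emeasure lebesgue (E \<inter> ball x (2 ^ k * d))"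
    by (simp add: ennreal_mult mult_ac)
  finally show ?thesis
    using Pk d unfolding P_def by (intro exI[of _ "2 ^ k * d"]) auto
qed

text \<open>This constant less 1 is the doubling constant times the factor of
  \<open>mass_W_le_half\<close>; it will bound \<open>w(E1)\<close> by \<open>w(E1 - E)\<close>. The
  added 1 puts \<open>(CA - 1) / CA\<close> strictly between 0 and 1.\<close>

definition Ainfty_const :: "real \<Rightarrow> real \<Rightarrow> nat \<Rightarrow> real" where
  "Ainfty_const q c d = doubling_const q c d * (2 powr q * c) + 1"

context muckenhoupt
begin

definition CA :: real where "CA = Ainfty_const q c DIM('a)"

lemma CA_gt_1: "1 < CA"
  using D_pos c by (simp add: CA_def D_def Ainfty_const_def)

text \<open>The complement of \<open>E\<close> in the ball has at least half its volume, so
  \<open>emeasure_powr_le\<close> applies to it with ratio at least 1/2.\<close>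

lemma mass_W_le_half:
  assumes [measurable]: "E \<in> sets lebesgue" and r: "0 < r"
    and half: "2 * emeasure lebesgue (E \<inter> ball x r) \<le> emeasure lebesgue (ball x r)"
  shows "mass W (ball x r) \<le> ennreal (2 powr q * c) * mass W (ball x r - E)"
proof -
  let ?B = "ball x r"
  obtain n where n: "emeasure lebesgue ?B = ennreal n" "0 < n"
    using emeasure_lebesgue_ball_pos[OF r, of x] emeasure_lebesgue_ball_finite[of x r]
    by (cases "emeasure lebesgue ?B") auto
  have "emeasure lebesgue (?B \<inter> E) + emeasure lebesgue (?B - E) = emeasure lebesgue ?B"
    by (subst plus_emeasure) (auto intro!: arg_cong[of _ _ "emeasure lebesgue"])
  then have le: "emeasure lebesgue ?B \<le> 2 * emeasure lebesgue (?B - E)"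
    and fin: "emeasure lebesgue (?B - E) < top"
    using half n
    by (cases "emeasure lebesgue (?B \<inter> E)"; cases "emeasure lebesgue (?B - E)";
        simp add: Int_commute ennreal_mult[symmetric] flip: ennreal_plus ennreal_numeral)+
  then obtain m where m: "emeasure lebesgue (?B - E) = ennreal m" "0 \<le> m" "n \<le> 2 * m"
    using n by (cases "emeasure lebesgue (?B - E)") (auto simp: ennreal_mult[symmetric] simp flip: ennreal_numeral)
  have "0 < m" using m n by simp
  have "ennreal (m powr q) * mass W ?B \<le> ennreal c * ennreal (n powr q) * mass W (?B - E)"
    using emeasure_powr_le[of "?B - E" x r] r n m by auto
  also have "\<dots> \<le> ennreal c * ennreal ((2 * m) powr q) * mass W (?B - E)"
    using n m q by (intro mult_right_mono mult_left_mono ennreal_leI powr_mono2) auto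
  also have "\<dots> = ennreal (m powr q) * (ennreal (2 powr q * c) * mass W (?B - E))"
    using m c by (simp add: powr_mult ennreal_mult mult_ac)
  finally show ?thesis
    using \<open>0 < m\<close> by (subst (asm) ennreal_mult_le_mult_iff) auto
qed

text \<open>Every point of \<open>E\<close> is the centre of a ball which \<open>E\<close> fills up to a proportion between \<open>2\<^bsup>-d-1\<^esup>\<close> and
  \<open>1/2\<close>. The union \<open>E1\<close> of a Vitali subfamily of such balls, dilated, has Lebesgue measure comparable to
  that of \<open>E\<close>, but a larger weighted mass because half of each ball lies outside \<open>E\<close>.\<close>

lemma expand_open_set:
  assumes "open E" and sub: "E \<subseteq> ball x0 s" and a: "0 < a"
    and E: "emeasure lebesgue E \<le> ennreal (measure lebesgue (ball (0::'a) 1) * a ^ DIM('a))"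
  shows "\<exists>E1. open E1 \<and> E1 \<subseteq> ball x0 (s + 20 * a) \<and>
    emeasure lebesgue E1 \<le> ennreal (measure lebesgue (ball (0::'a) 1) * (20 * a) ^ DIM('a)) \<and>
    mass W E \<le> ennreal ((CA - 1) / CA) * mass W E1"
proof -
  let ?V = "measure lebesgue (ball (0::'a) 1)"
  have V: "0 < ?V" using content_ball_pos[of 1 "0::'a"] by simp
  have [measurable]: "E \<in> sets lebesgue" using assms by auto
  obtain r where r: "\<And>x. x \<in> E \<Longrightarrow> 0 < r x"
    "\<And>x. x \<in> E \<Longrightarrow> 2 * emeasure lebesgue (E \<inter> ball x (r x)) \<le> emeasure lebesgue (ball x (r x))"
    "\<And>x. x \<in> E \<Longrightarrow> emeasure lebesgue (ball x (r x)) \<le> ennreal (2 * 2 ^ DIM('a)) * emeasure lebesgue (E \<inter> ball x (r x))"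
    using exists_half_density_ball[OF assms(1) _ a E] by metis
  \<comment> \<open>Comparing volumes, \<open>r^d \<le> 2 (2 a)^d \<le> (4 a)^d\<close>. Together
    with the Vitali dilation this is the origin of \<open>20 * a\<close>.\<close>
  have r4: "r x \<le> 4 * a" if x: "x \<in> E" for x
  proof -
    have "ennreal (?V * r x ^ DIM('a)) = emeasure lebesgue (ball x (r x))"
      using r(1)[OF x] by (simp add: emeasure_lebesgue_ball)
    also have "\<dots> \<le> ennreal (2 * 2 ^ DIM('a)) * ennreal (?V * a ^ DIM('a))"
      using r(3)[OF x] by (rule order.trans) (intro mult_left_mono order.trans[OF emeasure_mono E], auto)
    also have "\<dots> = ennreal (?V * (2 * (2 * a) ^ DIM('a)))"
      using a by (simp add: ennreal_mult[symmetric] power_mult_distrib mult_ac)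
    finally have "?V * r x ^ DIM('a) \<le> ?V * (2 * (2 * a) ^ DIM('a))"
      using a by (subst (asm) ennreal_le_iff) auto
    then have "r x ^ DIM('a) \<le> 2 * (2 * a) ^ DIM('a)" using V by simp
    also have "\<dots> \<le> 2 ^ DIM('a) * (2 * a) ^ DIM('a)"
      using a power_increasing[of 1 "DIM('a)" "2::real"] by (intro mult_right_mono) (auto simp: Suc_leI)
    also have "\<dots> = (4 * a) ^ DIM('a)" unfolding power_mult_distrib[symmetric] by simp
    finally have "\<not> (4 * a) ^ DIM('a) < r x ^ DIM('a)" by simp
    then show ?thesis using a power_strict_mono[of "4 * a" "r x" "DIM('a)"] by fastforce
  qed
  obtain C where C: "countable C" "C \<subseteq> E"
     "pairwise (\<lambda>i j. disjnt (ball i (r i)) (ball j (r j))) C"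
     "E \<subseteq> (\<Union>i\<in>C. ball i (5 * r i))"
  proof (rule Vitali_covering_lemma_balls[where S = E and K = E and a = "\<lambda>x. x" and r = r and B = "4 * a"])
    show "E \<subseteq> (\<Union>i\<in>E. ball i (r i))" using r(1) by force
  qed (use r(1) r4 in auto)
  define E1 where "E1 = (\<Union>i\<in>C. ball i (5 * r i))"
  have "open E1" unfolding E1_def by auto
  then have [measurable]: "E1 \<in> sets lebesgue" by auto
  have sub1: "E1 \<subseteq> ball x0 (s + 20 * a)"
  proof
    fix y assume "y \<in> E1"
    then obtain i where i: "i \<in> C" "dist i y < 5 * r i" by (auto simp: E1_def)
    then have "i \<in> E" using C by auto
    then have "dist x0 i < s" "r i \<le> 4 * a" using sub r4 by auto
    then show "y \<in> ball x0 (s + 20 * a)" using i dist_triangle[of x0 y i] by simp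
  qed
  \<comment> \<open>Dilation costs \<open>5^d\<close> and the density bound \<open>2 * 2^d\<close>;
    the product \<open>2 * 10^d\<close> is at most \<open>20^d\<close>, so the factor 20 serves for
    the volume as well.\<close>
  have "mass (\<lambda>_. 1) E1 \<le> mass (\<lambda>_. ennreal (2 * 10 ^ DIM('a))) (\<Union>i\<in>C. E \<inter> ball i (r i))"
    unfolding E1_def
  proof (rule mass_UN_le_disjoint)
    show "pairwise (\<lambda>i j. disjnt (E \<inter> ball i (r i)) (E \<inter> ball j (r j))) C"
      using C(3) by (rule pairwise_mono) (auto simp: disjnt_def)
    fix i assume "i \<in> C"
    then have i: "i \<in> E" using C by auto
    have "mass (\<lambda>_. 1) (ball i (5 * r i)) = ennreal (5 ^ DIM('a)) * emeasure lebesgue (ball i (r i))"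
      using emeasure_lebesgue_ball_scale[of "r i" 5 i i] r(1)[OF i] by (simp add: mass_1)
    also have "\<dots> \<le> ennreal (5 ^ DIM('a)) * (ennreal (2 * 2 ^ DIM('a)) * emeasure lebesgue (E \<inter> ball i (r i)))"
      by (intro mult_left_mono r i) auto
    also have "\<dots> = ennreal (2 * 10 ^ DIM('a)) * emeasure lebesgue (E \<inter> ball i (r i))"
    proof -
      have "(5::real) ^ DIM('a) * (2 * 2 ^ DIM('a)) = 2 * (5 ^ DIM('a) * 2 ^ DIM('a))" by simp
      also have "\<dots> = 2 * 10 ^ DIM('a)" unfolding power_mult_distrib[symmetric] by simp
      finally have eq: "(5::real) ^ DIM('a) * (2 * 2 ^ DIM('a)) = 2 * 10 ^ DIM('a)" .
      show ?thesis
        unfolding eq[symmetric] by (subst ennreal_mult) (auto simp: mult.assoc)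
    qed
    finally show "mass (\<lambda>_. 1) (ball i (5 * r i)) \<le> mass (\<lambda>_. ennreal (2 * 10 ^ DIM('a))) (E \<inter> ball i (r i))"
      by (simp add: mass_def nn_integral_cmult)
  qed (use C in auto)
  also have "\<dots> \<le> mass (\<lambda>_. ennreal (2 * 10 ^ DIM('a))) E"
    by (rule mass_mono) auto
  also have "\<dots> \<le> ennreal (2 * 10 ^ DIM('a)) * ennreal (?V * a ^ DIM('a))"
    using E by (simp add: mass_def nn_integral_cmult mult_left_mono)
  also have "\<dots> = ennreal (?V * (2 * 10 ^ DIM('a) * a ^ DIM('a)))"
    using a by (simp add: ennreal_mult[symmetric] mult_ac)
  also have "\<dots> \<le> ennreal (?V * (20 * a) ^ DIM('a))"
  proof (intro ennreal_leI mult_left_mono)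
    have "2 * 10 ^ DIM('a) * a ^ DIM('a) \<le> 2 ^ DIM('a) * 10 ^ DIM('a) * a ^ DIM('a)"
      using a power_increasing[of 1 "DIM('a)" "2::real"] by (intro mult_right_mono) (auto simp: Suc_leI)
    also have "\<dots> = (20 * a) ^ DIM('a)" unfolding power_mult_distrib[symmetric] by simp
    finally show "2 * 10 ^ DIM('a) * a ^ DIM('a) \<le> (20 * a) ^ DIM('a)" .
  qed simp
  finally have E1: "emeasure lebesgue E1 \<le> ennreal (?V * (20 * a) ^ DIM('a))"
    by (simp add: mass_1)
  have "mass W E1 \<le> mass (\<lambda>x. ennreal (CA - 1) * W x) (\<Union>i\<in>C. ball i (r i) - E)"
    unfolding E1_def
  proof (rule mass_UN_le_disjoint)
    show "pairwise (\<lambda>i j. disjnt (ball i (r i) - E) (ball j (r j) - E)) C"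
      using C(3) by (rule pairwise_mono) (auto simp: disjnt_def)
    fix i assume "i \<in> C"
    then have i: "i \<in> E" using C by auto
    have "mass W (ball i (5 * r i)) \<le> ennreal D * mass W (ball i (r i))"
      by (rule doublingD(5)[OF doubling_W])
    also have "\<dots> \<le> ennreal D * (ennreal (2 powr q * c) * mass W (ball i (r i) - E))"
      by (intro mult_left_mono mass_W_le_half r i) auto
    also have "\<dots> = mass (\<lambda>x. ennreal (CA - 1) * W x) (ball i (r i) - E)"
      using D_pos c by (subst mass_cmult) (auto simp: CA_def D_def Ainfty_const_def ennreal_mult mult.assoc)
    finally show "mass W (ball i (5 * r i)) \<le> mass (\<lambda>x. ennreal (CA - 1) * W x) (ball i (r i) - E)" .
  qed (use C in auto)
  also have "\<dots> \<le> mass (\<lambda>x. ennreal (CA - 1) * W x) (E1 - E)"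
  proof (rule mass_mono)
    have "ball i (r i) \<subseteq> E1" if "i \<in> C" for i
    proof -
      have "ball i (r i) \<subseteq> ball i (5 * r i)" using r(1)[of i] C that by (intro subset_ball) auto
      then show ?thesis using that unfolding E1_def by blast
    qed
    then show "(\<Union>i\<in>C. ball i (r i) - E) \<subseteq> E1 - E" by blast
  qed
  also have "\<dots> = ennreal (CA - 1) * mass W (E1 - E)"
    by (rule mass_cmult) measurable
  finally have *: "mass W E1 \<le> ennreal (CA - 1) * mass W (E1 - E)" .
  have "E \<subseteq> E1" using C(4) by (simp add: E1_def)
  then have add: "mass W E + mass W (E1 - E) = mass W E1"
    by (subst mass_Un_disjoint[symmetric]) (auto simp: Un_absorb1 Un_Diff_cancel)
  have "mass W E1 < top"
    using mass_mono[OF sub1, of W] mass_w_finite le_less_trans by blast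
  then obtain u v where uv: "mass W E = ennreal u" "mass W (E1 - E) = ennreal v" "0 \<le> u" "0 \<le> v"
    using add by (cases "mass W E"; cases "mass W (E1 - E)") auto
  have E1uv: "mass W E1 = ennreal (u + v)" using uv add by simp
  \<comment> \<open>Since \<open>E1 - E\<close> holds a fixed share of \<open>w(E1)\<close>, only
    the complementary share is left for \<open>E\<close>.\<close>
  have "u + v \<le> (CA - 1) * v"
    using * uv CA_gt_1 unfolding E1uv by (simp add: ennreal_mult[symmetric] del: ennreal_plus)
  then have "CA * u \<le> (CA - 1) * (u + v)"
    by (simp add: algebra_simps) (use uv in linarith)
  then have "u \<le> (CA - 1) / CA * (u + v)"
    using CA_gt_1 by (simp add: field_simps)
  then have "mass W E \<le> ennreal ((CA - 1) / CA) * mass W E1"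
    using uv CA_gt_1 unfolding E1uv by (simp add: ennreal_mult[symmetric] ennreal_leI del: ennreal_plus)
  then show ?thesis using \<open>open E1\<close> sub1 E1 by blast
qed

text \<open>Induction by \<open>expand_open_set\<close>: each step multiplies \<open>a\<close> by 20
  and gains a factor \<open>(CA - 1) / CA\<close>.\<close>

lemma mass_W_small_aux:
  assumes "open E" "E \<subseteq> ball x0 s" "0 < a"
    and "emeasure lebesgue E \<le> ennreal (measure lebesgue (ball (0::'a) 1) * a ^ DIM('a))"
  shows "mass W E \<le> ennreal (((CA - 1) / CA) ^ n) * mass W (ball x0 (s + 40 ^ n * a))"
  using assms
proof (induction n arbitrary: E s a)
  case 0
  have "E \<subseteq> ball x0 (s + a)" using 0 subset_ball[of s "s + a" x0] by simp
  then show ?case by (simp add: mass_mono)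
next
  case (Suc n)
  obtain E1 where E1: "open E1" "E1 \<subseteq> ball x0 (s + 20 * a)"
    "emeasure lebesgue E1 \<le> ennreal (measure lebesgue (ball (0::'a) 1) * (20 * a) ^ DIM('a))"
    "mass W E \<le> ennreal ((CA - 1) / CA) * mass W E1"
    using expand_open_set[OF Suc.prems] by blast
  have "mass W E1 \<le> ennreal (((CA - 1) / CA) ^ n) * mass W (ball x0 (s + 20 * a + 40 ^ n * (20 * a)))"
    using E1 Suc.prems by (intro Suc.IH) auto
  also have "\<dots> \<le> ennreal (((CA - 1) / CA) ^ n) * mass W (ball x0 (s + 40 ^ Suc n * a))"
  proof (intro mult_left_mono mass_mono subset_ball)
    \<comment> \<open>The enlargements \<open>20 a\<close> and \<open>40^n * 20 a\<close> together
      fit into \<open>40^(n+1) a\<close>, hence 40 rather than 20.\<close>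
    have "20 * a * 1 \<le> 20 * a * 40 ^ n" using Suc.prems by (intro mult_left_mono one_le_power) auto
    then show "s + 20 * a + 40 ^ n * (20 * a) \<le> s + 40 ^ Suc n * a" by simp
  qed simp
  finally have "ennreal ((CA - 1) / CA) * mass W E1 \<le>
    ennreal ((CA - 1) / CA) * (ennreal (((CA - 1) / CA) ^ n) * mass W (ball x0 (s + 40 ^ Suc n * a)))"
    by (intro mult_left_mono) auto
  also have "\<dots> = ennreal (((CA - 1) / CA) ^ Suc n) * mass W (ball x0 (s + 40 ^ Suc n * a))"
    using CA_gt_1 by (subst mult.assoc[symmetric]) (simp add: ennreal_mult[symmetric])
  finally show ?case using E1(4) order.trans by blast
qed

text \<open>The quantitative A-infinity property. The choice \<open>a = r / 40^n\<close> makes the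
  accumulated radius equal to \<open>2 r\<close>, and doubling returns to the original ball.\<close>

theorem mass_W_small:
  assumes "open E" "E \<subseteq> ball x r" "0 < r"
    and "emeasure lebesgue E \<le> ennreal (1 / (40 ^ n) ^ DIM('a)) * emeasure lebesgue (ball x r)"
  shows "mass W E \<le> ennreal (((CA - 1) / CA) ^ n * D) * mass W (ball x r)"
proof -
  have "ennreal (1 / (40 ^ n) ^ DIM('a)) * emeasure lebesgue (ball x r) =
     ennreal (measure lebesgue (ball (0::'a) 1) * (r / 40 ^ n) ^ DIM('a))"
    using \<open>0 < r\<close> by (simp add: emeasure_lebesgue_ball ennreal_mult[symmetric] power_divide)
  then have "mass W E \<le> ennreal (((CA - 1) / CA) ^ n) * mass W (ball x (r + 40 ^ n * (r / 40 ^ n)))"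
    using assms by (intro mass_W_small_aux) auto
  also have "\<dots> \<le> ennreal (((CA - 1) / CA) ^ n) * mass W (ball x (5 * r))"
    using \<open>0 < r\<close> by (intro mult_left_mono mass_mono subset_ball) auto
  also have "\<dots> \<le> ennreal (((CA - 1) / CA) ^ n) * (ennreal D * mass W (ball x r))"
    by (intro mult_left_mono doublingD(5)[OF doubling_W]) auto
  also have "\<dots> = ennreal (((CA - 1) / CA) ^ n * D) * mass W (ball x r)"
    using CA_gt_1 D_pos by (simp add: ennreal_mult mult.assoc)
  finally show ?thesis .
qed

end

section \<open>The good-lambda inequality\<close>

lemma not_mem_ball_nonpos: "x \<in> ball y r \<Longrightarrow> 0 < r"
  by (metis ball_eq_empty empty_iff not_le)

text \<open>Weighted weak type \<open>(q, q)\<close>. The Vitali argument is the one for weak type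
  (1,1); on each ball with average of \<open>g\<close> above \<open>t\<close>,
  \<open>mass_powr_le\<close> bounds \<open>t^q w(B)\<close> by \<open>c\<close> times the integral
  of \<open>g^q w\<close>.\<close>

lemma (in muckenhoupt) maxf_weak_type_W:
  assumes [measurable]: "g \<in> borel_measurable lebesgue" and t: "0 < t"
  shows "mass W {x. ennreal t < maxf (\<lambda>_. 1) g x} \<le>
    ennreal (c * D * t powr (- q)) * mass (\<lambda>y. epow (g y) q * W y) UNIV"
proof -
  let ?h = "\<lambda>y. epow (g y) q * W y" and ?C = "c * D * t powr (- q)"
  let ?K = "{(y, r). 0 < r \<and> ennreal t < mass g (ball y r) / mass (\<lambda>_. 1) (ball y r)}"
  have "mass W {x. ennreal t < maxf (\<lambda>_. 1) g x} \<le> mass (\<lambda>y. ennreal ?C * ?h y) (\<Union>(y, r)\<in>?K. ball y r)"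
    unfolding maxf_superlevel
  proof (rule mass_UN_balls_le)
    fix x r assume "(x, r) \<in> ?K"
    then have r: "0 < r" and tg: "ennreal t * mass (\<lambda>_. 1) (ball x r) \<le> mass g (ball x r)"
      using less_ennreal_divide_iff[of "mass (\<lambda>_. 1) (ball x r)" "ennreal t" "mass g (ball x r)"]
        doublingD(3)[OF doubling_1, of r x] doublingD(4)[OF doubling_1, of x r] by auto
    obtain n where n: "emeasure lebesgue (ball x r) = ennreal n" "0 < n"
      using emeasure_lebesgue_ball_pos[OF r, of x] emeasure_lebesgue_ball_finite[of x r]
      by (cases "emeasure lebesgue (ball x r)") auto
    have "ennreal (n powr q) * (ennreal (t powr q) * mass W (ball x r)) = epow (ennreal t * mass (\<lambda>_. 1) (ball x r)) q * mass W (ball x r)"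
      using n t by (simp add: mass_1 epow_mult mult_ac)
    also have "\<dots> \<le> epow (mass g (ball x r)) q * mass W (ball x r)"
      using q by (intro mult_right_mono epow_mono tg) auto
    also have "\<dots> \<le> ennreal c * epow (emeasure lebesgue (ball x r)) q * mass ?h (ball x r)"
      by (rule mass_powr_le) (use r in auto)
    also have "\<dots> = ennreal (n powr q) * (ennreal c * mass ?h (ball x r))"
      using n by (simp add: mult_ac)
    finally have *: "ennreal (t powr q) * mass W (ball x r) \<le> ennreal c * mass ?h (ball x r)"
      using n by (subst (asm) ennreal_mult_le_mult_iff) auto
    have "mass W (ball x (5 * r)) \<le> ennreal D * mass W (ball x r)"
      by (rule doublingD(5)[OF doubling_W])
    also have "\<dots> = ennreal (D * t powr (- q)) * (ennreal (t powr q) * mass W (ball x r))"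
    proof -
      have "D = D * t powr (- q) * t powr q" using t by (simp add: powr_minus)
      then have "ennreal D = ennreal (D * t powr (- q)) * ennreal (t powr q)"
        using D_pos by (subst ennreal_mult[symmetric]) auto
      then show ?thesis by (simp only: mult.assoc)
    qed
    also have "\<dots> \<le> ennreal (D * t powr (- q)) * (ennreal c * mass ?h (ball x r))"
      by (intro mult_left_mono *) auto
    also have "\<dots> = ennreal ?C * mass ?h (ball x r)"
      using c D_pos by (simp add: ennreal_mult mult_ac)
    also have "\<dots> = mass (\<lambda>y. ennreal ?C * ?h y) (ball x r)"
      by (subst mass_cmult) auto
    finally show "0 < r \<and> mass W (ball x (5 * r)) \<le> mass (\<lambda>y. ennreal ?C * ?h y) (ball x r)"
      using r by simp
  qed measurable
  also have "\<dots> \<le> mass (\<lambda>y. ennreal ?C * ?h y) UNIV" by (rule mass_mono) simp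
  also have "\<dots> = ennreal ?C * mass ?h UNIV" by (subst mass_cmult) auto
  finally show ?thesis .
qed

lemma mass_ball_le_maxf:
  assumes "z \<in> ball y r" "maxf (\<lambda>_. 1) g z \<le> t"
  shows "mass g (ball y r) \<le> t * emeasure lebesgue (ball y r)"
proof -
  have "mass g (ball y r) / mass (\<lambda>_. 1) (ball y r) \<le> t"
    using maxf_upper[OF assms(1), of g "\<lambda>_. 1"] assms(2) by (rule order.trans)
  then show ?thesis
    using doublingD(3,4)[OF doubling_1] not_mem_ball_nonpos[OF assms(1)]
    by (subst (asm) ennreal_divide_le_iff) (auto simp: mass_1)
qed

text \<open>The data of the theorem with \<open>F = |T f|\<^bsup>p\<^sub>0\<^esup>\<close>, \<open>\<phi> = |f|\<^bsup>p\<^sub>0\<^esup>\<close>, \<open>q = p/p\<^sub>0\<close> and \<open>q1 = p\<^sub>1/p\<^sub>0\<close>. On each ball,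
  \<open>R\<close> and \<open>G\<close> come from the parts of \<open>f\<close> inside and outside the dilated ball.\<close>

locale good_lambda = muckenhoupt q c w
  for q c :: real and w :: "'a::euclidean_space \<Rightarrow> real" +
  fixes q1 \<kappa> A0 N :: real and F \<phi> :: "'a \<Rightarrow> ennreal"
  assumes q1: "q < q1" and \<kappa>: "0 < \<kappa>" and A0: "0 < A0" and N: "0 < N"
    and measurable_F [measurable]: "F \<in> borel_measurable lebesgue"
    and measurable_\<phi> [measurable]: "\<phi> \<in> borel_measurable lebesgue"
    and mass_F: "mass F UNIV \<le> ennreal A0 * mass \<phi> UNIV"
    and mass_\<phi>: "mass \<phi> UNIV < top"
    and split: "0 < r \<Longrightarrow> \<exists>G R. G \<in> borel_measurable lebesgue \<and> R \<in> borel_measurable lebesgue \<and>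
      (AE y in lebesgue. F y \<le> ennreal \<kappa> * (G y + R y)) \<and>
      mass R UNIV \<le> ennreal A0 * mass \<phi> (ball x (4 * r)) \<and>
      (\<forall>m>0. mass F (ball x (3 * r)) \<le> ennreal m * emeasure lebesgue (ball x (3 * r)) \<and>
        (\<forall>y s. ball x r \<subseteq> ball y s \<longrightarrow> mass \<phi> (ball y s) \<le> ennreal m * emeasure lebesgue (ball y s)) \<longrightarrow>
        mass (\<lambda>y. epow (G y) q1 * W y) (ball x r) \<le> ennreal (N * m powr q1) * mass W (ball x r))"
begin

lemma mass_F_finite: "mass F UNIV < top"
  using mass_F mass_\<phi> by (simp add: ennreal_mult_less_top le_less_trans)

text \<open>The estimate on one Whitney ball. The nearby point \<open>z\<close> rules out large
  balls, so inside the half ball only averages over balls contained in \<open>ball x R\<close> can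
  exceed \<open>\<alpha> * l\<close>, and there the splitting of \<open>F\<close> applies. The part
  \<open>H\<close> coming from inside is handled by weak type (1,1) and A-infinity, the part
  \<open>G\<close> from outside by weighted weak type; \<open>y0\<close> controls the averages of
  \<open>\<phi>\<close> in both.\<close>

lemma local_good_lambda:
  assumes R: "0 < R" and l: "0 < l" and \<alpha>: "7 ^ DIM('a) \<le> \<alpha>" and \<gamma>: "0 < \<gamma>" "\<gamma> \<le> 1"
    and \<gamma>n: "20 ^ DIM('a) * (2 * \<kappa> * A0 * \<gamma>) / \<alpha> \<le> 1 / (40 ^ n) ^ DIM('a)"
    and [measurable]: "F1 \<in> borel_measurable lebesgue"
    and F1: "\<And>y. F1 y \<le> F y" "\<And>y. y \<in> ball x (3 * R) \<Longrightarrow> F y = F1 y"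
    and z: "dist x z \<le> R" "maxf (\<lambda>_. 1) F1 z \<le> ennreal l"
    and y0: "y0 \<in> ball x R" "maxf (\<lambda>_. 1) \<phi> y0 \<le> ennreal (\<gamma> * l)"
  shows "mass W (ball x (R / 2) \<inter> {y. ennreal (\<alpha> * l) < maxf (\<lambda>_. 1) F1 y}) \<le>
    ennreal (((CA - 1) / CA) ^ n * D + c * D * N * (4 * \<kappa> / \<alpha>) powr q1) * mass W (ball x R)"
proof -
  let ?B = "ball x R"
  have \<alpha>0: "0 < \<alpha>" using \<alpha> zero_less_power[of "7::real" "DIM('a)"] by linarith
  \<comment> \<open>If \<open>\<kappa> (G' + H')\<close> averages more than
    \<open>\<alpha> * l\<close> over a ball, then \<open>G'\<close> or \<open>H'\<close> averages
    more than \<open>\<tau>\<close>.\<close>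
  define \<tau> where "\<tau> = \<alpha> * l / (2 * \<kappa>)"
  have \<tau>: "0 < \<tau>" "\<kappa> * (\<tau> + \<tau>) = \<alpha> * l" using \<alpha>0 l \<kappa> by (auto simp: \<tau>_def field_simps)
  obtain G H where [measurable]: "G \<in> borel_measurable lebesgue" "H \<in> borel_measurable lebesgue"
    and FGH: "AE y in lebesgue. F y \<le> ennreal \<kappa> * (G y + H y)"
    and H: "mass H UNIV \<le> ennreal A0 * mass \<phi> (ball x (4 * R))"
    and G: "\<And>m. 0 < m \<Longrightarrow> mass F (ball x (3 * R)) \<le> ennreal m * emeasure lebesgue (ball x (3 * R)) \<Longrightarrow>
        (\<forall>y s. ball x R \<subseteq> ball y s \<longrightarrow> mass \<phi> (ball y s) \<le> ennreal m * emeasure lebesgue (ball y s)) \<Longrightarrow>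
        mass (\<lambda>y. epow (G y) q1 * W y) (ball x R) \<le> ennreal (N * m powr q1) * mass W (ball x R)"
    using split[OF R, of x] by blast
  define G' where "G' y = G y * indicator ?B y" for y
  define H' where "H' y = H y * indicator ?B y" for y
  have [measurable]: "G' \<in> borel_measurable lebesgue" "H' \<in> borel_measurable lebesgue"
    unfolding G'_def H'_def by measurable
  define UG where "UG = {y. ennreal \<tau> < maxf (\<lambda>_. 1) G' y}"
  define UH where "UH = {y. ennreal \<tau> < maxf (\<lambda>_. 1) H' y}"
  have op: "open UG" "open UH" unfolding UG_def UH_def by (auto intro: open_maxf_superlevel)
  then have [measurable]: "UG \<in> sets lebesgue" "UH \<in> sets lebesgue" by (auto intro: measurable_open_lebesgue)
  have cover: "ball x (R / 2) \<inter> {y. ennreal (\<alpha> * l) < maxf (\<lambda>_. 1) F1 y} \<subseteq> (UH \<inter> ?B) \<union> UG"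
  proof
    fix y assume "y \<in> ball x (R / 2) \<inter> {y. ennreal (\<alpha> * l) < maxf (\<lambda>_. 1) F1 y}"
    then have y: "dist x y < R / 2" and gt: "ennreal (\<alpha> * l) < maxf (\<lambda>_. 1) F1 y" by auto
    obtain v s where vs: "y \<in> ball v s"
      and "ennreal (\<alpha> * l) < mass F1 (ball v s) / mass (\<lambda>_. 1) (ball v s)"
      using gt unfolding less_maxf_iff by blast
    then have s: "0 < s" and F1vs: "ennreal (\<alpha> * l) * emeasure lebesgue (ball v s) < mass F1 (ball v s)"
      using not_mem_ball_nonpos[OF vs]
        less_ennreal_divide_iff[OF doublingD(3)[OF doubling_1] doublingD(4)[OF doubling_1]]
      by (auto simp: mass_1)
    have "s < R / 4"
    proof (rule ccontr)
      assume "\<not> s < R / 4"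
      \<comment> \<open>The distance from \<open>v\<close> to \<open>z\<close> is below
        \<open>s + R / 2 + R\<close>, which is at most \<open>7 s\<close>; hence the requirement
        \<open>7 ^ DIM('a) \<le> \<alpha>\<close>.\<close>
      then have "z \<in> ball v (7 * s)"
        using vs y z dist_triangle[of v z y] dist_triangle[of y z x] by (auto simp: dist_commute)
      then have "mass F1 (ball v (7 * s)) \<le> ennreal l * emeasure lebesgue (ball v (7 * s))"
        using z(2) by (rule mass_ball_le_maxf)
      also have "\<dots> = ennreal (7 ^ DIM('a) * l) * emeasure lebesgue (ball v s)"
        using s l by (subst emeasure_lebesgue_ball_scale[of s 7 v v]) (auto simp: ennreal_mult mult_ac)
      also have "\<dots> \<le> ennreal (\<alpha> * l) * emeasure lebesgue (ball v s)"
        using \<alpha> l by (intro mult_right_mono ennreal_leI) auto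
      finally have "mass F1 (ball v s) \<le> ennreal (\<alpha> * l) * emeasure lebesgue (ball v s)"
        using s by (intro order.trans[OF mass_mono[of "ball v s" "ball v (7 * s)"]] subset_ball) auto
      with F1vs show False by simp
    qed
    have sub: "ball v s \<subseteq> ?B"
    proof
      fix u assume "u \<in> ball v s"
      then show "u \<in> ?B"
        using vs y \<open>s < R / 4\<close> dist_triangle[of x u y] dist_triangle[of y u v] by (simp add: dist_commute)
    qed
    have yB: "y \<in> ?B" using sub vs by blast
    have "mass F1 (ball v s) \<le> mass (\<lambda>y. ennreal \<kappa> * (G' y + H' y)) (ball v s)"
    proof (rule mass_mono_fun_AE)
      show "AE y in lebesgue. y \<in> ball v s \<longrightarrow> F1 y \<le> ennreal \<kappa> * (G' y + H' y)"
        using FGH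
      proof eventually_elim
        case (elim y)
        then show ?case using sub F1(1)[of y] by (auto simp: G'_def H'_def)
      qed
    qed
    also have "\<dots> = ennreal \<kappa> * (mass G' (ball v s) + mass H' (ball v s))"
      by (subst mass_cmult, measurable) (subst mass_add, auto)
    finally have "ennreal \<kappa> * (mass G' (ball v s) + mass H' (ball v s)) > ennreal (\<alpha> * l) * emeasure lebesgue (ball v s)"
      using F1vs by simp
    also have "ennreal (\<alpha> * l) = ennreal \<kappa> * (ennreal \<tau> + ennreal \<tau>)"
      using \<tau> \<kappa> by (simp add: ennreal_mult[symmetric] flip: ennreal_plus)
    finally have *: "ennreal \<kappa> * (ennreal \<tau> * emeasure lebesgue (ball v s) + ennreal \<tau> * emeasure lebesgue (ball v s)) <
       ennreal \<kappa> * (mass G' (ball v s) + mass H' (ball v s))"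
      by (simp only: distrib_right mult.assoc)
    have "\<not> (mass G' (ball v s) \<le> ennreal \<tau> * emeasure lebesgue (ball v s) \<and> mass H' (ball v s) \<le> ennreal \<tau> * emeasure lebesgue (ball v s))"
    proof
      assume "mass G' (ball v s) \<le> ennreal \<tau> * emeasure lebesgue (ball v s) \<and> mass H' (ball v s) \<le> ennreal \<tau> * emeasure lebesgue (ball v s)"
      then have "ennreal \<kappa> * (mass G' (ball v s) + mass H' (ball v s)) \<le>
         ennreal \<kappa> * (ennreal \<tau> * emeasure lebesgue (ball v s) + ennreal \<tau> * emeasure lebesgue (ball v s))"
        by (intro mult_left_mono add_mono) auto
      with * show False by simp
    qed
    moreover have "y \<in> UG" if "\<not> mass G' (ball v s) \<le> ennreal \<tau> * emeasure lebesgue (ball v s)"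
      using that mass_ball_le_maxf[OF vs, of G' "ennreal \<tau>"] unfolding UG_def by (metis mem_Collect_eq not_le)
    moreover have "y \<in> UH" if "\<not> mass H' (ball v s) \<le> ennreal \<tau> * emeasure lebesgue (ball v s)"
      using that mass_ball_le_maxf[OF vs, of H' "ennreal \<tau>"] unfolding UH_def by (metis mem_Collect_eq not_le)
    ultimately show "y \<in> (UH \<inter> ?B) \<union> UG" using yB by blast
  qed
  have \<phi>_le: "mass \<phi> (ball y s) \<le> ennreal (\<gamma> * l) * emeasure lebesgue (ball y s)" if "?B \<subseteq> ball y s" for y s
    using y0 that by (intro mass_ball_le_maxf[of y0]) auto
  have UH: "mass W (UH \<inter> ?B) \<le> ennreal (((CA - 1) / CA) ^ n * D) * mass W ?B"
  proof (rule mass_W_small)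
    \<comment> \<open>The factor \<open>5^d\<close> of weak type (1,1) and \<open>4^d\<close> of the
      dilated ball multiply to the \<open>20^d\<close> in the assumption on
      \<open>\<gamma>\<close>.\<close>
    have "emeasure lebesgue (UH \<inter> ?B) \<le> mass (\<lambda>_. 1) UH"
      by (subst mass_1) (auto intro!: emeasure_mono)
    also have "\<dots> \<le> ennreal (5 ^ DIM('a) / \<tau>) * mass H' UNIV"
      unfolding UH_def using \<tau> by (intro maxf_weak_type doubling_1) auto
    also have "\<dots> \<le> ennreal (5 ^ DIM('a) / \<tau>) * (ennreal A0 * (ennreal (\<gamma> * l) * emeasure lebesgue (ball x (4 * R))))"
    proof (intro mult_left_mono)
      have "mass H' UNIV \<le> mass H UNIV" by (intro mass_mono_fun) (auto simp: H'_def split: split_indicator)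
      also have "\<dots> \<le> ennreal A0 * mass \<phi> (ball x (4 * R))" by (rule H)
      also have "\<dots> \<le> ennreal A0 * (ennreal (\<gamma> * l) * emeasure lebesgue (ball x (4 * R)))"
        using R by (intro mult_left_mono \<phi>_le subset_ball) auto
      finally show "mass H' UNIV \<le> ennreal A0 * (ennreal (\<gamma> * l) * emeasure lebesgue (ball x (4 * R)))" .
    qed simp
    also have "\<dots> = ennreal (5 ^ DIM('a) / \<tau> * (A0 * (\<gamma> * l * 4 ^ DIM('a)))) * emeasure lebesgue ?B"
      using R \<tau> \<gamma> l A0 by (subst emeasure_lebesgue_ball_scale[of R 4 x x]) (auto simp: ennreal_mult[symmetric] mult.assoc[symmetric])
    also have "\<dots> \<le> ennreal (1 / (40 ^ n) ^ DIM('a)) * emeasure lebesgue ?B"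
    proof (intro mult_right_mono ennreal_leI)
      have "5 ^ DIM('a) / \<tau> * (A0 * (\<gamma> * l * 4 ^ DIM('a))) = (5 ^ DIM('a) * 4 ^ DIM('a)) * (2 * \<kappa> * A0 * \<gamma>) / \<alpha>"
        using l \<alpha>0 \<kappa> by (simp add: \<tau>_def)
      also have "5 ^ DIM('a) * 4 ^ DIM('a) = (20::real) ^ DIM('a)"
        unfolding power_mult_distrib[symmetric] by simp
      finally show "5 ^ DIM('a) / \<tau> * (A0 * (\<gamma> * l * 4 ^ DIM('a))) \<le> 1 / (40 ^ n) ^ DIM('a)"
        using \<gamma>n by simp
    qed simp
    finally show "emeasure lebesgue (UH \<inter> ?B) \<le> ennreal (1 / (40 ^ n) ^ DIM('a)) * emeasure lebesgue ?B" .
  qed (use op R in auto)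
  have UG: "mass W UG \<le> ennreal (c * D * N * (4 * \<kappa> / \<alpha>) powr q1) * mass W ?B"
  proof -
    \<comment> \<open>Only values of \<open>G'\<close> above \<open>\<tau> / 2\<close> matter. There
      \<open>G'^q\<close> is at most \<open>(\<tau> / 2)^(q - q1)\<close> times
      \<open>G'^q1\<close>, which brings in the higher exponent.\<close>
    let ?G'' = "\<lambda>y. G' y * indicator {y. ennreal (\<tau> / 2) < G' y} y"
    have "mass W UG \<le> mass W {y. ennreal (\<tau> / 2) < maxf (\<lambda>_. 1) ?G'' y}"
      using less_maxf_truncate[OF doubling_1, of G' "\<tau> / 2"] \<tau>
      unfolding UG_def by (intro mass_mono) auto
    also have "\<dots> \<le> ennreal (c * D * (\<tau> / 2) powr (- q)) * mass (\<lambda>y. epow (?G'' y) q * W y) UNIV"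
      using \<tau> by (intro maxf_weak_type_W) auto
    also have "\<dots> \<le> ennreal (c * D * (\<tau> / 2) powr (- q)) * mass (\<lambda>y. ennreal ((\<tau> / 2) powr (q - q1)) * (epow (G' y) q1 * W y)) UNIV"
    proof (intro mult_left_mono mass_mono_fun)
      fix y
      show "epow (?G'' y) q * W y \<le> ennreal ((\<tau> / 2) powr (q - q1)) * (epow (G' y) q1 * W y)"
      proof (cases "ennreal (\<tau> / 2) < G' y")
        case True
        have "epow (G' y) q \<le> ennreal ((\<tau> / 2) powr (q - q1)) * epow (G' y) q1"
        proof (cases "G' y")
          case (real a)
          then have a: "\<tau> / 2 < a" using True \<tau> by (simp add: ennreal_less_iff)
          have "a powr (q - q1) \<le> (\<tau> / 2) powr (q - q1)"
            using a \<tau> q1 by (intro powr_mono2') auto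
          then have "a powr (q - q1) * a powr q1 \<le> (\<tau> / 2) powr (q - q1) * a powr q1"
            by (intro mult_right_mono) auto
          then have "a powr q \<le> (\<tau> / 2) powr (q - q1) * a powr q1"
            by (simp flip: powr_add)
          then show ?thesis using real by (simp add: ennreal_mult[symmetric] ennreal_leI)
        qed (use \<tau> in \<open>simp add: ennreal_mult_top\<close>)
        then show ?thesis using True by (simp add: mult.assoc[symmetric] mult_right_mono)
      qed simp
    qed simp
    also have "\<dots> = ennreal (c * D * (\<tau> / 2) powr (- q)) * (ennreal ((\<tau> / 2) powr (q - q1)) * mass (\<lambda>y. epow (G' y) q1 * W y) UNIV)"
      by (subst mass_cmult) auto
    also have "mass (\<lambda>y. epow (G' y) q1 * W y) UNIV = mass (\<lambda>y. epow (G y) q1 * W y) ?B"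
      unfolding mass_def G'_def by (intro nn_integral_cong) (auto split: split_indicator)
    \<comment> \<open>The bound for \<open>G\<close> is taken with \<open>m = l\<close>:
      \<open>z\<close> supplies the condition on \<open>F\<close> in the three-fold ball,
      \<open>y0\<close> and \<open>\<gamma> \<le> 1\<close> supply the one on
      \<open>\<phi>\<close>.\<close>
    also have "ennreal (c * D * (\<tau> / 2) powr (- q)) * (ennreal ((\<tau> / 2) powr (q - q1)) * mass (\<lambda>y. epow (G y) q1 * W y) ?B)
       \<le> ennreal (c * D * (\<tau> / 2) powr (- q)) * (ennreal ((\<tau> / 2) powr (q - q1)) * (ennreal (N * l powr q1) * mass W ?B))"
    proof (intro mult_left_mono G l)
      have "mass F (ball x (3 * R)) = mass F1 (ball x (3 * R))"
        unfolding mass_def using F1(2) by (intro nn_integral_cong) (auto split: split_indicator)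
      also have "\<dots> \<le> ennreal l * emeasure lebesgue (ball x (3 * R))"
        using z R by (intro mass_ball_le_maxf[of z]) auto
      finally show "mass F (ball x (3 * R)) \<le> ennreal l * emeasure lebesgue (ball x (3 * R))" .
      have "ennreal (\<gamma> * l) \<le> ennreal l" using \<gamma> l by (intro ennreal_leI) auto
      then show "\<forall>y s. ?B \<subseteq> ball y s \<longrightarrow> mass \<phi> (ball y s) \<le> ennreal l * emeasure lebesgue (ball y s)"
        using \<phi>_le by (meson mult_right_mono order.trans zero_le)
    qed auto
    also have "\<dots> = ennreal (c * D * (\<tau> / 2) powr (- q) * ((\<tau> / 2) powr (q - q1) * (N * l powr q1))) * mass W ?B"
      using c D_pos N by (simp add: ennreal_mult mult.assoc)
    also have "c * D * (\<tau> / 2) powr (- q) * ((\<tau> / 2) powr (q - q1) * (N * l powr q1)) = c * D * N * (4 * \<kappa> / \<alpha>) powr q1"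
    proof -
      have "(\<tau> / 2) powr (- q) * (\<tau> / 2) powr (q - q1) = (\<tau> / 2) powr (- q1)"
        by (simp flip: powr_add)
      moreover have "(\<tau> / 2) powr (- q1) * l powr q1 = (l / (\<tau> / 2)) powr q1"
        using \<tau> l by (simp add: powr_divide powr_minus_divide powr_mult)
      moreover have "l / (\<tau> / 2) = 4 * \<kappa> / \<alpha>" using l by (simp add: \<tau>_def)
      moreover have "c * D * (\<tau> / 2) powr (- q) * ((\<tau> / 2) powr (q - q1) * (N * l powr q1)) =
          c * D * N * (((\<tau> / 2) powr (- q) * (\<tau> / 2) powr (q - q1)) * l powr q1)"
        by (simp only: mult_ac)
      ultimately show ?thesis by (simp only:)
    qed
    finally show ?thesis .
  qed
  have "mass W (ball x (R / 2) \<inter> {y. ennreal (\<alpha> * l) < maxf (\<lambda>_. 1) F1 y}) \<le> mass W ((UH \<inter> ?B) \<union> UG)"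
    by (rule mass_mono[OF cover])
  also have "\<dots> \<le> mass W (UH \<inter> ?B) + mass W UG" by (rule mass_Un_le) auto
  also have "\<dots> \<le> ennreal (((CA - 1) / CA) ^ n * D) * mass W ?B + ennreal (c * D * N * (4 * \<kappa> / \<alpha>) powr q1) * mass W ?B"
    by (intro add_mono UH UG)
  also have "\<dots> = ennreal (((CA - 1) / CA) ^ n * D + c * D * N * (4 * \<kappa> / \<alpha>) powr q1) * mass W ?B"
    using CA_gt_1 D_pos c N by (simp add: distrib_right)
  finally show ?thesis .
qed

end

section \<open>Summing the local estimate over Whitney balls\<close>

lemma emeasure_lebesgue_UNIV: "emeasure lebesgue (UNIV :: 'a::euclidean_space set) = top"
  by (simp add: emeasure_completion)

text \<open>Turns a good-lambda inequality at all levels into one between integrals.\<close>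

lemma layer_cake_le:
  assumes [measurable]: "X \<in> borel_measurable lebesgue" "Y1 \<in> borel_measurable lebesgue"
    "Y2 \<in> borel_measurable lebesgue" "Y3 \<in> borel_measurable lebesgue" "v \<in> borel_measurable lebesgue"
    and s: "0 < s"
    and le: "\<And>t. 0 < t \<Longrightarrow> mass v {x. ennreal t < X x} \<le>
      a * mass v {x. ennreal t < Y1 x} + mass v {x. ennreal t < Y2 x} + mass v {x. ennreal t < Y3 x}"
  shows "(\<integral>\<^sup>+x. epow (X x) s * v x \<partial>lebesgue) \<le> a * (\<integral>\<^sup>+x. epow (Y1 x) s * v x \<partial>lebesgue) +
    (\<integral>\<^sup>+x. epow (Y2 x) s * v x \<partial>lebesgue) + (\<integral>\<^sup>+x. epow (Y3 x) s * v x \<partial>lebesgue)"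
proof -
  let ?k = "\<lambda>t. ennreal (s * t powr (s - 1)) * indicator {0<..} t"
  let ?m = "\<lambda>Y t. ?k t * mass v {x. ennreal t < Y x}"
  have [measurable]: "?m Y \<in> borel_measurable lborel" if "Y \<in> borel_measurable lebesgue" for Y
    using that by (intro borel_measurable_times_ennreal measurable_mass_superlevel) auto
  have "(\<integral>\<^sup>+t. ?m X t \<partial>lborel) \<le> (\<integral>\<^sup>+t. a * ?m Y1 t + ?m Y2 t + ?m Y3 t \<partial>lborel)"
  proof (rule nn_integral_mono)
    fix t :: real
    show "?m X t \<le> a * ?m Y1 t + ?m Y2 t + ?m Y3 t"
    proof (cases "0 < t")
      case True
      then show ?thesis
        using mult_left_mono[OF le[OF True], of "?k t"] by (simp add: distrib_left mult_ac)
    qed simp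
  qed
  also have "\<dots> = a * (\<integral>\<^sup>+t. ?m Y1 t \<partial>lborel) + (\<integral>\<^sup>+t. ?m Y2 t \<partial>lborel) + (\<integral>\<^sup>+t. ?m Y3 t \<partial>lborel)"
    by (simp add: nn_integral_add nn_integral_cmult)
  finally show ?thesis
    using s by (simp add: layer_cake)
qed

context good_lambda
begin

text \<open>The points with \<open>maxf \<phi>\<close> above \<open>\<gamma> * l\<close> form the
  last term. The others are covered by Whitney balls of \<open>E\<close>, and the local estimates
  are summed over a Vitali subfamily. The condition \<open>l0\<close> bounds \<open>|E|\<close> by
  the volume of \<open>ball 0 \<rho>\<close>, so Whitney radii are at most \<open>\<rho>\<close>,
  and three-fold Whitney balls stay where \<open>F1 = F\<close>.\<close>

lemma global_good_lambda:
  assumes \<rho>: "0 < \<rho>" and l: "0 < l" and \<alpha>: "7 ^ DIM('a) \<le> \<alpha>" and \<gamma>: "0 < \<gamma>" "\<gamma> \<le> 1"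
    and \<gamma>n: "20 ^ DIM('a) * (2 * \<kappa> * A0 * \<gamma>) / \<alpha> \<le> 1 / (40 ^ n) ^ DIM('a)"
    and l0: "ennreal (5 ^ DIM('a)) * mass F UNIV \<le> ennreal l * emeasure lebesgue (ball (0::'a) \<rho>)"
  defines "F1 \<equiv> (\<lambda>y. F y * indicator (ball 0 (4 * \<rho>)) y)"
  shows "mass W (ball 0 \<rho> \<inter> {y. ennreal (\<alpha> * l) < maxf (\<lambda>_. 1) F1 y}) \<le>
    ennreal ((((CA - 1) / CA) ^ n * D + c * D * N * (4 * \<kappa> / \<alpha>) powr q1) * D ^ 3) *
      mass W (ball 0 \<rho> \<inter> {y. ennreal l < maxf (\<lambda>_. 1) F1 y}) +
    mass W (ball 0 \<rho> \<inter> {y. ennreal (\<gamma> * l) < maxf (\<lambda>_. 1) \<phi> y})"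
proof -
  let ?B0 = "ball (0::'a) \<rho>"
  define \<delta> where "\<delta> = ((CA - 1) / CA) ^ n * D + c * D * N * (4 * \<kappa> / \<alpha>) powr q1"
  have \<delta>: "0 \<le> \<delta>" using CA_gt_1 D_pos c N by (simp add: \<delta>_def)
  have [measurable]: "F1 \<in> borel_measurable lebesgue" unfolding F1_def by measurable
  have \<alpha>1: "1 \<le> \<alpha>" using \<alpha> one_le_power[of "7::real" "DIM('a)"] by linarith
  define E where "E = {y. ennreal l < maxf (\<lambda>_. 1) F1 y}"
  define E' where "E' = {y. ennreal (\<alpha> * l) < maxf (\<lambda>_. 1) F1 y}"
  define P where "P = {y. ennreal (\<gamma> * l) < maxf (\<lambda>_. 1) \<phi> y}"
  have op: "open E" "open E'" "open P"
    unfolding E_def E'_def P_def by (auto intro: open_maxf_superlevel)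
  then have [measurable]: "E \<in> sets lebesgue" "E' \<in> sets lebesgue" "P \<in> sets lebesgue"
    by (auto intro: measurable_open_lebesgue)
  have "E' \<subseteq> E"
  proof -
    have "ennreal l \<le> ennreal (\<alpha> * l)" using \<alpha>1 l by (intro ennreal_leI) auto
    then show ?thesis by (auto simp: E_def E'_def intro: le_less_trans)
  qed
  define H where "H = ?B0 \<inter> E' - P"
  have [measurable]: "H \<in> sets lebesgue" unfolding H_def by measurable
  have "emeasure lebesgue E = mass (\<lambda>_. 1) E" by (simp add: mass_1)
  also have "\<dots> \<le> ennreal (5 ^ DIM('a) / l) * mass F1 UNIV"
    unfolding E_def using l by (intro maxf_weak_type doubling_1) auto
  also have "\<dots> \<le> ennreal (5 ^ DIM('a) / l) * mass F UNIV"
    by (intro mult_left_mono mass_mono_fun) (auto simp: F1_def split: split_indicator)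
  also have "\<dots> = ennreal (1 / l) * (ennreal (5 ^ DIM('a)) * mass F UNIV)"
    using l by (simp add: mult.assoc[symmetric] ennreal_mult[symmetric])
  also have "\<dots> \<le> ennreal (1 / l) * (ennreal l * emeasure lebesgue ?B0)"
    by (intro mult_left_mono l0) auto
  also have "\<dots> = emeasure lebesgue ?B0"
    using l by (simp add: mult.assoc[symmetric] ennreal_mult[symmetric])
  finally have E_small: "emeasure lebesgue E \<le> emeasure lebesgue ?B0" .
  then have "E \<noteq> UNIV"
    using emeasure_lebesgue_ball_finite[of "0::'a" \<rho>] emeasure_lebesgue_UNIV[where 'a = 'a] by auto
  then have ne: "- E \<noteq> {}" by auto
  \<comment> \<open>The ball of this radius lies in \<open>E\<close>, and a point of the complement
    at exactly this distance will serve as \<open>z\<close>.\<close>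
  define R where "R x = infdist x (- E)" for x
  have R_pos: "0 < R x" if "x \<in> E" for x
    using that op(1) ne in_closed_iff_infdist_zero[of "- E" x] infdist_nonneg[of x "- E"]
    by (auto simp: R_def closed_def less_le)
  have R_sub: "ball x (R x) \<subseteq> E" for x
  proof
    fix y assume "y \<in> ball x (R x)"
    then show "y \<in> E" using infdist_le[of y "- E" x] by (force simp: R_def)
  qed
  have R_le: "R x \<le> \<rho>" if "x \<in> E" for x
  proof -
    have "emeasure lebesgue (ball x (R x)) \<le> emeasure lebesgue ?B0"
      by (rule order.trans[OF emeasure_mono[OF R_sub] E_small]) measurable
    then have "ennreal (measure lebesgue (ball (0::'a) 1) * R x ^ DIM('a)) \<le> ennreal (measure lebesgue (ball (0::'a) 1) * \<rho> ^ DIM('a))"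
      using R_pos[OF that] \<rho> by (simp add: emeasure_lebesgue_ball)
    then have "measure lebesgue (ball (0::'a) 1) * R x ^ DIM('a) \<le> measure lebesgue (ball (0::'a) 1) * \<rho> ^ DIM('a)"
      using \<rho> by (subst (asm) ennreal_le_iff) auto
    moreover have "0 < measure lebesgue (ball (0::'a) 1)" using content_ball_pos[of 1 "0::'a"] by simp
    ultimately have "\<not> \<rho> ^ DIM('a) < R x ^ DIM('a)" by simp
    then show ?thesis using \<rho> power_strict_mono[of \<rho> "R x" "DIM('a)"] by fastforce
  qed
  \<comment> \<open>With a tenth of the distance as radius, the five-fold dilation is the half ball
    of the local estimate.\<close>
  obtain C where C: "countable C" "C \<subseteq> H"
     "pairwise (\<lambda>i j. disjnt (ball i (R i / 10)) (ball j (R j / 10))) C"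
     "H \<subseteq> (\<Union>i\<in>C. ball i (5 * (R i / 10)))"
  proof (rule Vitali_covering_lemma_balls[where S = H and K = H and a = "\<lambda>x. x" and r = "\<lambda>x. R x / 10" and B = \<rho>])
    have HE: "H \<subseteq> E" using \<open>E' \<subseteq> E\<close> by (auto simp: H_def)
    show "H \<subseteq> (\<Union>i\<in>H. ball i (R i / 10))" using R_pos HE by fastforce
    show "0 < R i / 10 \<and> R i / 10 \<le> \<rho>" if "i \<in> H" for i
      using R_pos[of i] R_le[of i] HE that by fastforce
  qed blast
  have "mass W H \<le> mass W (\<Union>i\<in>C. ball i (R i / 2) \<inter> H)"
    using C(4) by (intro mass_mono) auto
  also have "\<dots> \<le> mass (\<lambda>x. ennreal (\<delta> * D ^ 3) * W x) (\<Union>i\<in>C. ball i (R i / 10) \<inter> ?B0)"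
  proof (rule mass_UN_le_disjoint)
    show "pairwise (\<lambda>i j. disjnt (ball i (R i / 10) \<inter> ?B0) (ball j (R j / 10) \<inter> ?B0)) C"
      using C(3) by (rule pairwise_mono) (auto simp: disjnt_def)
    fix i assume "i \<in> C"
    then have i: "norm i < \<rho>" "i \<in> E" using C(2) \<open>E' \<subseteq> E\<close> by (auto simp: H_def)
    note Ri = R_pos[OF i(2)] R_le[OF i(2)]
    have "mass W (ball i (R i / 2) \<inter> H) \<le> ennreal \<delta> * mass W (ball i (R i))"
    proof (cases "ball i (R i / 2) \<inter> H = {}")
      case False
      then obtain y0 where y0: "dist i y0 < R i / 2" "y0 \<notin> P" by (auto simp: H_def)
      obtain z where z: "z \<in> - E" "dist i z = R i"
        using infdist_attains_inf[of "- E" i] op(1) ne unfolding R_def by (metis closed_Compl)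
      have sub4: "ball i (3 * R i) \<subseteq> ball 0 (4 * \<rho>)"
      proof
        fix y assume "y \<in> ball i (3 * R i)"
        then show "y \<in> ball 0 (4 * \<rho>)" using i Ri dist_triangle[of 0 y i] by simp
      qed
      have "mass W (ball i (R i / 2) \<inter> H) \<le> mass W (ball i (R i / 2) \<inter> {y. ennreal (\<alpha> * l) < maxf (\<lambda>_. 1) F1 y})"
        by (rule mass_mono) (auto simp: H_def E'_def)
      also have "\<dots> \<le> ennreal \<delta> * mass W (ball i (R i))"
        unfolding \<delta>_def
      proof (rule local_good_lambda[OF Ri(1) l \<alpha> \<gamma> \<gamma>n, where z = z and ?y0.0 = y0])
        show "F1 y \<le> F y" for y by (auto simp: F1_def split: split_indicator)
        show "F y = F1 y" if "y \<in> ball i (3 * R i)" for y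
          using that sub4 by (auto simp: F1_def subset_iff)
        show "maxf (\<lambda>_. 1) F1 z \<le> ennreal l" using z by (auto simp: E_def not_less)
        show "maxf (\<lambda>_. 1) \<phi> y0 \<le> ennreal (\<gamma> * l)" using y0 by (auto simp: P_def not_less)
        show "y0 \<in> ball i (R i)" using y0 Ri(1) by simp
      qed (use z in auto)
      finally show ?thesis .
    qed simp
    also have "mass W (ball i (R i)) \<le> ennreal (D ^ 3) * mass W (ball i (R i / 10) \<inter> ?B0)"
    proof -
      \<comment> \<open>Moving the centre towards the origin gives a ball of comparable radius that stays inside \<open>B0\<close>.\<close>
      define i' where "i' = (1 - R i / (20 * \<rho>)) *\<^sub>R i"
      have "dist i i' = norm ((R i / (20 * \<rho>)) *\<^sub>R i)"
        by (simp add: i'_def dist_norm scaleR_diff_left)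
      also have "\<dots> = R i / (20 * \<rho>) * norm i" using Ri \<rho> by simp
      finally have d: "dist i i' = R i / (20 * \<rho>) * norm i" .
      have "R i / (20 * \<rho>) * norm i \<le> R i / (20 * \<rho>) * \<rho>"
        using i Ri \<rho> by (intro mult_left_mono) auto
      then have d': "dist i i' \<le> R i / 20" using d \<rho> by simp
      have r1: "0 \<le> 1 - R i / (20 * \<rho>)" using Ri \<rho> by (simp add: field_simps)
      have n: "norm i' = (1 - R i / (20 * \<rho>)) * norm i"
        unfolding i'_def using r1 by simp
      also have "\<dots> \<le> (1 - R i / (20 * \<rho>)) * \<rho>"
        using i r1 by (intro mult_left_mono) auto
      also have "\<dots> = \<rho> - R i / 20" using \<rho> by (simp add: field_simps)
      finally have n': "norm i' \<le> \<rho> - R i / 20" .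
      have sub': "ball i' (R i / 20) \<subseteq> ball i (R i / 10) \<inter> ?B0"
      proof
        fix y assume "y \<in> ball i' (R i / 20)"
        then show "y \<in> ball i (R i / 10) \<inter> ?B0"
          using d' n' dist_triangle[of i y i'] dist_triangle[of 0 y i'] by simp
      qed
      have "ball i (R i) \<subseteq> ball i' (5 * (5 * (5 * (R i / 20))))"
      proof
        fix y assume "y \<in> ball i (R i)"
        then show "y \<in> ball i' (5 * (5 * (5 * (R i / 20))))"
          using d' dist_triangle[of i' y i] Ri(1) by (simp add: dist_commute)
      qed
      then have "mass W (ball i (R i)) \<le> mass W (ball i' (5 * (5 * (5 * (R i / 20)))))" by (rule mass_mono)
      also have "\<dots> \<le> ennreal D * (ennreal D * (ennreal D * mass W (ball i' (R i / 20))))"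
        by (intro order.trans[OF doublingD(5)[OF doubling_W]] mult_left_mono order.refl) auto
      also have "\<dots> = ennreal (D ^ 3) * mass W (ball i' (R i / 20))"
        using D_pos by (simp add: power3_eq_cube ennreal_mult mult.assoc)
      also have "\<dots> \<le> ennreal (D ^ 3) * mass W (ball i (R i / 10) \<inter> ?B0)"
        by (intro mult_left_mono mass_mono sub') auto
      finally show ?thesis .
    qed
    then have "ennreal \<delta> * mass W (ball i (R i)) \<le> ennreal \<delta> * (ennreal (D ^ 3) * mass W (ball i (R i / 10) \<inter> ?B0))"
      by (intro mult_left_mono) auto
    also have "\<dots> = mass (\<lambda>x. ennreal (\<delta> * D ^ 3) * W x) (ball i (R i / 10) \<inter> ?B0)"
      using \<delta> D_pos by (subst mass_cmult) (auto simp: ennreal_mult mult.assoc)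
    finally show "mass W (ball i (R i / 2) \<inter> H) \<le> mass (\<lambda>x. ennreal (\<delta> * D ^ 3) * W x) (ball i (R i / 10) \<inter> ?B0)" .
  qed (use C in auto)
  also have "\<dots> \<le> mass (\<lambda>x. ennreal (\<delta> * D ^ 3) * W x) (?B0 \<inter> E)"
  proof (rule mass_mono)
    have "ball i (R i / 10) \<subseteq> E" if "i \<in> C" for i
    proof -
      have "0 < R i" using that C(2) \<open>E' \<subseteq> E\<close> by (intro R_pos) (auto simp: H_def)
      then have "ball i (R i / 10) \<subseteq> ball i (R i)" by (intro subset_ball) auto
      then show ?thesis using R_sub by blast
    qed
    then show "(\<Union>i\<in>C. ball i (R i / 10) \<inter> ?B0) \<subseteq> ?B0 \<inter> E" by blast
  qed
  also have "\<dots> = ennreal (\<delta> * D ^ 3) * mass W (?B0 \<inter> E)"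
    by (rule mass_cmult) auto
  finally have H_le: "mass W H \<le> ennreal (\<delta> * D ^ 3) * mass W (?B0 \<inter> E)" .
  have "mass W (?B0 \<inter> E') \<le> mass W (H \<union> (?B0 \<inter> P))"
    by (rule mass_mono) (auto simp: H_def)
  also have "\<dots> \<le> mass W H + mass W (?B0 \<inter> P)" by (rule mass_Un_le) auto
  also have "\<dots> \<le> ennreal (\<delta> * D ^ 3) * mass W (?B0 \<inter> E) + mass W (?B0 \<inter> P)"
    by (intro add_mono H_le order.refl)
  finally show ?thesis unfolding E_def E'_def P_def \<delta>_def .
qed

end

section \<open>Integration over levels, absorption and removal of the truncations\<close>

lemma ennreal_less_times_iff:
  "0 < a \<Longrightarrow> 0 \<le> t \<Longrightarrow> ennreal t < y * ennreal (1 / a) \<longleftrightarrow> ennreal (a * t) < y"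
proof (cases y)
  case (real b)
  assume "0 < a" "0 \<le> t"
  then show ?thesis
    using real by (simp add: ennreal_mult[symmetric] ennreal_less_iff field_simps)
qed (simp add: ennreal_top_mult)

context good_lambda
begin

text \<open>The first summand is the bound for \<open>maxf \<phi>\<close> at level
  \<open>\<gamma> t\<close>, the second comes from the low levels; the factor
  \<open>2 \<alpha>^q\<close> arises when half of \<open>\<alpha>^(-q)\<close> is absorbed.\<close>

definition bound_const :: "real \<Rightarrow> real \<Rightarrow> real" where
  "bound_const \<alpha> \<gamma> = 2 * \<alpha> powr q * (\<gamma> powr (- q) * CM + (5 ^ DIM('a) * A0) powr q * c)"

text \<open>The good-lambda inequality is integrated over all levels and its first term absorbed.
  The bound is uniform in \<open>L\<close> and \<open>\<rho>\<close>, so both can later tend to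
  infinity.\<close>

lemma truncated_maxf_bound:
  assumes \<rho>: "0 < \<rho>" and supp: "mass \<phi> UNIV \<le> mass \<phi> (ball 0 \<rho>)"
    and \<alpha>: "7 ^ DIM('a) \<le> \<alpha>" and \<gamma>: "0 < \<gamma>" "\<gamma> \<le> 1"
    and \<gamma>n: "20 ^ DIM('a) * (2 * \<kappa> * A0 * \<gamma>) / \<alpha> \<le> 1 / (40 ^ n) ^ DIM('a)"
    and \<delta>: "(((CA - 1) / CA) ^ n * D + c * D * N * (4 * \<kappa> / \<alpha>) powr q1) * D ^ 3 \<le> \<alpha> powr (- q) / 2"
    and L: "0 \<le> L"
  defines "F1 \<equiv> (\<lambda>y. F y * indicator (ball 0 (4 * \<rho>)) y)"
  shows "(\<integral>\<^sup>+x. epow (min (maxf (\<lambda>_. 1) F1 x) (ennreal L)) q * (W x * indicator (ball 0 \<rho>) x) \<partial>lebesgue)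
    \<le> ennreal (bound_const \<alpha> \<gamma>) * (\<integral>\<^sup>+x. epow (\<phi> x) q * W x \<partial>lebesgue)"
proof -
  let ?B0 = "ball (0::'a) \<rho>"
  define \<delta>' where "\<delta>' = (((CA - 1) / CA) ^ n * D + c * D * N * (4 * \<kappa> / \<alpha>) powr q1) * D ^ 3"
  have \<delta>': "0 \<le> \<delta>'" using CA_gt_1 D_pos c N by (simp add: \<delta>'_def)
  have [measurable]: "F1 \<in> borel_measurable lebesgue" unfolding F1_def by measurable
  have \<alpha>1: "1 \<le> \<alpha>" using \<alpha> one_le_power[of "7::real" "DIM('a)"] by linarith
  define v where "v x = W x * indicator ?B0 x" for x
  have [measurable]: "v \<in> borel_measurable lebesgue" unfolding v_def by measurable
  have mass_v: "mass v A = mass W (?B0 \<inter> A)" for A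
    unfolding mass_def v_def by (simp add: indicator_inter_arith mult.assoc)
  define X where "X x = min (maxf (\<lambda>_. 1) F1 x) (ennreal L)" for x
  have [measurable]: "X \<in> borel_measurable lebesgue" unfolding X_def by measurable
  define I where "I = (\<integral>\<^sup>+x. epow (X x) q * v x \<partial>lebesgue)"
  define J where "J = (\<integral>\<^sup>+x. epow (\<phi> x) q * W x \<partial>lebesgue)"
  obtain mF where mF: "mass F UNIV = ennreal mF" "0 \<le> mF"
    using mass_F_finite by (cases "mass F UNIV") auto
  obtain n0 where n0: "emeasure lebesgue ?B0 = ennreal n0" "0 < n0"
    using emeasure_lebesgue_ball_pos[OF \<rho>, of "0::'a"] emeasure_lebesgue_ball_finite[of "0::'a" \<rho>]
    by (cases "emeasure lebesgue ?B0") auto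
  \<comment> \<open>The smallest level that \<open>global_good_lambda\<close> admits on this
    ball.\<close>
  define l0 where "l0 = 5 ^ DIM('a) * mF / n0"
  have CM: "0 \<le> CM"
    using c q by (auto simp: CM_def maximal_const_def Let_def doubling_const_def intro!: mult_nonneg_nonneg divide_nonneg_nonneg)
  have l0: "0 \<le> l0" using mF n0 by (simp add: l0_def)
  \<comment> \<open>Level \<open>\<alpha> t\<close> for \<open>X\<close> is level \<open>t\<close>
    for \<open>X / \<alpha>\<close>. The constant function \<open>l0\<close> encodes the low levels:
    its superlevel set is everything for \<open>t < l0\<close> and empty otherwise.\<close>
  have "(\<integral>\<^sup>+x. epow (X x * ennreal (1 / \<alpha>)) q * v x \<partial>lebesgue) \<le> ennreal \<delta>' * (\<integral>\<^sup>+x. epow (X x) q * v x \<partial>lebesgue) +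
    (\<integral>\<^sup>+x. epow (maxf (\<lambda>_. 1) \<phi> x * ennreal (1 / \<gamma>)) q * v x \<partial>lebesgue) + (\<integral>\<^sup>+x. epow (ennreal l0) q * v x \<partial>lebesgue)"
  proof (rule layer_cake_le)
    fix t :: real assume t: "0 < t"
    have X1: "{x. ennreal t < X x * ennreal (1 / \<alpha>)} = {x. ennreal (\<alpha> * t) < X x}"
      using t \<alpha>1 by (auto simp: ennreal_less_times_iff)
    have Y2: "{x. ennreal t < maxf (\<lambda>_. 1) \<phi> x * ennreal (1 / \<gamma>)} = {x. ennreal (\<gamma> * t) < maxf (\<lambda>_. 1) \<phi> x}"
      using t \<gamma> by (auto simp: ennreal_less_times_iff)
    let ?rhs = "ennreal \<delta>' * mass v {x. ennreal t < X x} + mass v {x. ennreal (\<gamma> * t) < maxf (\<lambda>_. 1) \<phi> x}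
      + mass v {x. ennreal t < ennreal l0}"
    have "mass v {x. ennreal (\<alpha> * t) < X x} \<le> ?rhs"
    proof (cases "t < l0")
      case True
      then have "{x :: 'a. ennreal t < ennreal l0} = UNIV" using t by (auto simp: ennreal_less_iff)
      then have "mass v {x. ennreal (\<alpha> * t) < X x} \<le> mass v {x. ennreal t < ennreal l0}"
        by (auto intro: mass_mono)
      also have "\<dots> \<le> ?rhs" by simp
      finally show ?thesis .
    next
      case False
      show ?thesis
      proof (cases "\<alpha> * t < L")
        case True
        have "t \<le> \<alpha> * t" using t \<alpha>1 by simp
        with True have tL: "t < L" by linarith
        have eq: "{x. ennreal s < X x} = {x. ennreal s < maxf (\<lambda>_. 1) F1 x}" if "s < L" "0 \<le> s" for s
          using that by (auto simp: X_def ennreal_less_iff)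
        have "mass W (?B0 \<inter> {y. ennreal (\<alpha> * t) < maxf (\<lambda>_. 1) F1 y}) \<le>
          ennreal \<delta>' * mass W (?B0 \<inter> {y. ennreal t < maxf (\<lambda>_. 1) F1 y}) +
          mass W (?B0 \<inter> {y. ennreal (\<gamma> * t) < maxf (\<lambda>_. 1) \<phi> y})"
          unfolding F1_def \<delta>'_def
        proof (rule global_good_lambda[OF \<rho> t \<alpha> \<gamma> \<gamma>n])
          have "5 ^ DIM('a) * mF \<le> t * n0" using False n0 by (simp add: l0_def field_simps)
          then have "ennreal (5 ^ DIM('a) * mF) \<le> ennreal (t * n0)" by (rule ennreal_leI)
          then show "ennreal (5 ^ DIM('a)) * mass F UNIV \<le> ennreal t * emeasure lebesgue ?B0"
            using mF n0 t by (simp add: ennreal_mult)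
        qed
        then show ?thesis
          using eq[of t] eq[of "\<alpha> * t"] True tL t \<alpha>1 by (simp add: mass_v add_increasing2)
      next
        case False
        then have "{x. ennreal (\<alpha> * t) < X x} = {}"
          using L by (auto simp: X_def not_less intro: ennreal_leI)
        then show ?thesis by simp
      qed
    qed
    then show "mass v {x. ennreal t < X x * ennreal (1 / \<alpha>)} \<le> ennreal \<delta>' * mass v {x. ennreal t < X x} +
      mass v {x. ennreal t < maxf (\<lambda>_. 1) \<phi> x * ennreal (1 / \<gamma>)} + mass v {x. ennreal t < ennreal l0}"
      by (simp only: X1 Y2)
  qed (use q in auto)
  also have "(\<integral>\<^sup>+x. epow (X x * ennreal (1 / \<alpha>)) q * v x \<partial>lebesgue) = ennreal (\<alpha> powr (- q)) * I"
  proof -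
    have "epow (X x * ennreal (1 / \<alpha>)) q * v x = ennreal (\<alpha> powr (- q)) * (epow (X x) q * v x)" for x
      using \<alpha>1 by (simp add: epow_mult powr_divide powr_minus_divide mult_ac)
    then show ?thesis unfolding I_def by (simp add: nn_integral_cmult)
  qed
  also have "(\<integral>\<^sup>+x. epow (maxf (\<lambda>_. 1) \<phi> x * ennreal (1 / \<gamma>)) q * v x \<partial>lebesgue) \<le> ennreal (\<gamma> powr (- q) * CM) * J"
  proof -
    have "(\<integral>\<^sup>+x. epow (maxf (\<lambda>_. 1) \<phi> x * ennreal (1 / \<gamma>)) q * v x \<partial>lebesgue) \<le>
      (\<integral>\<^sup>+x. ennreal (\<gamma> powr (- q)) * (epow (maxf (\<lambda>_. 1) \<phi> x) q * W x) \<partial>lebesgue)"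
    proof (rule nn_integral_mono)
      fix x
      have "epow (maxf (\<lambda>_. 1) \<phi> x * ennreal (1 / \<gamma>)) q * v x = ennreal (\<gamma> powr (- q)) * (epow (maxf (\<lambda>_. 1) \<phi> x) q * v x)"
        using \<gamma> by (simp add: epow_mult powr_divide powr_minus_divide mult_ac)
      also have "\<dots> \<le> ennreal (\<gamma> powr (- q)) * (epow (maxf (\<lambda>_. 1) \<phi> x) q * W x)"
        by (intro mult_left_mono) (auto simp: v_def split: split_indicator)
      finally show "epow (maxf (\<lambda>_. 1) \<phi> x * ennreal (1 / \<gamma>)) q * v x \<le> ennreal (\<gamma> powr (- q)) * (epow (maxf (\<lambda>_. 1) \<phi> x) q * W x)" .
    qed
    also have "\<dots> = ennreal (\<gamma> powr (- q)) * (\<integral>\<^sup>+x. epow (maxf (\<lambda>_. 1) \<phi> x) q * W x \<partial>lebesgue)"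
      by (rule nn_integral_cmult) measurable
    also have "\<dots> \<le> ennreal (\<gamma> powr (- q)) * (ennreal CM * J)"
      unfolding J_def by (intro mult_left_mono maxf_bounded) auto
    also have "\<dots> = ennreal (\<gamma> powr (- q) * CM) * J"
      using CM by (simp add: ennreal_mult mult.assoc)
    finally show ?thesis .
  qed
  also have "(\<integral>\<^sup>+x. epow (ennreal l0) q * v x \<partial>lebesgue) \<le> ennreal ((5 ^ DIM('a) * A0) powr q * c) * J"
  proof -
    have "(\<integral>\<^sup>+x. epow (ennreal l0) q * v x \<partial>lebesgue) = ennreal (l0 powr q) * mass v UNIV"
      using l0 by (simp add: nn_integral_cmult mass_def)
    also have "mass v UNIV = mass W ?B0" by (simp add: mass_v)
    finally have eq: "(\<integral>\<^sup>+x. epow (ennreal l0) q * v x \<partial>lebesgue) = ennreal (l0 powr q) * mass W ?B0" .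
    \<comment> \<open>Here \<open>l0 n0\<close> is \<open>5^d\<close> times the mass of
      \<open>F\<close>, which is controlled by the mass of \<open>\<phi>\<close>, all of it carried
      by \<open>B0\<close>; the averaging bound on \<open>B0\<close> turns this into the weighted
      norm of \<open>\<phi>\<close>.\<close>
    have "ennreal (n0 powr q) * (ennreal (l0 powr q) * mass W ?B0) = epow (ennreal (5 ^ DIM('a)) * mass F UNIV) q * mass W ?B0"
    proof -
      have "n0 powr q * l0 powr q = (5 ^ DIM('a) * mF) powr q"
        using n0 mF l0 by (simp add: l0_def flip: powr_mult)
      then show ?thesis
        using mF by (simp add: mult.assoc[symmetric] ennreal_mult[symmetric])
    qed
    also have "\<dots> \<le> epow (ennreal (5 ^ DIM('a)) * (ennreal A0 * mass \<phi> ?B0)) q * mass W ?B0"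
    proof (intro mult_right_mono epow_mono mult_left_mono)
      show "mass F UNIV \<le> ennreal A0 * mass \<phi> ?B0"
        using mass_F supp by (meson mult_left_mono order.trans zero_le)
    qed (use q in auto)
    also have "\<dots> = ennreal ((5 ^ DIM('a) * A0) powr q) * (epow (mass \<phi> ?B0) q * mass W ?B0)"
      using A0 by (simp add: epow_mult powr_mult ennreal_mult mult.assoc)
    also have "\<dots> \<le> ennreal ((5 ^ DIM('a) * A0) powr q) * (ennreal c * epow (emeasure lebesgue ?B0) q * mass (\<lambda>y. epow (\<phi> y) q * W y) ?B0)"
      using \<rho> by (intro mult_left_mono mass_powr_le) auto
    also have "\<dots> \<le> ennreal ((5 ^ DIM('a) * A0) powr q) * (ennreal c * epow (emeasure lebesgue ?B0) q * J)"
      unfolding J_def mass_def by (intro mult_left_mono nn_integral_mono) (auto split: split_indicator)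
    also have "\<dots> = ennreal (n0 powr q) * (ennreal ((5 ^ DIM('a) * A0) powr q * c) * J)"
      using n0 c by (simp add: ennreal_mult mult_ac)
    finally show ?thesis
      unfolding eq using n0 by (subst (asm) ennreal_mult_le_mult_iff) auto
  qed
  finally have main: "ennreal (\<alpha> powr (- q)) * I \<le> ennreal \<delta>' * I + ennreal (\<gamma> powr (- q) * CM) * J + ennreal ((5 ^ DIM('a) * A0) powr q * c) * J"
    by (simp add: I_def add_mono)
  define M where "M = \<gamma> powr (- q) * CM + (5 ^ DIM('a) * A0) powr q * c"
  have M: "0 < M" using CM A0 c by (simp add: M_def add_nonneg_pos)
  have main: "ennreal (\<alpha> powr (- q)) * I \<le> ennreal \<delta>' * I + ennreal M * J"
    using main CM c by (simp add: M_def distrib_right add.assoc)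
  \<comment> \<open>The cap \<open>L\<close> makes \<open>I\<close> finite, so that
    \<open>\<delta>' I\<close> can be subtracted.\<close>
  have "I \<le> (\<integral>\<^sup>+x. ennreal (L powr q) * v x \<partial>lebesgue)"
    unfolding I_def
  proof (intro nn_integral_mono mult_right_mono)
    fix x
    have "epow (X x) q \<le> epow (ennreal L) q" using q by (intro epow_mono) (auto simp: X_def)
    then show "epow (X x) q \<le> ennreal (L powr q)" using L by simp
  qed simp
  also have "\<dots> = ennreal (L powr q) * mass W ?B0"
    using mass_v[of UNIV] by (simp add: nn_integral_cmult mass_def)
  also have "\<dots> < top" using mass_w_finite by (simp add: ennreal_mult_less_top)
  finally have I_fin: "I < top" .
  have "I \<le> ennreal (2 * \<alpha> powr q * M) * J"
  proof (cases J)
    case (real b)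
    obtain i where i: "I = ennreal i" "0 \<le> i" using I_fin by (cases I) auto
    have "ennreal (\<alpha> powr (- q) * i) \<le> ennreal (\<delta>' * i + M * b)"
      using main real i \<delta>' M by (simp add: ennreal_mult)
    then have "\<alpha> powr (- q) * i \<le> \<delta>' * i + M * b"
      using i real M \<delta>' by (subst (asm) ennreal_le_iff) auto
    also have "\<dots> \<le> \<alpha> powr (- q) / 2 * i + M * b"
      using \<delta> i unfolding \<delta>'_def by (intro add_right_mono mult_right_mono) auto
    finally have "\<alpha> powr (- q) * i \<le> 2 * M * b" by simp
    then have "\<alpha> powr q * (\<alpha> powr (- q) * i) \<le> \<alpha> powr q * (2 * M * b)"
      by (intro mult_left_mono) auto
    moreover have "\<alpha> powr q * \<alpha> powr (- q) = 1" using \<alpha>1 by (simp flip: powr_add)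
    ultimately have "i \<le> \<alpha> powr q * (2 * M * b)" by (simp only: mult.assoc[symmetric] mult_1_left)
    then have "i \<le> 2 * \<alpha> powr q * M * b" by (simp only: mult_ac)
    then show ?thesis using i real M by (simp add: ennreal_mult[symmetric] ennreal_leI)
  next
    case top
    have "0 < 2 * \<alpha> powr q * M" using M \<alpha>1 by simp
    then have "ennreal (2 * \<alpha> powr q * M) * J = top"
      unfolding top ennreal_mult_top by (meson ennreal_eq_0_iff not_le)
    then show ?thesis by simp
  qed
  then show ?thesis unfolding I_def J_def X_def v_def M_def bound_const_def .
qed

text \<open>On the ball of radius \<open>m\<close>, \<open>F\<close> is almost everywhere below the
  maximal function of its cut-off. Height and radius are both set to \<open>m\<close>, and monotone
  convergence removes them.\<close>

theorem good_lambda_bound: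
  assumes supp: "mass \<phi> UNIV \<le> mass \<phi> (ball 0 \<rho>0)"
    and \<alpha>: "7 ^ DIM('a) \<le> \<alpha>" and \<gamma>: "0 < \<gamma>" "\<gamma> \<le> 1"
    and \<gamma>n: "20 ^ DIM('a) * (2 * \<kappa> * A0 * \<gamma>) / \<alpha> \<le> 1 / (40 ^ n) ^ DIM('a)"
    and \<delta>: "(((CA - 1) / CA) ^ n * D + c * D * N * (4 * \<kappa> / \<alpha>) powr q1) * D ^ 3 \<le> \<alpha> powr (- q) / 2"
  shows "(\<integral>\<^sup>+x. epow (F x) q * W x \<partial>lebesgue)
    \<le> ennreal (bound_const \<alpha> \<gamma>) * (\<integral>\<^sup>+x. epow (\<phi> x) q * W x \<partial>lebesgue)"
proof -
  define h where "h n x = epow (min (F x) (ennreal (real n))) q * (W x * indicator (ball 0 (real n)) x)" for n x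
  have [measurable]: "h n \<in> borel_measurable lebesgue" for n unfolding h_def by measurable
  have mono: "h m x \<le> h n x" if "m \<le> n" for m n x
    unfolding h_def using that q
    by (intro mult_mono epow_mono min.mono ennreal_leI) (auto split: split_indicator)
  obtain N0 :: nat where N0: "\<rho>0 \<le> real N0" "1 \<le> real N0"
    using real_arch_simple[of "max \<rho>0 1"] by auto
  have bound: "(\<integral>\<^sup>+x. h m x \<partial>lebesgue) \<le> ennreal (bound_const \<alpha> \<gamma>) * (\<integral>\<^sup>+x. epow (\<phi> x) q * W x \<partial>lebesgue)"
    if "N0 \<le> m" for m
  proof -
    have m: "\<rho>0 \<le> real m" "1 \<le> real m" using N0 that by linarith+
    define F1 where "F1 y = F y * indicator (ball 0 (4 * real m)) y" for y
    have [measurable]: "F1 \<in> borel_measurable lebesgue" unfolding F1_def by measurable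
    have "mass F1 UNIV \<le> mass F UNIV" by (intro mass_mono_fun) (auto simp: F1_def split: split_indicator)
    then have "AE x in lebesgue. F1 x \<le> maxf (\<lambda>_. 1) F1 x"
      using mass_F_finite by (intro AE_le_maxf) auto
    then have "(\<integral>\<^sup>+x. h m x \<partial>lebesgue) \<le>
        (\<integral>\<^sup>+x. epow (min (maxf (\<lambda>_. 1) F1 x) (ennreal (real m))) q * (W x * indicator (ball 0 (real m)) x) \<partial>lebesgue)"
    proof (intro nn_integral_mono_AE, eventually_elim)
      case (elim x)
      show ?case
      proof (cases "x \<in> ball 0 (real m)")
        case True
        then have "F x = F1 x" using m by (simp add: F1_def)
        then show ?thesis unfolding h_def using elim q by (intro mult_right_mono epow_mono min.mono) auto
      qed (simp add: h_def)
    qed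
    also have "\<dots> \<le> ennreal (bound_const \<alpha> \<gamma>) * (\<integral>\<^sup>+x. epow (\<phi> x) q * W x \<partial>lebesgue)"
      unfolding F1_def
    proof (rule truncated_maxf_bound[OF _ _ \<alpha> \<gamma> \<gamma>n \<delta>])
      show "mass \<phi> UNIV \<le> mass \<phi> (ball 0 (real m))"
        using m by (intro order.trans[OF supp] mass_mono subset_ball)
    qed (use m in auto)
    finally show ?thesis .
  qed
  have "AE x in lebesgue. F x \<noteq> \<infinity>"
    using mass_F_finite by (intro nn_integral_PInf_AE) (auto simp: mass_def)
  then have "(\<integral>\<^sup>+x. epow (F x) q * W x \<partial>lebesgue) \<le> (\<integral>\<^sup>+x. (SUP n. h (n + N0) x) \<partial>lebesgue)"
  proof (intro nn_integral_mono_AE, eventually_elim)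
    case (elim x)
    then obtain a where a: "F x = ennreal a" "0 \<le> a" by (cases "F x") auto
    obtain k :: nat where k: "max a (norm x + 1) \<le> real k" using real_arch_simple by blast
    then have "a \<le> real (k + N0)" "norm x < real (k + N0)" by auto
    then have "epow (F x) q * W x = h (k + N0) x"
      using a by (simp add: h_def min_absorb1 ennreal_leI del: of_nat_add)
    then show ?case by (metis SUP_upper UNIV_I)
  qed
  also have "\<dots> = (SUP n. (\<integral>\<^sup>+x. h (n + N0) x \<partial>lebesgue))"
    by (rule nn_integral_monotone_convergence_SUP) (auto simp: incseq_def le_fun_def intro: mono)
  also have "\<dots> \<le> ennreal (bound_const \<alpha> \<gamma>) * (\<integral>\<^sup>+x. epow (\<phi> x) q * W x \<partial>lebesgue)"
    by (intro SUP_least bound) auto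
  finally show ?thesis .
qed

end

text \<open>The constants are chosen in the order \<open>\<alpha>\<close> (enlarging factor), \<open>n\<close> (number of \<open>A\<^sub>\<infinity>\<close> iterations), \<open>\<gamma>\<close>;
  the choice of \<open>\<alpha>\<close> uses \<open>q < q1\<close>.\<close>

theorem good_lambda_uniform:
  fixes q c q1 \<kappa> A0 N :: real
  assumes q: "1 < q" and c: "0 < c" and q1: "q < q1" and pos: "0 < \<kappa>" "0 < A0" "0 < N"
  shows "\<exists>C. \<forall>w F \<phi> \<rho>. good_lambda q c w q1 \<kappa> A0 N F \<phi> \<longrightarrow>
    mass \<phi> UNIV \<le> mass \<phi> (ball (0 :: 'a::euclidean_space) \<rho>) \<longrightarrow>
    (\<integral>\<^sup>+x. epow (F x) q * ennreal (w x) \<partial>lebesgue) \<le> ennreal C * (\<integral>\<^sup>+x. epow (\<phi> x) q * ennreal (w x) \<partial>lebesgue)"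
proof -
  define D' where "D' = doubling_const q c DIM('a)"
  define A where "A = Ainfty_const q c DIM('a)"
  have D': "0 < D'" using c by (simp add: D'_def doubling_const_def)
  have A: "1 < A" using c D' by (simp add: A_def Ainfty_const_def D'_def)
  \<comment> \<open>Four times the coefficient of \<open>\<alpha>^(-q1)\<close> in the outer term;
    \<open>\<alpha>^(q1 - q) \<ge> Z\<close> makes that term at most a quarter of
    \<open>\<alpha>^(-q)\<close>.\<close>
  define Z where "Z = 4 * (c * D' * N * (4 * \<kappa>) powr q1 * D' ^ 3)"
  have Z: "0 < Z" using c D' pos by (simp add: Z_def)
  define \<alpha> where "\<alpha> = max (7 ^ DIM('a)) (Z powr (1 / (q1 - q)))"
  have \<alpha>: "7 ^ DIM('a) \<le> \<alpha>" "Z powr (1 / (q1 - q)) \<le> \<alpha>" by (auto simp: \<alpha>_def)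
  have \<alpha>0: "0 < \<alpha>" using \<alpha>(1) zero_less_power[of "7::real" "DIM('a)"] by linarith
  have "Z = (Z powr (1 / (q1 - q))) powr (q1 - q)" using q1 Z by (simp add: powr_powr)
  also have "\<dots> \<le> \<alpha> powr (q1 - q)" using q1 \<alpha> by (intro powr_mono2) auto
  finally have "Z * \<alpha> powr (- q1) \<le> \<alpha> powr (q1 - q) * \<alpha> powr (- q1)" by (intro mult_right_mono) auto
  then have "Z * \<alpha> powr (- q1) \<le> \<alpha> powr (- q)" by (simp flip: powr_add)
  moreover have "(4 * \<kappa> / \<alpha>) powr q1 = (4 * \<kappa>) powr q1 * \<alpha> powr (- q1)"
    using \<alpha>0 pos by (simp add: powr_divide powr_minus_divide)
  ultimately have d1: "c * D' * N * (4 * \<kappa> / \<alpha>) powr q1 * D' ^ 3 \<le> \<alpha> powr (- q) / 4"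
    by (simp add: Z_def mult_ac)
  have "(A - 1) / A < 1" using A by simp
  moreover have "0 < \<alpha> powr (- q) / (4 * D' ^ 4)" using \<alpha>0 D' by simp
  \<comment> \<open>With \<open>\<alpha>\<close> fixed, enough iterations bring the inner term below
    another quarter of \<open>\<alpha>^(-q)\<close>.\<close>
  ultimately obtain n where n: "((A - 1) / A) ^ n < \<alpha> powr (- q) / (4 * D' ^ 4)"
    using real_arch_pow_inv[of "\<alpha> powr (- q) / (4 * D' ^ 4)" "(A - 1) / A"] by auto
  have "((A - 1) / A) ^ n * D' ^ 4 \<le> \<alpha> powr (- q) / (4 * D' ^ 4) * D' ^ 4"
    using n D' by (intro mult_right_mono) auto
  then have d2: "((A - 1) / A) ^ n * D' * D' ^ 3 \<le> \<alpha> powr (- q) / 4"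
    using D' by (simp add: eval_nat_numeral mult_ac)
  have d: "(((A - 1) / A) ^ n * D' + c * D' * N * (4 * \<kappa> / \<alpha>) powr q1) * D' ^ 3 \<le> \<alpha> powr (- q) / 2"
    unfolding distrib_right using d1 d2 by linarith
  \<comment> \<open>The value for which the smallness condition on \<open>\<gamma>\<close> becomes
    an equality.\<close>
  define g where "g = \<alpha> / (20 ^ DIM('a) * (2 * \<kappa> * A0)) / (40 ^ n) ^ DIM('a)"
  define \<gamma> where "\<gamma> = min 1 g"
  have g: "0 < g" using \<alpha>0 pos by (simp add: g_def)
  have \<gamma>: "0 < \<gamma>" "\<gamma> \<le> 1" using g by (auto simp: \<gamma>_def)
  have "20 ^ DIM('a) * (2 * \<kappa> * A0 * \<gamma>) / \<alpha> \<le> 20 ^ DIM('a) * (2 * \<kappa> * A0 * g) / \<alpha>"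
    using \<alpha>0 pos by (intro divide_right_mono mult_left_mono) (auto simp: \<gamma>_def)
  also have "\<dots> = 1 / (40 ^ n) ^ DIM('a)"
    using \<alpha>0 pos by (simp add: g_def)
  finally have \<gamma>n: "20 ^ DIM('a) * (2 * \<kappa> * A0 * \<gamma>) / \<alpha> \<le> 1 / (40 ^ n) ^ DIM('a)" .
  define C where "C = 2 * \<alpha> powr q * (\<gamma> powr (- q) * maximal_const q c DIM('a) + (5 ^ DIM('a) * A0) powr q * c)"
  show ?thesis
  proof (intro exI[of _ C] allI impI)
    fix w F \<phi> \<rho>
    assume gl: "good_lambda q c w q1 \<kappa> A0 N F \<phi>" and supp: "mass \<phi> UNIV \<le> mass \<phi> (ball (0 :: 'a) \<rho>)"
    interpret good_lambda q c w q1 \<kappa> A0 N F \<phi> by (rule gl)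
    show "(\<integral>\<^sup>+x. epow (F x) q * ennreal (w x) \<partial>lebesgue) \<le> ennreal C * (\<integral>\<^sup>+x. epow (\<phi> x) q * ennreal (w x) \<partial>lebesgue)"
      using good_lambda_bound[OF supp \<alpha>(1) \<gamma> \<gamma>n] d
      unfolding C_def D'_def A_def CA_def CM_def D_def bound_const_def by blast
  qed
qed

section \<open>Weights and operators in the form of the statement\<close>

lemma avg_eq: "avg B h = mass h B / emeasure lebesgue B"
  by (simp add: avg_def mass_def)

lemma Aq_weight_ball:
  assumes w: "Aq_weight q Cw w" and "0 < r"
  shows "avg (ball x r) (\<lambda>x. ennreal (w x)) *
    epow (avg (ball x r) (\<lambda>x. if w x = 0 then \<infinity> else ennreal (w x powr (-1 / (q - 1))))) (q - 1)
    \<le> ennreal Cw"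
proof -
  have "is_ball (ball x r)" unfolding is_ball_def using \<open>0 < r\<close> by blast
  then show ?thesis using w unfolding Aq_weight_def by blast
qed

text \<open>If the weight has positive mass on a ball about the origin, the \<open>A_q\<close>
  condition makes the dual weight integrable on all larger ones. Since the dual weight is
  \<open>\<infinity>\<close> where the weight vanishes, the zeros form a null set.\<close>

lemma Aq_weight_zero_or_pos:
  fixes w :: "'a::euclidean_space \<Rightarrow> real"
  assumes w: "Aq_weight q Cw w" and q: "1 < q"
  shows "(AE x in lebesgue. w x = 0) \<or> (AE x in lebesgue. 0 < w x)"
proof (cases "\<forall>n::nat. mass (\<lambda>x. ennreal (w x)) (ball 0 (real n)) = 0")
  case True
  have [measurable]: "w \<in> borel_measurable lebesgue" and w0: "\<And>x. 0 \<le> w x"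
    using w by (auto simp: Aq_weight_def)
  have "AE x in lebesgue. ennreal (w x) * indicator (ball 0 (real n)) x = 0" for n
    using True unfolding mass_def by (subst nn_integral_0_iff_AE[symmetric]) auto
  then have "AE x in lebesgue. \<forall>n::nat. ennreal (w x) * indicator (ball 0 (real n)) x = 0"
    unfolding AE_all_countable by blast
  then have "AE x in lebesgue. w x = 0"
  proof eventually_elim
    case (elim x)
    obtain n :: nat where "norm x < real n" using reals_Archimedean2 by blast
    then show ?case using elim[rule_format, of n] w0[of x] by simp
  qed
  then show ?thesis by blast
next
  case False
  have [measurable]: "w \<in> borel_measurable lebesgue" and w0: "\<And>x. 0 \<le> w x"
    using w by (auto simp: Aq_weight_def)
  define \<sigma> where "\<sigma> x = (if w x = 0 then \<infinity> else ennreal (w x powr (-1 / (q - 1))))" for x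
  have [measurable]: "\<sigma> \<in> borel_measurable lebesgue" unfolding \<sigma>_def by measurable
  obtain n0 :: nat where n0: "mass (\<lambda>x. ennreal (w x)) (ball 0 (real n0)) \<noteq> 0" using False by blast
  have "AE x in lebesgue. x \<in> ball 0 (real n) \<longrightarrow> n0 \<le> n \<longrightarrow> w x \<noteq> 0" for n
  proof (cases "n0 \<le> n \<and> 0 < n")
    case True
    let ?B = "ball (0::'a) (real n)"
    have "mass (\<lambda>x. ennreal (w x)) (ball 0 (real n0)) \<le> mass (\<lambda>x. ennreal (w x)) ?B"
      using True by (intro mass_mono subset_ball) auto
    with n0 have "mass (\<lambda>x. ennreal (w x)) ?B \<noteq> 0" by auto
    moreover have "emeasure lebesgue ?B \<noteq> top" using emeasure_lebesgue_ball_finite[of "0::'a" "real n"] by simp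
    ultimately have "avg ?B (\<lambda>x. ennreal (w x)) \<noteq> 0" by (simp add: avg_eq)
    moreover have "avg ?B (\<lambda>x. ennreal (w x)) * epow (avg ?B \<sigma>) (q - 1) \<le> ennreal Cw"
      using Aq_weight_ball[OF w, of "real n" 0] True unfolding \<sigma>_def by simp
    ultimately have "epow (avg ?B \<sigma>) (q - 1) \<noteq> top"
      by (auto simp: ennreal_mult_top top_unique)
    then have "mass \<sigma> ?B \<noteq> top"
      using emeasure_lebesgue_ball_finite[of "0::'a" "real n", THEN less_imp_neq]
      by (auto simp: avg_eq ennreal_top_divide)
    then have "AE x in lebesgue. \<sigma> x * indicator ?B x \<noteq> \<infinity>"
      unfolding mass_def by (intro nn_integral_PInf_AE) auto
    then show ?thesis
      by (rule eventually_mono) (auto simp: \<sigma>_def)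
  next
    case False
    then show ?thesis by (cases "n = 0") auto
  qed
  then have "AE x in lebesgue. \<forall>n::nat. x \<in> ball 0 (real n) \<longrightarrow> n0 \<le> n \<longrightarrow> w x \<noteq> 0"
    unfolding AE_all_countable by blast
  then have "AE x in lebesgue. 0 < w x"
  proof eventually_elim
    case (elim x)
    obtain n :: nat where n: "max (norm x + 1) (real n0) \<le> real n" using real_arch_simple by blast
    then have "x \<in> ball 0 (real n)" "n0 \<le> n" by auto
    then show ?case using elim w0[of x] by (auto simp: less_le)
  qed
  then show ?thesis by blast
qed

lemma mass_cong_AE: "AE x in lebesgue. u x = v x \<Longrightarrow> mass u A = mass v A"
  unfolding mass_def by (intro nn_integral_cong_AE) (auto elim: eventually_mono)

text \<open>Modifying the weight on a null set changes no mass. The locale wants a positive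
  constant, whereas \<open>Cw\<close> is an arbitrary real; hence \<open>max Cw 1\<close>.\<close>

lemma Aq_weight_muckenhoupt:
  fixes w :: "'a::euclidean_space \<Rightarrow> real"
  assumes w: "Aq_weight q Cw w" and q: "1 < q" and pos: "AE x in lebesgue. 0 < w x"
  shows "muckenhoupt q (max Cw 1) (\<lambda>x. if w x = 0 then 1 else w x)"
proof -
  have [measurable]: "w \<in> borel_measurable lebesgue" and w0: "\<And>x. 0 \<le> w x"
    using w by (auto simp: Aq_weight_def)
  define u where "u x = (if w x = 0 then 1 else w x)" for x
  define \<sigma> where "\<sigma> x = (if w x = 0 then \<infinity> else ennreal (w x powr (-1 / (q - 1))))" for x
  have u0: "0 < u x" for x using w0[of x] by (auto simp: u_def less_le)
  have [measurable]: "u \<in> borel_measurable lebesgue" unfolding u_def by measurable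
  have mu: "mass (\<lambda>x. ennreal (u x)) A = mass (\<lambda>x. ennreal (w x)) A" for A
    by (rule mass_cong_AE) (use pos in eventually_elim, auto simp: u_def)
  have ms: "mass (\<lambda>x. ennreal (u x powr (-1 / (q - 1)))) A = mass \<sigma> A" for A
    by (rule mass_cong_AE) (use pos in eventually_elim, auto simp: u_def \<sigma>_def)
  have fin: "mass (\<lambda>x. ennreal (u x)) (ball x r) < top" for x r
  proof -
    have "mass (\<lambda>x. ennreal (u x)) (ball x r) \<le> mass (\<lambda>x. ennreal (w x)) (cball x r)"
      unfolding mu by (rule mass_mono) auto
    also have "\<dots> < top"
      using w compact_cball[of x r] unfolding Aq_weight_def mass_def by auto
    finally show ?thesis .
  qed
  have Aq: "mass (\<lambda>x. ennreal (u x)) (ball x r) *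
          epow (mass (\<lambda>x. ennreal (u x powr (-1 / (q - 1)))) (ball x r)) (q - 1)
        \<le> ennreal (max Cw 1) * epow (emeasure lebesgue (ball x r)) q" if r: "0 < r" for x r
  proof -
    let ?B = "ball x r" and ?U = "mass (\<lambda>x. ennreal (u x)) (ball x r)" and ?S = "mass (\<lambda>x. ennreal (u x powr (-1 / (q - 1)))) (ball x r)"
    obtain n where n: "emeasure lebesgue (ball x r) = ennreal n" "0 < n"
      using emeasure_lebesgue_ball_pos[OF r, of x] emeasure_lebesgue_ball_finite[of x r]
      by (cases "emeasure lebesgue (ball x r)") auto
    have div: "y / ennreal n = y * ennreal (1 / n)" for y
      using n by (simp add: divide_ennreal_def inverse_ennreal divide_inverse)
    have "avg ?B (\<lambda>x. ennreal (w x)) * epow (avg ?B \<sigma>) (q - 1) \<le> ennreal Cw"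
      unfolding \<sigma>_def by (rule Aq_weight_ball[OF w r])
    also have "\<dots> \<le> ennreal (max Cw 1)" by (intro ennreal_leI) auto
    finally have "(?U * ennreal (1 / n)) * (epow ?S (q - 1) * ennreal ((1 / n) powr (q - 1))) \<le> ennreal (max Cw 1)"
      unfolding mu ms using n by (simp add: avg_eq div epow_mult)
    then have "ennreal (n powr q) * ((?U * ennreal (1 / n)) * (epow ?S (q - 1) * ennreal ((1 / n) powr (q - 1)))) \<le>
        ennreal (n powr q) * ennreal (max Cw 1)"
      by (intro mult_left_mono) auto
    also have "ennreal (n powr q) * ((?U * ennreal (1 / n)) * (epow ?S (q - 1) * ennreal ((1 / n) powr (q - 1)))) =
        ?U * epow ?S (q - 1) * (ennreal (n powr q) * ennreal (1 / n) * ennreal ((1 / n) powr (q - 1)))"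
      by (simp only: mult_ac)
    also have "ennreal (n powr q) * ennreal (1 / n) * ennreal ((1 / n) powr (q - 1)) = 1"
    proof -
      have "n powr q * (1 / n) * (1 / n) powr (q - 1) = 1"
        using n by (simp add: powr_divide powr_diff)
      then show ?thesis using n by (simp add: ennreal_mult[symmetric])
    qed
    finally show ?thesis using n by (simp add: mult.commute)
  qed
  \<comment> \<open>A finite product whose first factor is positive has a finite second
    factor.\<close>
  have fin': "mass (\<lambda>x. ennreal (u x powr (-1 / (q - 1)))) (ball x r) < top" for x r
  proof (cases "0 < r")
    case True
    have "mass (\<lambda>x. ennreal (u x)) (ball x r) \<noteq> 0"
      using mass_pos[of "\<lambda>x. ennreal (u x)" r x] True u0 by auto
    moreover have "ennreal (max Cw 1) * epow (emeasure lebesgue (ball x r)) q < top"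
      using emeasure_lebesgue_ball_finite[of x r] by (simp add: ennreal_mult_less_top)
    then have "mass (\<lambda>x. ennreal (u x)) (ball x r) *
          epow (mass (\<lambda>x. ennreal (u x powr (-1 / (q - 1)))) (ball x r)) (q - 1) < top"
      using Aq[OF True, of x] by (rule le_less_trans[rotated])
    ultimately show ?thesis
      by (auto simp: ennreal_mult_less_top)
  next
    case False
    then have "ball x r = {}" by (intro ball_empty) simp
    then show ?thesis by (simp del: ball_eq_empty)
  qed
  have "muckenhoupt q (max Cw 1) u"
    by unfold_locales (use q u0 fin fin' Aq in auto)
  then show ?thesis by (simp add: u_def[abs_def])
qed

section \<open>Function spaces, and extraction of the good-lambda data from the operator\<close>

lemma Linf_c_imp_Lp:
  assumes f: "Linf_c f" and p: "0 < p"
  shows "Lp p f"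
proof -
  obtain M S where M: "AE x in lebesgue. \<bar>f x\<bar> \<le> M" and S: "compact S" "AE x in lebesgue. x \<notin> S \<longrightarrow> f x = 0"
    and [measurable]: "f \<in> borel_measurable lebesgue"
    using f by (auto simp: Linf_c_def)
  have S_meas: "S \<in> sets lebesgue" using S by (simp add: borel_compact)
  have "(\<integral>\<^sup>+x. ennreal (\<bar>f x\<bar> powr p) \<partial>lebesgue) \<le> (\<integral>\<^sup>+x. ennreal (M powr p) * indicator S x \<partial>lebesgue)"
  proof (rule nn_integral_mono_AE, use M S(2) in eventually_elim)
    case (elim x)
    then show ?case using p by (cases "x \<in> S") (auto intro!: ennreal_leI powr_mono2)
  qed
  also have "\<dots> = ennreal (M powr p) * emeasure lebesgue S"
    using S_meas by (rule nn_integral_cmult_indicator)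
  also have "\<dots> < top"
    using S(1) lmeasurable_compact by (auto simp: ennreal_mult_less_top fmeasurable_def)
  finally show ?thesis by (simp add: Lp_def)
qed

lemma Linf_c_restrict:
  assumes f: "Linf_c f" and A: "A \<in> sets lebesgue"
  shows "Linf_c (\<lambda>x. f x * indicator A x)"
proof -
  obtain M S where M: "AE x in lebesgue. \<bar>f x\<bar> \<le> M" and S: "compact S" "AE x in lebesgue. x \<notin> S \<longrightarrow> f x = 0"
    and [measurable]: "f \<in> borel_measurable lebesgue"
    using f by (auto simp: Linf_c_def)
  note [measurable] = A
  have "AE x in lebesgue. \<bar>f x * indicator A x\<bar> \<le> M"
    using M by eventually_elim (auto split: split_indicator)
  moreover have "AE x in lebesgue. x \<notin> S \<longrightarrow> f x * indicator A x = 0"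
    using S(2) by eventually_elim auto
  ultimately show ?thesis unfolding Linf_c_def using S(1) by auto
qed

lemma Lp_norm_le_iff:
  assumes "0 < p"
  shows "Lp_norm p g \<le> ennreal C * Lp_norm p f \<longleftrightarrow>
    (\<integral>\<^sup>+x. ennreal (\<bar>g x\<bar> powr p) \<partial>lebesgue) \<le> epow (ennreal C) p * (\<integral>\<^sup>+x. ennreal (\<bar>f x\<bar> powr p) \<partial>lebesgue)"
  using assms by (simp add: Lp_norm_def epow_le_iff epow_mult epow_epow)

text \<open>The sum is bounded by twice the maximum, which works for every positive exponent,
  including those below 1 where convexity of the power fails.\<close>

lemma quasi_triangle_powr:
  fixes a b d K p :: real
  assumes "\<bar>a\<bar> \<le> K * (\<bar>b\<bar> + \<bar>d\<bar>)" "1 \<le> K" "0 < p"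
  shows "ennreal (\<bar>a\<bar> powr p) \<le> ennreal ((2 * K) powr p) * (ennreal (\<bar>b\<bar> powr p) + ennreal (\<bar>d\<bar> powr p))"
proof -
  note assms(1)
  also have "K * (\<bar>b\<bar> + \<bar>d\<bar>) \<le> K * (2 * max \<bar>b\<bar> \<bar>d\<bar>)"
    using assms by (intro mult_left_mono) auto
  finally have "\<bar>a\<bar> \<le> 2 * K * max \<bar>b\<bar> \<bar>d\<bar>" by simp
  then have "\<bar>a\<bar> powr p \<le> (2 * K * max \<bar>b\<bar> \<bar>d\<bar>) powr p"
    using assms by (intro powr_mono2) auto
  also have "\<dots> = (2 * K) powr p * max \<bar>b\<bar> \<bar>d\<bar> powr p"
    using assms by (simp add: powr_mult)
  also have "\<dots> \<le> (2 * K) powr p * (\<bar>b\<bar> powr p + \<bar>d\<bar> powr p)"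
    by (intro mult_left_mono) (auto simp: max_def)
  finally show ?thesis
    by (simp add: ennreal_mult[symmetric] ennreal_leI flip: ennreal_plus)
qed

theorem theorem3p1:
  fixes K p0 p p1 C0 N Cw :: real
  assumes "1 \<le> K" and "0 < p0" and "p0 < p" and "p < p1"
  shows "\<exists>C::real. \<forall>(T :: ('a::euclidean_space \<Rightarrow> real) \<Rightarrow> ('a \<Rightarrow> real)) (\<omega> :: 'a \<Rightarrow> real).
     ( (\<forall>f g. Lp p0 f \<longrightarrow> Lp p0 g \<longrightarrow>
          (AE x in lebesgue. \<bar>T (\<lambda>y. f y + g y) x\<bar> \<le> K * (\<bar>T f x\<bar> + \<bar>T g x\<bar>)))
     \<and> Aq_weight (p / p0) Cw \<omega>
     \<and> (\<forall>f. Lp p0 f \<longrightarrow> T f \<in> borel_measurable lebesgue \<and>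
          Lp_norm p0 (T f) \<le> ennreal C0 * Lp_norm p0 f)
     \<and> (\<forall>x r g. 0 < r \<longrightarrow> Linf_c g \<longrightarrow> (AE y in lebesgue. y \<in> ball x (4 * r) \<longrightarrow> g y = 0) \<longrightarrow>
          epow (avg (ball x r) (\<lambda>y. ennreal (\<bar>T g y\<bar> powr p1 * \<omega> y))) (1 / p1)
          \<le> ennreal N *
            (epow (avg (ball x (3 * r)) (\<lambda>y. ennreal (\<bar>T g y\<bar> powr p0))) (1 / p0)
             + (SUP B' \<in> {B'. is_ball B' \<and> ball x r \<subseteq> B'}.
                  epow (avg B' (\<lambda>y. ennreal (\<bar>g y\<bar> powr p0))) (1 / p0)))
            * epow (avg (ball x r) (\<lambda>y. ennreal (\<omega> y))) (1 / p1)) )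
     \<longrightarrow> (\<forall>f. Linf_c f \<longrightarrow>
          (\<integral>\<^sup>+x. ennreal (\<bar>T f x\<bar> powr p * \<omega> x) \<partial>lebesgue)
          \<le> ennreal C * (\<integral>\<^sup>+x. ennreal (\<bar>f x\<bar> powr p * \<omega> x) \<partial>lebesgue))"
proof -
  define q where "q = p / p0"
  define q1 where "q1 = p1 / p0"
  \<comment> \<open>The constants of the quasi-triangle inequality and of the operator bound for
    \<open>p0\<close>-th powers; \<open>max 1\<close> covers a nonpositive
    \<open>C0\<close>.\<close>
  define \<kappa> where "\<kappa> = (2 * K) powr p0"
  define A0 where "A0 = max 1 C0 powr p0"
  \<comment> \<open>The bracket in hypothesis (2), normalised: the first summand is for the average
    of \<open>|T g|^p0\<close> over the three-fold ball, with \<open>4 / 3\<close> the ratio of the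
    radii \<open>4 r\<close> and \<open>3 r\<close>; the summand 1 is for the supremum.\<close>
  define b where "b = (\<kappa> * (1 + A0 * (4 / 3) ^ DIM('a))) powr (1 / p0) + 1"
  define N' where "N' = (max 1 N * b) powr p1"
  have q_bounds: "1 < q" "q < q1" using assms by (auto simp: q_def q1_def divide_strict_right_mono)
  have pos: "0 < p1" "0 < p" using assms by auto
  have \<kappa>: "0 < \<kappa>" and A0: "0 < A0" using assms by (auto simp: \<kappa>_def A0_def)
  have b: "0 < b" by (simp add: b_def add_nonneg_pos)
  have N': "0 < N'" using b by (simp add: N'_def)
  \<comment> \<open>Fixed before \<open>T\<close> and the weight are introduced, as the order of
    quantifiers demands.\<close>
  obtain C where C: "\<And>w F \<phi> \<rho>. good_lambda q (max Cw 1) w q1 \<kappa> A0 N' F \<phi> \<Longrightarrow>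
    mass \<phi> UNIV \<le> mass \<phi> (ball (0 :: 'a) \<rho>) \<Longrightarrow>
    (\<integral>\<^sup>+x. epow (F x) q * ennreal (w x) \<partial>lebesgue) \<le> ennreal C * (\<integral>\<^sup>+x. epow (\<phi> x) q * ennreal (w x) \<partial>lebesgue)"
  proof -
    have "0 < max Cw 1" by simp
    from good_lambda_uniform[where 'a = 'a, OF q_bounds(1) this q_bounds(2) \<kappa> A0 N'] that show ?thesis by blast
  qed
  show ?thesis
  proof (intro exI[of _ C] allI impI, elim conjE)
    fix T :: "('a \<Rightarrow> real) \<Rightarrow> 'a \<Rightarrow> real" and \<omega> f :: "'a \<Rightarrow> real"
    assume sub: "\<forall>f g. Lp p0 f \<longrightarrow> Lp p0 g \<longrightarrow>
          (AE x in lebesgue. \<bar>T (\<lambda>y. f y + g y) x\<bar> \<le> K * (\<bar>T f x\<bar> + \<bar>T g x\<bar>))"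
      and wt: "Aq_weight (p / p0) Cw \<omega>"
      and bd: "\<forall>f. Lp p0 f \<longrightarrow> T f \<in> borel_measurable lebesgue \<and> Lp_norm p0 (T f) \<le> ennreal C0 * Lp_norm p0 f"
      and hyp: "\<forall>x r g. 0 < r \<longrightarrow> Linf_c g \<longrightarrow> (AE y in lebesgue. y \<in> ball x (4 * r) \<longrightarrow> g y = 0) \<longrightarrow>
          epow (avg (ball x r) (\<lambda>y. ennreal (\<bar>T g y\<bar> powr p1 * \<omega> y))) (1 / p1)
          \<le> ennreal N *
            (epow (avg (ball x (3 * r)) (\<lambda>y. ennreal (\<bar>T g y\<bar> powr p0))) (1 / p0)
             + (SUP B' \<in> {B'. is_ball B' \<and> ball x r \<subseteq> B'}.
                  epow (avg B' (\<lambda>y. ennreal (\<bar>g y\<bar> powr p0))) (1 / p0)))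
            * epow (avg (ball x r) (\<lambda>y. ennreal (\<omega> y))) (1 / p1)"
      and f: "Linf_c f"
    have \<omega>0: "0 \<le> \<omega> x" for x using wt by (auto simp: Aq_weight_def)
    have [measurable]: "\<omega> \<in> borel_measurable lebesgue" using wt by (auto simp: Aq_weight_def)
    have [measurable]: "f \<in> borel_measurable lebesgue" using f by (simp add: Linf_c_def)
    have Lpf: "Lp p0 f" using f assms by (intro Linf_c_imp_Lp)
    have T_meas [measurable]: "T g \<in> borel_measurable lebesgue" if "Lp p0 g" for g using bd that by blast
    have T_bd: "mass (\<lambda>x. ennreal (\<bar>T g x\<bar> powr p0)) UNIV \<le> ennreal A0 * mass (\<lambda>x. ennreal (\<bar>g x\<bar> powr p0)) UNIV"
      if "Lp p0 g" for g
    proof -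
      have "Lp_norm p0 (T g) \<le> ennreal (max 1 C0) * Lp_norm p0 g"
        using bd that by (meson ennreal_leI max.cobounded2 mult_right_mono order.trans zero_le)
      then show ?thesis
        using assms by (subst (asm) Lp_norm_le_iff) (auto simp: A0_def mass_def)
    qed
    define \<phi> where "\<phi> x = ennreal (\<bar>f x\<bar> powr p0)" for x
    define F where "F x = ennreal (\<bar>T f x\<bar> powr p0)" for x
    have [measurable]: "\<phi> \<in> borel_measurable lebesgue" "F \<in> borel_measurable lebesgue"
      unfolding \<phi>_def F_def using T_meas[OF Lpf] by measurable
    from Aq_weight_zero_or_pos[OF wt] q_bounds consider
      (zero) "AE x in lebesgue. \<omega> x = 0" | (pos) "AE x in lebesgue. 0 < \<omega> x" by (auto simp: q_def)
    then show "(\<integral>\<^sup>+x. ennreal (\<bar>T f x\<bar> powr p * \<omega> x) \<partial>lebesgue)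
          \<le> ennreal C * (\<integral>\<^sup>+x. ennreal (\<bar>f x\<bar> powr p * \<omega> x) \<partial>lebesgue)"
    proof cases
      case zero
      then have "(\<integral>\<^sup>+x. ennreal (\<bar>T f x\<bar> powr p * \<omega> x) \<partial>lebesgue) = (\<integral>\<^sup>+x. 0 \<partial>(lebesgue :: 'a measure))"
        by (intro nn_integral_cong_AE) (auto elim: eventually_mono)
      then show ?thesis by simp
    next
      case pos'': pos
      define w where "w x = (if \<omega> x = 0 then 1 else \<omega> x)" for x
      have w\<omega>: "AE x in lebesgue. w x = \<omega> x"
        using pos'' by eventually_elim (simp add: w_def)
      interpret muckenhoupt q "max Cw 1" w
        using Aq_weight_muckenhoupt[OF wt] pos'' q_bounds unfolding w_def[abs_def] q_def by blast
      have "good_lambda q (max Cw 1) w q1 \<kappa> A0 N' F \<phi>"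
      proof unfold_locales
        show "q < q1" "0 < \<kappa>" "0 < A0" "0 < N'" by (fact q_bounds(2) \<kappa> A0 N')+
        show "F \<in> borel_measurable lebesgue" "\<phi> \<in> borel_measurable lebesgue" by measurable
        show "mass F UNIV \<le> ennreal A0 * mass \<phi> UNIV"
          using T_bd[OF Lpf] unfolding F_def \<phi>_def .
        show "mass \<phi> UNIV < top" using Lpf by (simp add: Lp_def \<phi>_def mass_def)
        fix x :: 'a and r :: real
        assume r: "0 < r"
        define g where "g y = f y * indicator (- ball x (4 * r)) y" for y
        define h where "h y = f y * indicator (ball x (4 * r)) y" for y
        have g: "Linf_c g" and h: "Linf_c h"
          unfolding g_def h_def by (intro Linf_c_restrict f; simp)+
        \<comment> \<open>No homogeneity of \<open>T\<close> is available to relate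
          \<open>T (- h)\<close> to \<open>T h\<close>, so the function \<open>- h\<close> is
          carried along separately.\<close>
        have h': "Linf_c (\<lambda>y. - h y)" using h by (simp add: Linf_c_def)
        have Lpg: "Lp p0 g" "Lp p0 h" "Lp p0 (\<lambda>y. - h y)"
          using g h h' assms by (auto intro: Linf_c_imp_Lp)
        note [measurable] = T_meas[OF Lpg(1)] T_meas[OF Lpg(2)] T_meas[OF Lpg(3)] T_meas[OF Lpf]
        define G where "G y = ennreal (\<bar>T g y\<bar> powr p0)" for y
        define R where "R y = ennreal (\<bar>T h y\<bar> powr p0)" for y
        define R' where "R' y = ennreal (\<bar>T (\<lambda>y. - h y) y\<bar> powr p0)" for y
        have [measurable]: "G \<in> borel_measurable lebesgue" "R \<in> borel_measurable lebesgue" "R' \<in> borel_measurable lebesgue"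
          unfolding G_def R_def R'_def by measurable
        have mass_h: "mass (\<lambda>y. ennreal (\<bar>h y\<bar> powr p0)) UNIV = mass \<phi> (ball x (4 * r))"
          unfolding mass_def h_def \<phi>_def by (intro nn_integral_cong) (auto split: split_indicator)
        have R: "mass R UNIV \<le> ennreal A0 * mass \<phi> (ball x (4 * r))"
          using T_bd[OF Lpg(2)] unfolding R_def mass_h .
        have R': "mass R' UNIV \<le> ennreal A0 * mass \<phi> (ball x (4 * r))"
          using T_bd[OF Lpg(3)] unfolding R'_def by (simp add: mass_h)
        have FGR: "AE y in lebesgue. F y \<le> ennreal \<kappa> * (G y + R y)"
        proof -
          have "(\<lambda>y. g y + h y) = f" by (auto simp: g_def h_def fun_eq_iff split: split_indicator)
          then have "AE y in lebesgue. \<bar>T f y\<bar> \<le> K * (\<bar>T g y\<bar> + \<bar>T h y\<bar>)"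
            using sub Lpg by metis
          then show ?thesis
            unfolding F_def G_def R_def \<kappa>_def
            by eventually_elim (intro quasi_triangle_powr assms)
        qed
        \<comment> \<open>Hypothesis (2) bounds \<open>T g\<close> by its own average on the
          three-fold ball; writing \<open>g = f + (- h)\<close> leads back to
          \<open>F\<close>.\<close>
        have GFR: "AE y in lebesgue. G y \<le> ennreal \<kappa> * (F y + R' y)"
        proof -
          have "(\<lambda>y. f y + - h y) = g" by (auto simp: g_def h_def fun_eq_iff split: split_indicator)
          then have "AE y in lebesgue. \<bar>T g y\<bar> \<le> K * (\<bar>T f y\<bar> + \<bar>T (\<lambda>y. - h y) y\<bar>)"
            using sub Lpg Lpf by metis
          then show ?thesis
            unfolding F_def G_def R'_def \<kappa>_def
            by eventually_elim (intro quasi_triangle_powr assms)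
        qed
        have "mass (\<lambda>y. epow (G y) q1 * W y) (ball x r) \<le> ennreal (N' * m powr q1) * mass W (ball x r)"
          if m: "0 < m" and F3: "mass F (ball x (3 * r)) \<le> ennreal m * emeasure lebesgue (ball x (3 * r))"
            and \<phi>m: "\<forall>y s. ball x r \<subseteq> ball y s \<longrightarrow> mass \<phi> (ball y s) \<le> ennreal m * emeasure lebesgue (ball y s)" for m
        proof -
          let ?B = "ball x r" and ?B3 = "ball x (3 * r)"
          have vol: "0 < emeasure lebesgue (ball y s)" "emeasure lebesgue (ball y s) < top" if "0 < s" for y :: 'a and s
            using that by (auto intro: emeasure_lebesgue_ball_pos emeasure_lebesgue_ball_finite)
          have "mass G ?B3 \<le> mass (\<lambda>y. ennreal \<kappa> * (F y + R' y)) ?B3"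
            using GFR by (intro mass_mono_fun_AE) (auto elim: eventually_mono)
          also have "\<dots> = ennreal \<kappa> * (mass F ?B3 + mass R' ?B3)"
            by (subst mass_cmult, measurable) (subst mass_add, auto)
          also have "\<dots> \<le> ennreal \<kappa> * (ennreal m * emeasure lebesgue ?B3 + ennreal (A0 * (m * (4 / 3) ^ DIM('a))) * emeasure lebesgue ?B3)"
          proof (intro mult_left_mono add_mono F3)
            have "mass R' ?B3 \<le> mass R' UNIV" by (rule mass_mono) simp
            also have "\<dots> \<le> ennreal A0 * mass \<phi> (ball x (4 * r))" by (rule R')
            also have "\<dots> \<le> ennreal A0 * (ennreal m * emeasure lebesgue (ball x ((4 / 3) * (3 * r))))"
              using r \<phi>m[rule_format, of x "4 * r"] by (intro mult_left_mono) (auto simp: subset_ball)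
            also have "emeasure lebesgue (ball x ((4 / 3) * (3 * r))) = ennreal ((4 / 3) ^ DIM('a)) * emeasure lebesgue ?B3"
              using r by (intro emeasure_lebesgue_ball_scale) auto
            also have "ennreal A0 * (ennreal m * (ennreal ((4 / 3) ^ DIM('a)) * emeasure lebesgue ?B3)) =
                ennreal (A0 * (m * (4 / 3) ^ DIM('a))) * emeasure lebesgue ?B3"
              using A0 m by (simp only: ennreal_mult less_imp_le mult.assoc mult_nonneg_nonneg zero_le_power zero_le_divide_iff zero_le_numeral simp_thms)
            finally show "mass R' ?B3 \<le> ennreal (A0 * (m * (4 / 3) ^ DIM('a))) * emeasure lebesgue ?B3" .
          qed simp
          also have "\<dots> = ennreal (m * (\<kappa> * (1 + A0 * (4 / 3) ^ DIM('a)))) * emeasure lebesgue ?B3"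
          proof -
            have "m * (\<kappa> * (1 + A0 * (4 / 3) ^ DIM('a))) = \<kappa> * (m + A0 * (m * (4 / 3) ^ DIM('a)))"
              by (simp add: algebra_simps)
            then have "ennreal (m * (\<kappa> * (1 + A0 * (4 / 3) ^ DIM('a)))) = ennreal \<kappa> * (ennreal m + ennreal (A0 * (m * (4 / 3) ^ DIM('a))))"
              using \<kappa> A0 m by (simp only: ennreal_mult less_imp_le add_nonneg_nonneg mult_nonneg_nonneg zero_le_power zero_le_divide_iff zero_le_numeral simp_thms ennreal_plus)
            then show ?thesis by (simp only: distrib_right mult.assoc)
          qed
          finally have "avg ?B3 G \<le> ennreal (m * (\<kappa> * (1 + A0 * (4 / 3) ^ DIM('a))))"
            unfolding avg_eq using vol r by (subst ennreal_divide_le_iff) auto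
          then have "epow (avg ?B3 G) (1 / p0) \<le> epow (ennreal (m * (\<kappa> * (1 + A0 * (4 / 3) ^ DIM('a))))) (1 / p0)"
            using assms by (intro epow_mono) auto
          also have "\<dots> = ennreal (m powr (1 / p0) * (\<kappa> * (1 + A0 * (4 / 3) ^ DIM('a))) powr (1 / p0))"
            using m \<kappa> A0 by (simp add: powr_mult)
          finally have avgG: "epow (avg ?B3 G) (1 / p0) \<le> \<dots>" .
          have sup: "(SUP B' \<in> {B'. is_ball B' \<and> ?B \<subseteq> B'}. epow (avg B' (\<lambda>y. ennreal (\<bar>g y\<bar> powr p0))) (1 / p0))
             \<le> ennreal (m powr (1 / p0))"
          proof (rule SUP_least)
            fix B' assume "B' \<in> {B'. is_ball B' \<and> ?B \<subseteq> B'}"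
            then obtain y s where B': "B' = ball y s" "0 < s" "?B \<subseteq> ball y s" by (auto simp: is_ball_def)
            have "mass (\<lambda>y. ennreal (\<bar>g y\<bar> powr p0)) B' \<le> mass \<phi> B'"
              unfolding \<phi>_def g_def by (rule mass_mono_fun) (auto split: split_indicator)
            also have "\<dots> \<le> ennreal m * emeasure lebesgue B'" using \<phi>m B' by simp
            finally have "avg B' (\<lambda>y. ennreal (\<bar>g y\<bar> powr p0)) \<le> ennreal m"
              unfolding avg_eq using vol B' by (subst ennreal_divide_le_iff) auto
            then have "epow (avg B' (\<lambda>y. ennreal (\<bar>g y\<bar> powr p0))) (1 / p0) \<le> epow (ennreal m) (1 / p0)"
              using assms by (intro epow_mono) auto
            then show "epow (avg B' (\<lambda>y. ennreal (\<bar>g y\<bar> powr p0))) (1 / p0) \<le> ennreal (m powr (1 / p0))"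
              using m by simp
          qed
          have "AE y in lebesgue. y \<in> ball x (4 * r) \<longrightarrow> g y = 0" by (simp add: g_def)
          with hyp r g have "epow (avg ?B (\<lambda>y. ennreal (\<bar>T g y\<bar> powr p1 * \<omega> y))) (1 / p1)
            \<le> ennreal N * (epow (avg ?B3 (\<lambda>y. ennreal (\<bar>T g y\<bar> powr p0))) (1 / p0)
             + (SUP B' \<in> {B'. is_ball B' \<and> ?B \<subseteq> B'}. epow (avg B' (\<lambda>y. ennreal (\<bar>g y\<bar> powr p0))) (1 / p0)))
            * epow (avg ?B (\<lambda>y. ennreal (\<omega> y))) (1 / p1)" by blast
          also have "\<dots> \<le> ennreal (max 1 N) * (ennreal (m powr (1 / p0) * (\<kappa> * (1 + A0 * (4 / 3) ^ DIM('a))) powr (1 / p0)) + ennreal (m powr (1 / p0)))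
            * epow (avg ?B (\<lambda>y. ennreal (\<omega> y))) (1 / p1)"
            using avgG[unfolded G_def[abs_def]] sup by (intro mult_mono add_mono ennreal_leI) auto
          also have "ennreal (m powr (1 / p0) * (\<kappa> * (1 + A0 * (4 / 3) ^ DIM('a))) powr (1 / p0)) + ennreal (m powr (1 / p0)) =
              ennreal (m powr (1 / p0) * b)"
            by (subst ennreal_plus[symmetric]) (auto simp: b_def distrib_left)
          finally have "avg ?B (\<lambda>y. ennreal (\<bar>T g y\<bar> powr p1 * \<omega> y)) \<le>
            epow (ennreal (max 1 N) * ennreal (m powr (1 / p0) * b) * epow (avg ?B (\<lambda>y. ennreal (\<omega> y))) (1 / p1)) p1"
            using pos by (subst (asm) epow_le_iff) auto
          also have "\<dots> = ennreal (N' * m powr q1) * avg ?B (\<lambda>y. ennreal (\<omega> y))"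
            using pos b m by (simp add: epow_mult epow_epow N'_def q1_def powr_mult powr_powr ennreal_mult mult_ac)
          finally have "mass (\<lambda>y. ennreal (\<bar>T g y\<bar> powr p1 * \<omega> y)) ?B \<le> ennreal (N' * m powr q1) * avg ?B (\<lambda>y. ennreal (\<omega> y)) * emeasure lebesgue ?B"
            unfolding avg_eq[of ?B "\<lambda>y. ennreal (\<bar>T g y\<bar> powr p1 * \<omega> y)"] using vol r by (subst (asm) ennreal_divide_le_iff) auto
          also have "avg ?B (\<lambda>y. ennreal (\<omega> y)) * emeasure lebesgue ?B = mass (\<lambda>y. ennreal (\<omega> y)) ?B"
            unfolding avg_eq using vol[OF r, of x]
              ennreal_divide_times[of "mass (\<lambda>y. ennreal (\<omega> y)) ?B" "emeasure lebesgue ?B" "emeasure lebesgue ?B"] by simp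
          then have "ennreal (N' * m powr q1) * avg ?B (\<lambda>y. ennreal (\<omega> y)) * emeasure lebesgue ?B = ennreal (N' * m powr q1) * mass (\<lambda>y. ennreal (\<omega> y)) ?B"
            by (simp only: mult.assoc)
          also have "mass (\<lambda>y. ennreal (\<omega> y)) ?B = mass W ?B"
            using w\<omega> by (intro mass_cong_AE) (auto elim: eventually_mono)
          finally have "mass (\<lambda>y. ennreal (\<bar>T g y\<bar> powr p1 * \<omega> y)) ?B \<le> ennreal (N' * m powr q1) * mass W ?B" .
          moreover have "mass (\<lambda>y. ennreal (\<bar>T g y\<bar> powr p1 * \<omega> y)) ?B = mass (\<lambda>y. epow (G y) q1 * W y) ?B"
          proof (rule mass_cong_AE, use w\<omega> in eventually_elim)
            case (elim y)
            then show ?case using assms \<omega>0[of y] by (simp add: G_def q1_def powr_powr ennreal_mult)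
          qed
          ultimately show ?thesis by simp
        qed
        with FGR R show "\<exists>G R. G \<in> borel_measurable lebesgue \<and> R \<in> borel_measurable lebesgue \<and>
          (AE y in lebesgue. F y \<le> ennreal \<kappa> * (G y + R y)) \<and>
          mass R UNIV \<le> ennreal A0 * mass \<phi> (ball x (4 * r)) \<and>
          (\<forall>m>0. mass F (ball x (3 * r)) \<le> ennreal m * emeasure lebesgue (ball x (3 * r)) \<and>
            (\<forall>y s. ball x r \<subseteq> ball y s \<longrightarrow> mass \<phi> (ball y s) \<le> ennreal m * emeasure lebesgue (ball y s)) \<longrightarrow>
            mass (\<lambda>y. epow (G y) q1 * W y) (ball x r) \<le> ennreal (N' * m powr q1) * mass W (ball x r))"
          by (intro exI[of _ G] exI[of _ R]) auto
      qed
      moreover obtain \<rho> where "mass \<phi> UNIV \<le> mass \<phi> (ball 0 \<rho>)"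
      proof -
        obtain S where S: "compact S" "AE x in lebesgue. x \<notin> S \<longrightarrow> f x = 0"
          using f by (auto simp: Linf_c_def)
        obtain \<rho> where \<rho>: "S \<subseteq> ball 0 \<rho>"
          using compact_imp_bounded[OF S(1)] bounded_subset_ballD by blast
        have "mass \<phi> UNIV \<le> mass \<phi> (ball 0 \<rho>)"
          unfolding mass_def
        proof (rule nn_integral_mono_AE, use S(2) in eventually_elim)
          case (elim x)
          then show ?case using \<rho> by (cases "x \<in> S") (auto simp: \<phi>_def)
        qed
        then show ?thesis by (rule that)
      qed
      ultimately have *: "(\<integral>\<^sup>+x. epow (F x) q * ennreal (w x) \<partial>lebesgue) \<le> ennreal C * (\<integral>\<^sup>+x. epow (\<phi> x) q * ennreal (w x) \<partial>lebesgue)"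
        by (rule C)
      have eq: "(\<integral>\<^sup>+x. epow (ennreal (\<bar>u x\<bar> powr p0)) q * ennreal (w x) \<partial>lebesgue) = (\<integral>\<^sup>+x. ennreal (\<bar>u x\<bar> powr p * \<omega> x) \<partial>lebesgue)" for u :: "'a \<Rightarrow> real"
      proof (rule nn_integral_cong_AE, use w\<omega> in eventually_elim)
        case (elim x)
        then show ?case using assms \<omega>0[of x] by (simp add: q_def powr_powr ennreal_mult)
      qed
      show ?thesis using * unfolding F_def \<phi>_def eq .
    qed
  qed
qed

end
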